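(* Let $\Omega\subset\mathbb{R}^2$ be a smooth bounded domain and suppose that $\varphi\in C^2_c(\mathbb{R}^2)$ and $u\in W^{2,2}(\Omega)$ satisfy $u-\varphi\in\mathring W^{2,2}(\Omega)$. Let $\gamma:I\to\partial\Omega$ be a parametrization of the boundary $\partial\Omega$ by arclength. Let $K>0$ and assume that $$\|(\varphi\circ\gamma)'\|_{L^1(I)}<K.$$ Then for every $\varepsilon>0$ there exists $\delta=\delta(\varepsilon,K,\Omega)>0$ (depending only on $\varepsilon,K,\Omega$, and not on $u$ or $\varphi$) such that $$\mathcal W(u)+\|\varphi\|_{L^1(\partial\Omega)}\le\delta\quad\Rightarrow\quad\|u\|_{L^2(\Omega)}<\varepsilon.$$
   Context: For $u\in W^{2,2}(\Omega)$: $Q=\sqrt{1+|\nabla u|^2}$, $H=\operatorname{div}(\nabla u/Q)$ is the mean curvature of the graph of $u$, and $\mathcal W(u)=\frac14\int_\Omega H^2Q\,dx$ is its Willmore energy. $\mathring W^{2,2}(\Omega)$ denotes the closure of $C_c^\infty(\Omega)$ in $W^{2,2}(\Omega)$. *)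

theory Defs
  imports "HOL-Analysis.Analysis"
begin

definition partial :: "'a::euclidean_space \<Rightarrow> ('a \<Rightarrow> real) \<Rightarrow> 'a \<Rightarrow> real" where
  "partial b f x = frechet_derivative f (at x) b"

definition grad :: "('a::euclidean_space \<Rightarrow> real) \<Rightarrow> 'a \<Rightarrow> 'a" where
  "grad f x = (\<Sum>b\<in>Basis. partial b f x *\<^sub>R b)"

fun C_k :: "nat \<Rightarrow> ('a::euclidean_space \<Rightarrow> real) \<Rightarrow> bool" where
  "C_k 0 f \<longleftrightarrow> continuous_on UNIV f"
| "C_k (Suc k) f \<longleftrightarrow> f differentiable_on UNIV \<and> (\<forall>b\<in>Basis. C_k k (partial b f))"

definition C_infinity :: "('a::euclidean_space \<Rightarrow> real) \<Rightarrow> bool" where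
  "C_infinity f \<longleftrightarrow> (\<forall>k. C_k k f)"

definition supp :: "('a::euclidean_space \<Rightarrow> real) \<Rightarrow> 'a set" where
  "supp f = closure {x. f x \<noteq> 0}"

text \<open>Elements of \<open>C\<^sub>c\<^sup>\<infinity>(\<Omega>)\<close> are represented by their extension by zero to the whole space.\<close>

definition test_function :: "'a::euclidean_space set \<Rightarrow> ('a \<Rightarrow> real) \<Rightarrow> bool" where
  "test_function \<Omega> \<psi> \<longleftrightarrow> C_infinity \<psi> \<and> compact (supp \<psi>) \<and> supp \<psi> \<subseteq> \<Omega>"

definition C2_compact :: "('a::euclidean_space \<Rightarrow> real) \<Rightarrow> bool" where
  "C2_compact f \<longleftrightarrow> C_k 2 f \<and> compact (supp f)"

text \<open>Functions on \<open>\<Omega>\<close> are total functions of which only the values almost everywhere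
  in \<open>\<Omega>\<close> matter.\<close>

definition locally_integrable ::
    "'a::euclidean_space set \<Rightarrow> ('a \<Rightarrow> 'b::{banach, second_countable_topology}) \<Rightarrow> bool" where
  "locally_integrable \<Omega> f \<longleftrightarrow> (\<forall>C. compact C \<and> C \<subseteq> \<Omega> \<longrightarrow> integrable (lebesgue_on C) f)"

definition in_L2 :: "'a::euclidean_space set \<Rightarrow> ('a \<Rightarrow> real) \<Rightarrow> bool" where
  "in_L2 \<Omega> f \<longleftrightarrow> f \<in> borel_measurable (lebesgue_on \<Omega>) \<and> integrable (lebesgue_on \<Omega>) (\<lambda>x. (f x)\<^sup>2)"

definition L2_norm_on :: "'a::euclidean_space set \<Rightarrow> ('a \<Rightarrow> real) \<Rightarrow> real" where
  "L2_norm_on \<Omega> f = sqrt (LINT x|lebesgue_on \<Omega>. (f x)\<^sup>2)"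

definition has_weak_partial ::
    "'a::euclidean_space set \<Rightarrow> 'a \<Rightarrow> ('a \<Rightarrow> real) \<Rightarrow> ('a \<Rightarrow> real) \<Rightarrow> bool" where
  "has_weak_partial \<Omega> b u v \<longleftrightarrow> locally_integrable \<Omega> u \<and> locally_integrable \<Omega> v \<and>
     (\<forall>\<psi>. test_function \<Omega> \<psi> \<longrightarrow>
        (LINT x|lebesgue_on \<Omega>. u x * partial b \<psi> x) = - (LINT x|lebesgue_on \<Omega>. v x * \<psi> x))"

text \<open>The weak partial derivative is unique up to null sets if it exists; the choice of
  representative is immaterial below.\<close>

definition weak_partial :: "'a::euclidean_space set \<Rightarrow> 'a \<Rightarrow> ('a \<Rightarrow> real) \<Rightarrow> 'a \<Rightarrow> real" where
  "weak_partial \<Omega> b u = (SOME v. has_weak_partial \<Omega> b u v)"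

definition weak_grad :: "'a::euclidean_space set \<Rightarrow> ('a \<Rightarrow> real) \<Rightarrow> 'a \<Rightarrow> 'a" where
  "weak_grad \<Omega> u x = (\<Sum>b\<in>Basis. weak_partial \<Omega> b u x *\<^sub>R b)"

definition has_weak_div :: "'a::euclidean_space set \<Rightarrow> ('a \<Rightarrow> 'a) \<Rightarrow> ('a \<Rightarrow> real) \<Rightarrow> bool" where
  "has_weak_div \<Omega> F h \<longleftrightarrow> locally_integrable \<Omega> F \<and> locally_integrable \<Omega> h \<and>
     (\<forall>\<psi>. test_function \<Omega> \<psi> \<longrightarrow>
        (LINT x|lebesgue_on \<Omega>. F x \<bullet> grad \<psi> x) = - (LINT x|lebesgue_on \<Omega>. h x * \<psi> x))"

definition weak_div :: "'a::euclidean_space set \<Rightarrow> ('a \<Rightarrow> 'a) \<Rightarrow> 'a \<Rightarrow> real" where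
  "weak_div \<Omega> F = (SOME h. has_weak_div \<Omega> F h)"

text \<open>The Sobolev space \<open>W\<^sup>k\<^sup>,\<^sup>2(\<Omega>)\<close>, its squared norm (the sum of the squared \<open>L\<^sup>2\<close>-norms of all
  iterated weak partial derivatives of order at most \<open>k\<close>), and the closure of
  \<open>C\<^sub>c\<^sup>\<infinity>(\<Omega>)\<close> in it.\<close>

fun in_sobolev :: "nat \<Rightarrow> 'a::euclidean_space set \<Rightarrow> ('a \<Rightarrow> real) \<Rightarrow> bool" where
  "in_sobolev 0 \<Omega> u \<longleftrightarrow> in_L2 \<Omega> u"
| "in_sobolev (Suc k) \<Omega> u \<longleftrightarrow>
     in_L2 \<Omega> u \<and> (\<forall>b\<in>Basis. \<exists>v. has_weak_partial \<Omega> b u v \<and> in_sobolev k \<Omega> v)"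

fun sobolev_norm_sq :: "nat \<Rightarrow> 'a::euclidean_space set \<Rightarrow> ('a \<Rightarrow> real) \<Rightarrow> real" where
  "sobolev_norm_sq 0 \<Omega> u = (L2_norm_on \<Omega> u)\<^sup>2"
| "sobolev_norm_sq (Suc k) \<Omega> u =
     (L2_norm_on \<Omega> u)\<^sup>2 + (\<Sum>b\<in>Basis. sobolev_norm_sq k \<Omega> (weak_partial \<Omega> b u))"

definition sobolev_norm :: "nat \<Rightarrow> 'a::euclidean_space set \<Rightarrow> ('a \<Rightarrow> real) \<Rightarrow> real" where
  "sobolev_norm k \<Omega> u = sqrt (sobolev_norm_sq k \<Omega> u)"

definition in_sobolev_0 :: "nat \<Rightarrow> 'a::euclidean_space set \<Rightarrow> ('a \<Rightarrow> real) \<Rightarrow> bool" where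
  "in_sobolev_0 k \<Omega> u \<longleftrightarrow> in_sobolev k \<Omega> u \<and>
     (\<forall>e>0. \<exists>\<psi>. test_function \<Omega> \<psi> \<and> sobolev_norm k \<Omega> (\<lambda>x. \<psi> x - u x) < e)"

definition area_element :: "'a::euclidean_space set \<Rightarrow> ('a \<Rightarrow> real) \<Rightarrow> 'a \<Rightarrow> real" where
  "area_element \<Omega> u x = sqrt (1 + (norm (weak_grad \<Omega> u x))\<^sup>2)"

definition graph_mean_curvature :: "'a::euclidean_space set \<Rightarrow> ('a \<Rightarrow> real) \<Rightarrow> 'a \<Rightarrow> real" where
  "graph_mean_curvature \<Omega> u = weak_div \<Omega> (\<lambda>x. weak_grad \<Omega> u x /\<^sub>R area_element \<Omega> u x)"

text \<open>The energy takes values in \<open>[0,\<infinity>]\<close>, so that it cannot degenerate to zero through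
  non-integrability.\<close>

definition willmore :: "'a::euclidean_space set \<Rightarrow> ('a \<Rightarrow> real) \<Rightarrow> ennreal" where
  "willmore \<Omega> u = ennreal (1/4) *
     (\<integral>\<^sup>+x. ennreal ((graph_mean_curvature \<Omega> u x)\<^sup>2 * area_element \<Omega> u x) \<partial>lebesgue_on \<Omega>)"

text \<open>Near each boundary point, in suitable orthonormal coordinates, the domain is the
  part of a ball that lies above the graph of a smooth function of one variable.\<close>

definition smooth_bounded_domain :: "(real^2) set \<Rightarrow> bool" where
  "smooth_bounded_domain \<Omega> \<longleftrightarrow> open \<Omega> \<and> connected \<Omega> \<and> \<Omega> \<noteq> {} \<and> bounded \<Omega> \<and>
     (\<forall>p\<in>frontier \<Omega>. \<exists>r>0. \<exists>T :: real^2 \<Rightarrow> real^2. \<exists>g :: real \<Rightarrow> real.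
        orthogonal_transformation T \<and> C_infinity g \<and>
        \<Omega> \<inter> ball p r = {x \<in> ball p r. T x $ 2 > g (T x $ 1)})"

text \<open>A smooth bounded domain need not be simply connected, so its boundary may consist of
  several closed curves. The parameter domain \<open>I\<close> is the disjoint union of the
  intervals \<open>[a k, b k)\<close>, \<open>k < n\<close>, and \<open>\<gamma> k\<close> runs once through the \<open>k\<close>-th curve at unit speed.\<close>

definition arclength_parametrization ::
    "nat \<Rightarrow> (nat \<Rightarrow> real) \<Rightarrow> (nat \<Rightarrow> real) \<Rightarrow> (nat \<Rightarrow> real \<Rightarrow> real^2) \<Rightarrow> (real^2) set \<Rightarrow> bool" where
  "arclength_parametrization n a b \<gamma> S \<longleftrightarrow>
     (\<forall>k<n. a k < b k \<and> \<gamma> k (a k) = \<gamma> k (b k) \<and> inj_on (\<gamma> k) {a k..<b k} \<and>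
        (\<exists>\<gamma>'. continuous_on {a k..b k} \<gamma>' \<and>
           (\<forall>t\<in>{a k..b k}. (\<gamma> k has_vector_derivative \<gamma>' t) (at t within {a k..b k}) \<and>
                           norm (\<gamma>' t) = 1))) \<and>
     (\<forall>j<n. \<forall>k<n. j \<noteq> k \<longrightarrow> \<gamma> j ` {a j..b j} \<inter> \<gamma> k ` {a k..b k} = {}) \<and>
     (\<Union>k<n. \<gamma> k ` {a k..b k}) = S"

text \<open>The \<open>L\<^sup>1\<close>-norm on the parametrized curves with respect to arclength, and the
  \<open>L\<^sup>1\<close>-norm on \<open>I\<close> of the derivative along them.\<close>

definition L1_boundary_norm ::
    "nat \<Rightarrow> (nat \<Rightarrow> real) \<Rightarrow> (nat \<Rightarrow> real) \<Rightarrow> (nat \<Rightarrow> real \<Rightarrow> real^2) \<Rightarrow> (real^2 \<Rightarrow> real) \<Rightarrow> real" where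
  "L1_boundary_norm n a b \<gamma> f =
     (\<Sum>k<n. LINT t|lebesgue_on {a k..b k}. \<bar>f (\<gamma> k t)\<bar>)"

definition L1_tangential_norm ::
    "nat \<Rightarrow> (nat \<Rightarrow> real) \<Rightarrow> (nat \<Rightarrow> real) \<Rightarrow> (nat \<Rightarrow> real \<Rightarrow> real^2) \<Rightarrow> (real^2 \<Rightarrow> real) \<Rightarrow> real" where
  "L1_tangential_norm n a b \<gamma> f =
     (\<Sum>k<n. LINT t|lebesgue_on {a k..b k}.
        \<bar>vector_derivative (f \<circ> \<gamma> k) (at t within {a k..b k})\<bar>)"

end

theory Submission
  imports Defs "HOL-Computational_Algebra.Polynomial"
begin

text \<open>
  Write \<open>Q = sqrt (1 + |\<nabla>u|\<^sup>2)\<close>, let \<open>H\<close> be the divergence of \<open>\<nabla>u / Q\<close>, and let \<open>D\<close> be the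
  \<open>L\<^sup>1\<close>-norm of the boundary values. Testing the equation \<open>div (\<nabla>u / Q) = H\<close> with \<open>u\<close> itself
  gives, because \<open>|\<nabla>u / Q| \<le> 1\<close>,

  \<open>\<integral> |\<nabla>u|\<^sup>2 / Q  \<le>  \<integral> |H| |u| + C D  \<le>  \<parallel>H\<parallel>\<^sub>2 \<parallel>u\<parallel>\<^sub>2 + C D\<close>,

  and \<open>\<parallel>H\<parallel>\<^sub>2 \<le> 2 \<surd>W(u)\<close> since \<open>Q \<ge> 1\<close>. The Sobolev inequality in the plane, applied to \<open>u\<close>
  cut off at the boundary, gives \<open>\<parallel>u\<parallel>\<^sub>2 \<le> \<integral> |\<nabla>u| + C D\<close>. The two are linked by the pointwise bound
  \<open>|\<nabla>u| \<le> \<tau> + (1 + \<tau>) / \<tau> \<cdot> |\<nabla>u|\<^sup>2 / Q\<close>, valid for every \<open>\<tau> > 0\<close>. So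
  \<open>\<parallel>u\<parallel>\<^sub>2 \<le> \<tau> |\<Omega>| + c\<^sub>\<tau> (\<parallel>H\<parallel>\<^sub>2 \<parallel>u\<parallel>\<^sub>2 + C D) + C D\<close>. One fixes \<open>\<tau>\<close> so that \<open>\<tau> |\<Omega>|\<close> is small
  and then takes \<open>\<delta>\<close> so small that the term with \<open>\<parallel>u\<parallel>\<^sub>2\<close> is absorbed on the left
  (\<open>absorption\<close>). The constants depend on \<open>\<Omega>\<close> only through its area.

  Both estimates involve boundary values. They are obtained without a trace theorem: the
  approximations \<open>v\<^sub>i = \<psi>\<^sub>i + \<phi>\<close> of \<open>u\<close> in \<open>W\<^sup>2\<^sup>,\<^sup>2\<close> (\<open>exists_W22_approx\<close>) are \<open>C\<^sup>2\<close> on the whole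
  plane and coincide with \<open>\<phi>\<close> on the boundary, and for such a function \<open>w\<close> there are \<open>C\<^sup>1\<close>
  cutoffs \<open>\<eta>\<close> with compact support in \<open>\<Omega>\<close> for which \<open>\<integral> |w| |\<nabla>\<eta>|\<close> is at most a constant times
  the integral of \<open>|w|\<close> along the boundary curves, up to an arbitrarily small error
  (\<open>boundary_cutoffs\<close>). The cutoffs vanish on small balls around equally spaced points of the
  boundary curves and equal \<open>1\<close> a little further away.
  The product \<open>\<eta> w\<close> is then used as a test function (\<open>boundary_energy_and_sobolev\<close>), and the
  limits are taken first in \<open>\<eta>\<close>, then in \<open>i\<close> (\<open>limit_energy_and_sobolev\<close>).

  The weak derivatives and the weak divergence in the definition of the energy are arbitrary
  choices among the functions with the right test integrals. The fundamental lemma of the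
  calculus of variations (\<open>fundamental_lemma_variations\<close>) makes them unique up to null sets, and
  the chain rule for \<open>W\<^sup>2\<^sup>,\<^sup>2\<close> functions, obtained from the same approximations, shows that the
  chosen mean curvature is the expected expression in the first and second weak derivatives
  (\<open>graph_mean_curvature_AE\<close>); in particular a weak divergence exists.
\<close>

section \<open>Calculus of \<open>C\<^sup>k\<close> functions\<close>

lemma partial_eqI:
  "(f has_derivative D) (at x) \<Longrightarrow> partial b f x = D b"
  unfolding partial_def using frechet_derivative_at by metis

lemma grad_inner_Basis: "b \<in> Basis \<Longrightarrow> grad f x \<bullet> b = partial b f x"
  by (simp add: grad_def inner_sum_left_Basis)

lemma has_derivative_grad:
  fixes f :: "'a::euclidean_space \<Rightarrow> real"
  assumes "f differentiable at x"
  shows "(f has_derivative (\<lambda>h. grad f x \<bullet> h)) (at x)"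
proof -
  define D where "D = frechet_derivative f (at x)"
  have D: "(f has_derivative D) (at x)"
    using assms unfolding D_def by (simp add: frechet_derivative_works)
  then have lin: "linear D" by (rule has_derivative_linear)
  have "D h = grad f x \<bullet> h" for h
  proof -
    have "D h = D (\<Sum>b\<in>Basis. (h \<bullet> b) *\<^sub>R b)" by (simp add: euclidean_representation)
    also have "\<dots> = (\<Sum>b\<in>Basis. (h \<bullet> b) * D b)"
      using lin by (simp add: linear_sum linear_scale)
    also have "\<dots> = grad f x \<bullet> h"
      unfolding grad_def partial_def D_def[symmetric]
      by (simp add: inner_sum_left inner_sum_right inner_commute mult.commute)
    finally show ?thesis .
  qed
  then have "D = (\<lambda>h. grad f x \<bullet> h)" by auto
  with D show ?thesis by simp
qed

lemma C_k_Suc_differentiable: "C_k (Suc k) f \<Longrightarrow> f differentiable at x"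
  by (simp add: differentiable_on_def)

lemma C_k_Suc_partial: "C_k (Suc k) f \<Longrightarrow> b \<in> Basis \<Longrightarrow> C_k k (partial b f)"
  by simp

lemma C_k_SucI:
  assumes "\<And>x. (f has_derivative D x) (at x)" "\<And>b. b \<in> Basis \<Longrightarrow> C_k k (\<lambda>x. D x b)"
  shows "C_k (Suc k) f"
proof -
  have "partial b f = (\<lambda>x. D x b)" for b
    using partial_eqI[OF assms(1)] by auto
  then show ?thesis
    using assms by (auto simp: differentiable_on_def differentiable_def)
qed

lemma C_k_continuous: "C_k k f \<Longrightarrow> continuous_on UNIV f"
  by (cases k) (auto intro: differentiable_imp_continuous_on)

lemma C_k_SucD: "C_k (Suc k) f \<Longrightarrow> C_k k f"
proof (induction k arbitrary: f)
  case 0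
  then show ?case using C_k_continuous[of "Suc 0"] by simp
next
  case (Suc k)
  then have "C_k k (partial b f)" if "b \<in> Basis" for b
    using that by simp
  moreover have "f differentiable_on UNIV" using Suc.prems by simp
  ultimately show ?case by simp
qed

lemma C_2_imp_C_1: "C_k 2 f \<Longrightarrow> C_k (Suc 0) f"
  using C_k_SucD[of "Suc 0" f] by (simp only: numeral_2_eq_2)

lemma C_2_partial: "C_k 2 f \<Longrightarrow> b \<in> Basis \<Longrightarrow> C_k (Suc 0) (partial b f)"
  using C_k_Suc_partial[of "Suc 0" f b] by (simp only: numeral_2_eq_2)

lemma partial_mult:
  assumes "f differentiable at x" "g differentiable at x"
  shows "partial b (\<lambda>x. f x * g x) x = f x * partial b g x + partial b f x * g x"
  using partial_eqI[OF has_derivative_mult[OF has_derivative_grad[OF assms(1)]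
        has_derivative_grad[OF assms(2)]]]
    partial_eqI[OF has_derivative_grad[OF assms(1)], of b]
    partial_eqI[OF has_derivative_grad[OF assms(2)], of b]
  by simp

lemma partial_add:
  assumes "f differentiable at x" "g differentiable at x"
  shows "partial b (\<lambda>x. f x + g x) x = partial b f x + partial b g x"
  using partial_eqI[OF has_derivative_add[OF has_derivative_grad[OF assms(1)]
        has_derivative_grad[OF assms(2)]]]
    partial_eqI[OF has_derivative_grad[OF assms(1)], of b]
    partial_eqI[OF has_derivative_grad[OF assms(2)], of b]
  by simp

lemma partial_const: "partial b (\<lambda>x. c) x = 0"
  by (rule partial_eqI[of _ "\<lambda>h. 0", simplified]) simp

lemma C_k_const: "C_k k (\<lambda>x. c)"
proof (induction k arbitrary: c)
  case 0
  show ?case by simp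
next
  case (Suc k)
  show ?case
    by (rule C_k_SucI[where D = "\<lambda>x h. 0"]) (auto simp: Suc)
qed

lemma C_k_add: "C_k k f \<Longrightarrow> C_k k g \<Longrightarrow> C_k k (\<lambda>x. f x + g x)"
proof (induction k arbitrary: f g)
  case 0
  then show ?case by (simp add: continuous_on_add)
next
  case (Suc k)
  note d = Suc.prems[THEN C_k_Suc_differentiable]
  have "partial b (\<lambda>x. f x + g x) = (\<lambda>x. partial b f x + partial b g x)" for b
    using partial_add[OF d] by auto
  then show ?case using Suc by (auto simp: differentiable_on_def)
qed

lemma C_k_mult: "C_k k f \<Longrightarrow> C_k k g \<Longrightarrow> C_k k (\<lambda>x. f x * g x)"
proof (induction k arbitrary: f g)
  case 0
  then show ?case by (simp add: continuous_on_mult)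
next
  case (Suc k)
  note d = Suc.prems[THEN C_k_Suc_differentiable]
  have "partial b (\<lambda>x. f x * g x) = (\<lambda>x. f x * partial b g x + partial b f x * g x)" for b
    using partial_mult[OF d] by auto
  moreover have "C_k k f" "C_k k g" using Suc.prems C_k_SucD by blast+
  ultimately show ?case using Suc by (auto simp: differentiable_on_def intro!: C_k_add)
qed

lemma C_k_diff: "C_k k f \<Longrightarrow> C_k k g \<Longrightarrow> C_k k (\<lambda>x. f x - g x)"
  using C_k_add[of k f "\<lambda>x. (-1) * g x"] C_k_mult[OF C_k_const[of k "-1"], of g] by simp

lemma C_k_prod: "finite I \<Longrightarrow> (\<And>i. i \<in> I \<Longrightarrow> C_k k (f i)) \<Longrightarrow> C_k k (\<lambda>x. \<Prod>i\<in>I. f i x)"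
  by (induction rule: finite_induct) (auto intro: C_k_mult C_k_const)

lemma C_k_power: "C_k k f \<Longrightarrow> C_k k (\<lambda>x. f x ^ n)"
  by (induction n) (auto intro: C_k_mult C_k_const)

text \<open>A function of one variable with derivatives of all orders, given as the sequence of its derivatives,
  yields smooth functions of a linear coordinate. Taken along \<open>b\<close> and \<open>- b\<close> for the basis vectors
  \<open>b\<close>, these are the factors of the smooth functions supported in a box.\<close>

lemma C_k_ridge:
  fixes w :: "'a::euclidean_space"
  assumes "\<And>n t. (f n has_real_derivative f (Suc n) t) (at t)"
  shows "C_k k (\<lambda>x. f n (x \<bullet> w + c))"
proof (induction k arbitrary: n)
  case 0
  have "continuous_on UNIV (f n)"
    using assms DERIV_isCont continuous_at_imp_continuous_on by blast
  then show ?case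
    by (auto intro!: continuous_on_compose2[of UNIV "f n"] continuous_intros)
next
  case (Suc k)
  show ?case
  proof (rule C_k_SucI)
    show "((\<lambda>x. f n (x \<bullet> w + c)) has_derivative (\<lambda>h. f (Suc n) (x \<bullet> w + c) * (h \<bullet> w))) (at x)" for x
    proof -
      have "((\<lambda>x. x \<bullet> w + c) has_derivative (\<lambda>h. h \<bullet> w)) (at x)"
        by (auto intro!: derivative_eq_intros)
      from has_derivative_compose[OF this assms[of n, unfolded has_field_derivative_def]]
      show ?thesis .
    qed
    show "C_k k (\<lambda>x. f (Suc n) (x \<bullet> w + c) * (b \<bullet> w))" for b
      by (intro C_k_mult C_k_const Suc)
  qed
qed

lemma supp_partial: "supp (partial b f) \<subseteq> supp f"
  unfolding supp_def
proof (rule closure_minimal)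
  show "{x. partial b f x \<noteq> 0} \<subseteq> closure {x. f x \<noteq> 0}"
  proof (rule subsetI, rule ccontr)
    fix x assume x: "x \<in> {x. partial b f x \<noteq> 0}" "x \<notin> closure {x. f x \<noteq> 0}"
    have "(f has_derivative (\<lambda>h. 0)) (at x)"
    proof (rule has_derivative_transform_within_open[of "\<lambda>x. 0"])
      show "open (- closure {x. f x \<noteq> 0})" by blast
      show "\<And>y. y \<in> - closure {x. f x \<noteq> 0} \<Longrightarrow> 0 = f y"
        using closure_subset[of "{x. f x \<noteq> 0}"] by auto
    qed (use x in auto)
    from partial_eqI[OF this] x show False by simp
  qed
qed simp

lemma supp_mult: "supp (\<lambda>x. f x * g x) \<subseteq> supp f \<inter> supp g"
  unfolding supp_def by (intro Int_greatest closure_mono) auto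

lemma not_supp_zero: "x \<notin> supp f \<Longrightarrow> f x = 0"
  unfolding supp_def using closure_subset[of "{x. f x \<noteq> 0}"] by auto

section \<open>Smooth functions that exhaust a box\<close>

lemma tendsto_poly_div_exp:
  "((\<lambda>s. poly p s / exp s) \<longlongrightarrow> (0::real)) at_top"
proof -
  have "((\<lambda>s. \<Sum>i\<le>degree p. coeff p i * (s ^ i / exp s)) \<longlongrightarrow> (\<Sum>i\<le>degree p. coeff p i * 0)) at_top"
    by (intro tendsto_intros tendsto_power_div_exp_0)
  then show ?thesis
    by (simp add: poly_altdef sum_divide_distrib)
qed

text \<open>These functions form a class that is closed under differentiation and contains \<open>exp (- 1 / t)\<close>,
  continued by zero to \<open>t \<le> 0\<close>; this gives its smoothness at \<open>0\<close>.\<close>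

definition flat :: "real poly \<Rightarrow> real \<Rightarrow> real" where
  "flat p t = (if t \<le> 0 then 0 else poly p (1 / t) / exp (1 / t))"

text \<open>For \<open>t > 0\<close> the factor \<open>1 / t\<^sup>2\<close> of the chain rule turns \<open>p\<close> into \<open>X\<^sup>2 (p - p')\<close>. At \<open>0\<close> the
  difference quotient is \<open>s p(s) / exp s\<close> with \<open>s = 1 / t\<close> tending to infinity, so it tends to \<open>0\<close>.\<close>

lemma flat_has_derivative:
  "(flat p has_real_derivative flat ([:0,0,1:] * (p - pderiv p)) t) (at t)"
proof -
  consider "t < 0" | "t > 0" | "t = 0" by linarith
  then show ?thesis
  proof cases
    case 1
    have "((\<lambda>t. 0) has_real_derivative 0) (at t)" by simp
    moreover have ev: "eventually (\<lambda>s. 0 = flat p s) (nhds t)"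
      using eventually_nhds_in_open[of "{..<0}" t] 1 by (auto elim!: eventually_mono simp: flat_def)
    ultimately have "(flat p has_real_derivative 0) (at t)"
      using DERIV_cong_ev[OF refl ev refl] by blast
    then show ?thesis using 1 by (simp add: flat_def)
  next
    case 2
    have "((\<lambda>t. 1 / t) has_real_derivative - (1 / t\<^sup>2)) (at t)"
      using 2 by (auto intro!: derivative_eq_intros simp: power2_eq_square)
    from DERIV_mult[OF DERIV_chain2[OF poly_DERIV this] DERIV_chain2[OF DERIV_exp DERIV_minus[OF this]]]
    have "((\<lambda>t. poly p (1 / t) * exp (- (1 / t))) has_real_derivative
        poly (pderiv p) (1 / t) * - (1 / t\<^sup>2) * exp (- (1 / t)) +
        exp (- (1 / t)) * - (- (1 / t\<^sup>2)) * poly p (1 / t)) (at t)" .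
    then have *: "((\<lambda>t. poly p (1 / t) * exp (- (1 / t))) has_real_derivative
        poly ([:0,0,1:] * (p - pderiv p)) (1 / t) * exp (- (1 / t))) (at t)"
      by (rule DERIV_cong) (simp add: algebra_simps power2_eq_square)
    have pos: "flat q s = poly q (1 / s) * exp (- (1 / s))" if "s > 0" for q s
      unfolding exp_minus divide_inverse[symmetric] flat_def using that by simp
    have ev: "eventually (\<lambda>s. poly p (1 / s) * exp (- (1 / s)) = flat p s) (nhds t)"
      using eventually_nhds_in_open[of "{0<..}" t] 2
      by (auto elim!: eventually_mono simp: pos)
    from * show ?thesis
      using DERIV_cong_ev[OF refl ev refl] pos[OF 2] by metis
  next
    case 3
    have "((\<lambda>h. flat p h / h) \<longlongrightarrow> 0) (at_right 0)"
    proof -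
      have "((\<lambda>h. poly ([:0,1:] * p) (inverse h) / exp (inverse h)) \<longlongrightarrow> 0) (at_right (0::real))"
        by (rule filterlim_compose[OF tendsto_poly_div_exp filterlim_inverse_at_top_right])
      moreover have "eventually (\<lambda>h. poly ([:0,1:] * p) (inverse h) / exp (inverse h) = flat p h / h) (at_right 0)"
        using eventually_at_right_less[of 0]
        by (auto elim!: eventually_mono simp: flat_def field_simps)
      ultimately show ?thesis using tendsto_cong by force
    qed
    moreover have "((\<lambda>h. flat p h / h) \<longlongrightarrow> 0) (at_left 0)"
    proof (rule tendsto_eventually)
      show "\<forall>\<^sub>F h in at_left 0. flat p h / h = 0"
        by (rule eventually_at_leftI[of "-1"]) (auto simp: flat_def)
    qed
    ultimately have "((\<lambda>h. flat p h / h) \<longlongrightarrow> 0) (at 0)"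
      by (simp add: filterlim_split_at)
    then show ?thesis
      using 3 by (simp add: has_field_derivative_iff) (simp add: flat_def)
  qed
qed

lemma smooth_step_tower:
  obtains f :: "nat \<Rightarrow> real \<Rightarrow> real" where
    "\<And>n t. (f n has_real_derivative f (Suc n) t) (at t)"
    "\<And>t. t \<le> 0 \<Longrightarrow> f 0 t = 0" "\<And>t. t > 0 \<Longrightarrow> 0 < f 0 t \<and> f 0 t < 1"
proof
  define P :: "nat \<Rightarrow> real poly" where "P = rec_nat 1 (\<lambda>_ p. [:0,0,1:] * (p - pderiv p))"
  show "(flat (P n) has_real_derivative flat (P (Suc n)) t) (at t)" for n t
    using flat_has_derivative[of "P n" t] by (simp add: P_def)
  show "flat (P 0) t = 0" if "t \<le> 0" for t using that by (simp add: flat_def)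
  show "0 < flat (P 0) t \<and> flat (P 0) t < 1" if "t > 0" for t
    using that by (simp add: flat_def P_def)
qed

lemma smooth_box_bump:
  fixes l r :: "'a::euclidean_space"
  shows "\<exists>G :: 'a \<Rightarrow> real. C_infinity G \<and> (\<forall>x\<in>box l r. 0 < G x \<and> G x < 1) \<and> (\<forall>x. x \<notin> box l r \<longrightarrow> G x = 0)"
proof -
  obtain f :: "nat \<Rightarrow> real \<Rightarrow> real" where f:
    "\<And>n t. (f n has_real_derivative f (Suc n) t) (at t)"
    "\<And>t. t \<le> 0 \<Longrightarrow> f 0 t = 0" "\<And>t. t > 0 \<Longrightarrow> 0 < f 0 t \<and> f 0 t < 1"
    using smooth_step_tower by blast
  define G :: "'a \<Rightarrow> real" where
    "G x = (\<Prod>b\<in>Basis. f 0 (x \<bullet> b + (- (l \<bullet> b))) * f 0 (x \<bullet> (- b) + r \<bullet> b))" for x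
  have p: "0 < f 0 (x \<bullet> b + (- (l \<bullet> b))) * f 0 (x \<bullet> (- b) + r \<bullet> b)"
    "f 0 (x \<bullet> b + (- (l \<bullet> b))) * f 0 (x \<bullet> (- b) + r \<bullet> b) < 1"
    if "x \<in> box l r" "b \<in> Basis" for x b
  proof -
    have "l \<bullet> b < x \<bullet> b" "x \<bullet> b < r \<bullet> b"
      using that by (simp_all add: box_def)
    then have "x \<bullet> b + (- (l \<bullet> b)) > 0" "x \<bullet> (- b) + r \<bullet> b > 0"
      by simp_all
    then have "0 < f 0 (x \<bullet> b + (- (l \<bullet> b)))" "f 0 (x \<bullet> b + (- (l \<bullet> b))) < 1"
      "0 < f 0 (x \<bullet> (- b) + r \<bullet> b)" "f 0 (x \<bullet> (- b) + r \<bullet> b) < 1" using f(3) by blast+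
    then show "0 < f 0 (x \<bullet> b + (- (l \<bullet> b))) * f 0 (x \<bullet> (- b) + r \<bullet> b)"
      "f 0 (x \<bullet> b + (- (l \<bullet> b))) * f 0 (x \<bullet> (- b) + r \<bullet> b) < 1"
      using mult_strict_mono[of "f 0 (x \<bullet> b + (- (l \<bullet> b)))" 1 "f 0 (x \<bullet> (- b) + r \<bullet> b)" 1]
      by (simp_all only: mult_pos_pos mult_1 less_imp_le zero_less_one)
  qed
  show ?thesis
  proof (intro exI[of _ G] conjI ballI allI impI)
    show "C_infinity G"
      unfolding C_infinity_def G_def
      by (intro allI C_k_prod C_k_mult C_k_ridge f) auto
  next
    fix x assume x: "x \<in> box l r"
    show "0 < G x" unfolding G_def by (intro prod_pos) (use p[OF x] in auto)
    obtain b :: 'a where b: "b \<in> Basis" using nonempty_Basis by blast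
    let ?P = "\<lambda>b. f 0 (x \<bullet> b + (- (l \<bullet> b))) * f 0 (x \<bullet> (- b) + r \<bullet> b)"
    have "G x = ?P b * prod ?P (Basis - {b})"
      unfolding G_def by (rule prod.remove) (use b in auto)
    also have "\<dots> \<le> ?P b"
      using p[OF x] b by (intro mult_left_le prod_le_1) (auto intro: less_imp_le)
    also have "\<dots> < 1" using p(2)[OF x b] .
    finally show "G x < 1" .
  next
    fix x assume x: "x \<notin> box l r"
    then obtain b where b: "b \<in> Basis" "x \<bullet> b \<le> l \<bullet> b \<or> r \<bullet> b \<le> x \<bullet> b"
      by (force simp: box_def not_less)
    then have "f 0 (x \<bullet> b + (- (l \<bullet> b))) * f 0 (x \<bullet> (- b) + r \<bullet> b) = 0"
      using f(2) by auto
    then show "G x = 0" unfolding G_def using b(1) by (intro prod_zero) auto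
  qed
qed

text \<open>If \<open>G\<close> is smooth, lies strictly between \<open>0\<close> and \<open>1\<close> in the open box and vanishes outside, then
  \<open>1 - (1 - G)\<^sup>n\<close> is a polynomial in \<open>G\<close>, vanishes where \<open>G\<close> does, and tends to the indicator of the box.\<close>

lemma test_functions_exhausting_box:
  fixes l r :: "'a::euclidean_space"
  assumes "cbox l r \<subseteq> \<Omega>"
  shows "\<exists>\<psi> :: nat \<Rightarrow> 'a \<Rightarrow> real.
    (\<forall>n. test_function \<Omega> (\<psi> n)) \<and> (\<forall>n x. 0 \<le> \<psi> n x \<and> \<psi> n x \<le> indicator (box l r) x) \<and>
    (\<forall>x. (\<lambda>n. \<psi> n x) \<longlonglongrightarrow> indicator (box l r) x)"
proof -
  obtain G where G: "C_infinity G" "\<And>x. x \<in> box l r \<Longrightarrow> 0 < G x \<and> G x < 1"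
    "\<And>x. x \<notin> box l r \<Longrightarrow> G x = 0"
    using smooth_box_bump[of l r] by blast
  define \<psi> where "\<psi> n x = 1 - (1 - G x) ^ n" for n x
  show ?thesis
  proof (intro exI[of _ \<psi>] conjI allI)
    fix n
    have "supp (\<psi> n) \<subseteq> cbox l r"
      unfolding supp_def
    proof (rule closure_minimal)
      show "{x. \<psi> n x \<noteq> 0} \<subseteq> cbox l r"
        using G(3) box_subset_cbox[of l r] by (force simp: \<psi>_def)
    qed (rule closed_cbox)
    moreover have "C_infinity (\<psi> n)"
      using G(1) unfolding C_infinity_def \<psi>_def by (auto intro!: C_k_diff C_k_power C_k_const)
    ultimately show "test_function \<Omega> (\<psi> n)"
      using assms unfolding test_function_def
      by (metis bounded_cbox bounded_subset closed_closure compact_eq_bounded_closed order_trans supp_def)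
  next
    fix n x
    have "0 \<le> G x" "G x \<le> 1" using G(2,3)[of x] by (cases "x \<in> box l r"; force)+
    then have "0 \<le> (1 - G x) ^ n" "(1 - G x) ^ n \<le> 1"
      by (auto intro: power_le_one)
    then show "0 \<le> \<psi> n x" "\<psi> n x \<le> indicator (box l r) x"
      using G(3)[of x] by (auto simp: \<psi>_def indicator_def)
  next
    fix x
    show "(\<lambda>n. \<psi> n x) \<longlonglongrightarrow> indicator (box l r) x"
    proof (cases "x \<in> box l r")
      case True
      then have "(\<lambda>n. 1 - (1 - G x) ^ n) \<longlonglongrightarrow> 1 - 0"
        using G(2)[of x] by (intro tendsto_intros LIMSEQ_realpow_zero) auto
      then show ?thesis using True by (simp add: \<psi>_def)
    next
      case False
      then show ?thesis using G(3)[of x] by (simp add: \<psi>_def)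
    qed
  qed
qed

section \<open>Integration by parts and weak derivatives\<close>

lemma lebesgue_on_integral_indicator:
  fixes f :: "'a::euclidean_space \<Rightarrow> 'b::{banach, second_countable_topology}"
  assumes "open \<Omega>"
  shows "integral\<^sup>L (lebesgue_on \<Omega>) f = (LINT x|lebesgue. indicator \<Omega> x *\<^sub>R f x)"
  using assms by (intro integral_restrict_space) auto

lemma lebesgue_on_integrable_indicator:
  fixes f :: "'a::euclidean_space \<Rightarrow> 'b::{banach, second_countable_topology}"
  assumes "open \<Omega>"
  shows "integrable (lebesgue_on \<Omega>) f \<longleftrightarrow> integrable lebesgue (\<lambda>x. indicator \<Omega> x *\<^sub>R f x)"
  using assms by (intro integrable_restrict_space) auto

lemma continuous_measurable_lebesgue:
  fixes f :: "'a::euclidean_space \<Rightarrow> real"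
  assumes "continuous_on UNIV f"
  shows "f \<in> borel_measurable lebesgue"
  using borel_measurable_continuous_onI[OF assms] by (intro measurable_completion) simp

lemma continuous_measurable_lebesgue_on:
  fixes f :: "'a::euclidean_space \<Rightarrow> real"
  assumes "continuous_on UNIV f"
  shows "f \<in> borel_measurable (lebesgue_on S)"
  using continuous_measurable_lebesgue[OF assms] by (rule measurable_restrict_space1)

lemma continuous_supp_bounded:
  fixes f :: "'a::euclidean_space \<Rightarrow> real"
  assumes "continuous_on UNIV f" "compact (supp f)"
  shows "\<exists>B>0. \<forall>x. \<bar>f x\<bar> \<le> B"
proof -
  have "compact (f ` supp f)"
    using assms by (meson compact_continuous_image continuous_on_subset subset_UNIV)
  then obtain B where "B > 0" "\<forall>y\<in>f ` supp f. norm y \<le> B"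
    using compact_imp_bounded bounded_pos by metis
  then have "\<bar>f x\<bar> \<le> B" for x
    using not_supp_zero[of x f] by (cases "x \<in> supp f") auto
  with \<open>B > 0\<close> show ?thesis by blast
qed

lemma continuous_supp_integrable:
  fixes f :: "'a::euclidean_space \<Rightarrow> real"
  assumes "continuous_on UNIV f" "compact (supp f)"
  shows "integrable lborel f"
proof -
  have "integrable lborel (\<lambda>x. indicator (supp f) x *\<^sub>R f x)"
    using assms by (intro borel_integrable_compact) (auto intro: continuous_on_subset)
  also have "(\<lambda>x. indicator (supp f) x *\<^sub>R f x) = f"
    using not_supp_zero[of _ f] by (auto simp: indicator_def fun_eq_iff)
  finally show ?thesis .
qed

lemma locally_integrable_continuous:
  fixes f :: "'a::euclidean_space \<Rightarrow> real"
  assumes "continuous_on UNIV f"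
  shows "locally_integrable \<Omega> f"
  unfolding locally_integrable_def
proof (intro allI impI)
  fix C assume "compact C \<and> C \<subseteq> \<Omega>"
  then have "integrable lborel (\<lambda>x. indicator C x *\<^sub>R f x)"
    using assms by (intro borel_integrable_compact) (auto intro: continuous_on_subset)
  moreover have "C \<in> sets lebesgue"
    using \<open>compact C \<and> C \<subseteq> \<Omega>\<close> by (simp add: borel_compact)
  ultimately show "integrable (lebesgue_on C) f"
    by (subst integrable_restrict_space) (auto intro: integrable_completion[THEN iffD2])
qed

lemma locally_integrable_mult:
  fixes g \<zeta> :: "'a::euclidean_space \<Rightarrow> real"
  assumes "open \<Omega>" "locally_integrable \<Omega> g" "continuous_on UNIV \<zeta>" "compact (supp \<zeta>)" "supp \<zeta> \<subseteq> \<Omega>"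
  shows "integrable (lebesgue_on \<Omega>) (\<lambda>x. g x * \<zeta> x)"
proof -
  obtain B where B: "B > 0" "\<And>x. \<bar>\<zeta> x\<bar> \<le> B"
    using continuous_supp_bounded assms by blast
  have "integrable (lebesgue_on (supp \<zeta>)) g"
    using assms unfolding locally_integrable_def by blast
  then have g: "integrable lebesgue (\<lambda>x. indicator (supp \<zeta>) x *\<^sub>R g x)"
    using assms by (subst (asm) integrable_restrict_space) (auto simp: borel_compact)
  have "integrable lebesgue (\<lambda>x. (indicator (supp \<zeta>) x *\<^sub>R g x) * \<zeta> x)"
  proof (rule Bochner_Integration.integrable_bound)
    show "integrable lebesgue (\<lambda>x. B * (indicator (supp \<zeta>) x *\<^sub>R g x))"
      using g by simp
    show "(\<lambda>x. (indicator (supp \<zeta>) x *\<^sub>R g x) * \<zeta> x) \<in> borel_measurable lebesgue"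
      using g continuous_measurable_lebesgue[OF assms(3)] by (intro borel_measurable_times) auto
    show "AE x in lebesgue. norm ((indicator (supp \<zeta>) x *\<^sub>R g x) * \<zeta> x)
        \<le> norm (B * (indicator (supp \<zeta>) x *\<^sub>R g x))"
      using B by (auto simp: abs_mult indicator_def mult.commute intro!: mult_right_mono)
  qed
  also have "(\<lambda>x. (indicator (supp \<zeta>) x *\<^sub>R g x) * \<zeta> x) = (\<lambda>x. indicator \<Omega> x *\<^sub>R (g x * \<zeta> x))"
    using not_supp_zero[of _ \<zeta>] assms(5) by (auto simp: indicator_def fun_eq_iff)
  finally show ?thesis using assms(1) by (simp add: lebesgue_on_integrable_indicator)
qed

lemma test_function_continuous: "test_function \<Omega> \<psi> \<Longrightarrow> continuous_on UNIV \<psi>"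
  unfolding test_function_def C_infinity_def using C_k_continuous by blast

lemma test_function_C_k: "test_function \<Omega> \<psi> \<Longrightarrow> C_k k \<psi>"
  unfolding test_function_def C_infinity_def by blast

lemma compact_supp_subset:
  assumes "supp f \<subseteq> supp g" "compact (supp g)"
  shows "compact (supp f)"
proof -
  have "closed (supp f)" by (simp add: supp_def)
  from compact_Int_closed[OF assms(2) this] show ?thesis
    using assms(1) by (simp add: Int_absorb1)
qed

lemma compact_supp_partial: "compact (supp f) \<Longrightarrow> compact (supp (partial b f))"
  by (rule compact_supp_subset[OF supp_partial])

lemma C_1_partial_continuous: "C_k (Suc 0) f \<Longrightarrow> b \<in> Basis \<Longrightarrow> continuous_on UNIV (partial b f)"
  by simp

lemma test_function_partial_continuous:
  "test_function \<Omega> \<psi> \<Longrightarrow> b \<in> Basis \<Longrightarrow> continuous_on UNIV (partial b \<psi>)"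
  using test_function_C_k[of \<Omega> \<psi> "Suc 0"] by simp

lemma line_has_derivative:
  fixes f :: "'a::euclidean_space \<Rightarrow> real"
  assumes "f differentiable at (x + s *\<^sub>R b)" "b \<in> Basis"
  shows "((\<lambda>s. f (x + s *\<^sub>R b)) has_real_derivative partial b f (x + s *\<^sub>R b)) (at s)"
proof -
  have "((\<lambda>s. x + s *\<^sub>R b) has_derivative (\<lambda>h. h *\<^sub>R b)) (at s)"
    by (auto intro!: derivative_eq_intros)
  from has_derivative_compose[OF this has_derivative_grad[OF assms(1)]]
  have "((\<lambda>s. f (x + s *\<^sub>R b)) has_derivative (\<lambda>h. grad f (x + s *\<^sub>R b) \<bullet> (h *\<^sub>R b))) (at s)" .
  moreover have "(\<lambda>h. grad f (x + s *\<^sub>R b) \<bullet> (h *\<^sub>R b)) = (*) (partial b f (x + s *\<^sub>R b))"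
    using assms(2) by (auto simp: grad_inner_Basis)
  ultimately show ?thesis by (simp add: has_field_derivative_def)
qed

text \<open>The integral of a difference quotient vanishes by translation invariance of Lebesgue measure, and
  the difference quotients converge boundedly with uniformly bounded supports.\<close>

lemma integral_partial_eq_0:
  fixes f :: "'a::euclidean_space \<Rightarrow> real"
  assumes f: "C_k (Suc 0) f" "compact (supp f)" and b: "b \<in> Basis"
  shows "(LINT x|lborel. partial b f x) = 0"
proof -
  define q where "q n x = (f (x + (1 / real (Suc n)) *\<^sub>R b) - f x) / (1 / real (Suc n))" for n x
  have d: "f differentiable at x" for x using C_k_Suc_differentiable[OF f(1)] .
  have cf: "continuous_on UNIV f" using f(1) by (rule C_k_continuous)
  have cp: "continuous_on UNIV (partial b f)" using f(1) b by simp
  obtain M where M: "M > 0" "\<And>x. \<bar>partial b f x\<bar> \<le> M"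
    using continuous_supp_bounded[OF cp compact_supp_partial[OF f(2)]] by blast
  obtain R where "\<forall>x\<in>supp f. norm x \<le> R"
    using compact_imp_bounded[OF f(2)] unfolding bounded_iff by blast
  then have R: "supp f \<subseteq> cball 0 R" by auto
  have if_: "integrable lborel f" using continuous_supp_integrable[OF cf f(2)] .
  have shift: "integrable lborel (\<lambda>x. f (x + c))" "(LINT x|lborel. f (x + c)) = (LINT x|lborel. f x)" for c
  proof -
    have m: "f \<in> borel_measurable borel" using cf by (rule borel_measurable_continuous_onI)
    have "integrable (distr lborel borel ((+) c)) f" using if_ by (simp add: lborel_distr_plus)
    then show "integrable lborel (\<lambda>x. f (x + c))"
      using m by (subst (asm) integrable_distr_eq) (auto simp: add.commute)
    have "(LINT x|lborel. f x) = (LINT x|distr lborel borel ((+) c). f x)" by (simp add: lborel_distr_plus)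
    also have "\<dots> = (LINT x|lborel. f (x + c))"
      using m by (subst integral_distr) (auto simp: add.commute)
    finally show "(LINT x|lborel. f (x + c)) = (LINT x|lborel. f x)" by simp
  qed
  have "(LINT x|lborel. q n x) = 0" for n
    unfolding q_def using shift if_ by simp
  moreover have "(\<lambda>n. LINT x|lborel. q n x) \<longlonglongrightarrow> (LINT x|lborel. partial b f x)"
  proof (rule integral_dominated_convergence[where w = "\<lambda>x. indicator (cball 0 (R + 1)) x *\<^sub>R M"])
    show "partial b f \<in> borel_measurable lborel"
      using borel_measurable_continuous_onI[OF cp] by simp
    show "q n \<in> borel_measurable lborel" for n
      unfolding q_def using shift(1)[of "(1 / real (Suc n)) *\<^sub>R b"] if_
      by (intro borel_measurable_divide borel_measurable_diff) auto
    show "integrable lborel (\<lambda>x. indicator (cball 0 (R + 1)) x *\<^sub>R M)"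
      by (intro borel_integrable_compact) auto
    show "AE x in lborel. (\<lambda>n. q n x) \<longlonglongrightarrow> partial b f x"
    proof (rule AE_I2)
      fix x
      have "((\<lambda>s. f (x + s *\<^sub>R b)) has_real_derivative partial b f x) (at 0)"
        using line_has_derivative[of f x 0 b] d b by simp
      then have "((\<lambda>h. (f (x + h *\<^sub>R b) - f x) / h) \<longlongrightarrow> partial b f x) (at 0)"
        by (simp add: DERIV_def)
      moreover have "filterlim (\<lambda>n. 1 / real (Suc n)) (at 0) sequentially"
        using LIMSEQ_Suc[OF lim_1_over_n[where 'a = real]] by (simp add: filterlim_at)
      ultimately show "(\<lambda>n. q n x) \<longlonglongrightarrow> partial b f x"
        unfolding q_def by (rule filterlim_compose)
    qed
    show "AE x in lborel. norm (q n x) \<le> indicator (cball 0 (R + 1)) x *\<^sub>R M" for n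
    proof (rule AE_I2)
      fix x
      let ?t = "1 / real (Suc n)"
      show "norm (q n x) \<le> indicator (cball 0 (R + 1)) x *\<^sub>R M"
      proof (cases "x \<in> cball 0 (R + 1)")
        case True
        have "\<exists>z>0. z < ?t \<and> f (x + ?t *\<^sub>R b) - f (x + 0 *\<^sub>R b) = (?t - 0) * partial b f (x + z *\<^sub>R b)"
          by (rule MVT2) (auto intro!: line_has_derivative d b)
        then obtain z where "f (x + ?t *\<^sub>R b) - f x = ?t * partial b f (x + z *\<^sub>R b)" by auto
        then have "q n x = partial b f (x + z *\<^sub>R b)" unfolding q_def by simp
        then show ?thesis using True M(2) by simp
      next
        case False
        have "norm (?t *\<^sub>R b) \<le> 1" using b by simp
        moreover have "norm x \<le> norm (x + ?t *\<^sub>R b) + norm (?t *\<^sub>R b)"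
          using norm_triangle_ineq4[of "x + ?t *\<^sub>R b" "?t *\<^sub>R b"] by (simp only: add_diff_cancel_right')
        ultimately have "x + ?t *\<^sub>R b \<notin> cball 0 R"
          using False unfolding mem_cball_0 by linarith
        moreover have "x \<notin> cball 0 R" using False by auto
        ultimately have "f (x + ?t *\<^sub>R b) = 0" "f x = 0" using R not_supp_zero[of _ f] by blast+
        then show ?thesis using False by (simp add: q_def)
      qed
    qed
  qed
  ultimately show ?thesis by (simp add: LIMSEQ_const_iff)
qed

lemma compact_supp_mult: "compact (supp g) \<Longrightarrow> compact (supp (\<lambda>x. f x * g x))"
  by (rule compact_supp_subset[of _ g]) (use supp_mult[of f g] in blast)

lemma integration_by_parts:
  fixes f g :: "'a::euclidean_space \<Rightarrow> real"
  assumes "C_k (Suc 0) f" "C_k (Suc 0) g" "compact (supp g)" "b \<in> Basis"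
  shows "(LINT x|lborel. f x * partial b g x) = - (LINT x|lborel. partial b f x * g x)"
proof -
  have c: "continuous_on UNIV f" "continuous_on UNIV g" "continuous_on UNIV (partial b f)"
    "continuous_on UNIV (partial b g)"
    using assms(4) by (simp_all only: C_k_continuous[OF assms(1)] C_k_continuous[OF assms(2)]
        C_1_partial_continuous[OF assms(1)] C_1_partial_continuous[OF assms(2)])
  have i1: "integrable lborel (\<lambda>x. f x * partial b g x)"
    by (intro continuous_supp_integrable continuous_on_mult c compact_supp_mult compact_supp_partial assms(3))
  have i2: "integrable lborel (\<lambda>x. partial b f x * g x)"
    by (intro continuous_supp_integrable continuous_on_mult c compact_supp_mult assms(3))
  have "partial b (\<lambda>x. f x * g x) = (\<lambda>x. f x * partial b g x + partial b f x * g x)"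
    using partial_mult[OF C_k_Suc_differentiable[OF assms(1)] C_k_Suc_differentiable[OF assms(2)]] by auto
  then have "(LINT x|lborel. f x * partial b g x + partial b f x * g x) = 0"
    using integral_partial_eq_0[OF C_k_mult[OF assms(1,2)] compact_supp_mult[OF assms(3)] assms(4)]
    by simp
  then show ?thesis
    unfolding Bochner_Integration.integral_add[OF i1 i2] by linarith
qed

lemma lebesgue_on_integral_supp:
  fixes f :: "'a::euclidean_space \<Rightarrow> real"
  assumes "open \<Omega>" "continuous_on UNIV f" "\<And>x. x \<notin> \<Omega> \<Longrightarrow> f x = 0"
  shows "integral\<^sup>L (lebesgue_on \<Omega>) f = integral\<^sup>L lborel f"
proof -
  have "integral\<^sup>L (lebesgue_on \<Omega>) f = (LINT x|lebesgue. indicator \<Omega> x *\<^sub>R f x)"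
    using assms(1) by (rule lebesgue_on_integral_indicator)
  also have "(\<lambda>x. indicator \<Omega> x *\<^sub>R f x) = f"
    using assms(3) by (auto simp: indicator_def fun_eq_iff)
  finally show ?thesis
    using borel_measurable_continuous_onI[OF assms(2)] by (simp add: integral_completion)
qed

lemma integration_by_parts_on:
  fixes f g :: "'a::euclidean_space \<Rightarrow> real"
  assumes "open \<Omega>" "C_k (Suc 0) f" "C_k (Suc 0) g" "compact (supp g)" "supp g \<subseteq> \<Omega>" "b \<in> Basis"
  shows "(LINT x|lebesgue_on \<Omega>. f x * partial b g x) = - (LINT x|lebesgue_on \<Omega>. partial b f x * g x)"
proof -
  have c: "continuous_on UNIV f" "continuous_on UNIV g" "continuous_on UNIV (partial b f)"
    "continuous_on UNIV (partial b g)"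
    using assms(6) by (simp_all only: C_k_continuous[OF assms(2)] C_k_continuous[OF assms(3)]
        C_1_partial_continuous[OF assms(2)] C_1_partial_continuous[OF assms(3)])
  have z: "g x = 0" "partial b g x = 0" if "x \<notin> \<Omega>" for x
    using that assms(5) supp_partial[of b g] not_supp_zero by blast+
  have "(LINT x|lebesgue_on \<Omega>. f x * partial b g x) = (LINT x|lborel. f x * partial b g x)"
    "(LINT x|lebesgue_on \<Omega>. partial b f x * g x) = (LINT x|lborel. partial b f x * g x)"
    using z by (auto intro!: lebesgue_on_integral_supp continuous_on_mult assms(1) c)
  then show ?thesis using integration_by_parts[OF assms(2,3,4,6)] by simp
qed

lemma C_1_has_weak_partial:
  assumes "open \<Omega>" "C_k (Suc 0) f" "b \<in> Basis"
  shows "has_weak_partial \<Omega> b f (partial b f)"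
proof -
  have "continuous_on UNIV f" "continuous_on UNIV (partial b f)"
    using C_k_continuous[OF assms(2)] C_1_partial_continuous[OF assms(2,3)] by blast+
  then show ?thesis
    unfolding has_weak_partial_def
    by (intro conjI allI impI locally_integrable_continuous integration_by_parts_on[OF assms(1,2)]
        test_function_C_k assms(3)) (auto simp: test_function_def)
qed

text \<open>Testing with functions that exhaust a box shows that \<open>g\<close> has integral zero over every box with
  closure in \<open>\<Omega>\<close>. By Lebesgue differentiation \<open>g\<close> vanishes almost everywhere in each such box,
  and countably many of them cover \<open>\<Omega>\<close>.\<close>

lemma fundamental_lemma_variations:
  fixes g :: "'a::euclidean_space \<Rightarrow> real"
  assumes \<Omega>: "open \<Omega>" and g: "locally_integrable \<Omega> g"
    and 0: "\<And>\<psi>. test_function \<Omega> \<psi> \<Longrightarrow> (LINT x|lebesgue_on \<Omega>. g x * \<psi> x) = 0"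
  shows "AE x in lebesgue_on \<Omega>. g x = 0"
proof -
  have gi: "integrable lebesgue (\<lambda>x. indicator (cbox l r) x *\<^sub>R g x)" if "cbox l r \<subseteq> \<Omega>" for l r
  proof -
    have "integrable (lebesgue_on (cbox l r)) g"
      using g that compact_cbox unfolding locally_integrable_def by blast
    then show ?thesis by (subst (asm) integrable_restrict_space) simp_all
  qed
  have box0: "(LINT x|lebesgue. indicator (box l r) x * g x) = 0" if lr: "cbox l r \<subseteq> \<Omega>" for l r
  proof -
    obtain \<psi> :: "nat \<Rightarrow> 'a \<Rightarrow> real" where \<psi>: "\<And>n. test_function \<Omega> (\<psi> n)"
      "\<And>n x. 0 \<le> \<psi> n x \<and> \<psi> n x \<le> indicator (box l r) x"
      "\<And>x. (\<lambda>n. \<psi> n x) \<longlonglongrightarrow> indicator (box l r) x"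
      using test_functions_exhausting_box[OF lr] by blast
    have eq: "\<psi> n x * g x = indicator \<Omega> x *\<^sub>R (g x * \<psi> n x)" for n x
    proof (cases "x \<in> box l r")
      case True
      then show ?thesis using lr box_subset_cbox[of l r] by auto
    next
      case False
      then show ?thesis using \<psi>(2)[of n x] by simp
    qed
    have "(\<lambda>n. LINT x|lebesgue. \<psi> n x * g x) \<longlonglongrightarrow> (LINT x|lebesgue. indicator (box l r) x * g x)"
    proof (rule integral_dominated_convergence[where w = "\<lambda>x. \<bar>indicator (cbox l r) x *\<^sub>R g x\<bar>"])
      have "integrable lebesgue (\<lambda>x. \<psi> n x * g x)" for n
      proof -
        have "integrable (lebesgue_on \<Omega>) (\<lambda>x. g x * \<psi> n x)"
          using \<psi>(1)[of n] test_function_continuous[OF \<psi>(1)[of n]]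
          by (intro locally_integrable_mult \<Omega> g) (auto simp: test_function_def)
        then show ?thesis unfolding eq using \<Omega> by (simp add: lebesgue_on_integrable_indicator)
      qed
      then show "(\<lambda>x. \<psi> n x * g x) \<in> borel_measurable lebesgue" for n by auto
      show "integrable lebesgue (\<lambda>x. \<bar>indicator (cbox l r) x *\<^sub>R g x\<bar>)"
        using gi[OF lr] by simp
      show lim: "AE x in lebesgue. (\<lambda>n. \<psi> n x * g x) \<longlonglongrightarrow> indicator (box l r) x * g x"
        using \<psi>(3) by (auto intro!: tendsto_mult)
      have "(\<lambda>x. indicator (box l r) x * g x) = (\<lambda>x. indicator (box l r) x * (indicator (cbox l r) x *\<^sub>R g x))"
        using box_subset_cbox[of l r] by (auto simp: indicator_def fun_eq_iff)
      also have "\<dots> \<in> borel_measurable lebesgue"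
        using gi[OF lr] by (intro borel_measurable_times borel_measurable_indicator) auto
      finally show "(\<lambda>x. indicator (box l r) x * g x) \<in> borel_measurable lebesgue" .
      show "AE x in lebesgue. norm (\<psi> n x * g x) \<le> \<bar>indicator (cbox l r) x *\<^sub>R g x\<bar>" for n
      proof (rule AE_I2)
        fix x
        have "\<bar>\<psi> n x\<bar> \<le> indicator (cbox l r) x"
          using \<psi>(2)[of n x] box_subset_cbox[of l r] by (cases "x \<in> box l r") auto
        then show "norm (\<psi> n x * g x) \<le> \<bar>indicator (cbox l r) x *\<^sub>R g x\<bar>"
          by (simp add: abs_mult mult_right_mono)
      qed
    qed
    moreover have "(LINT x|lebesgue. \<psi> n x * g x) = 0" for n
      unfolding eq using 0[OF \<psi>(1)] \<Omega> by (simp add: lebesgue_on_integral_indicator)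
    ultimately show ?thesis by (simp add: LIMSEQ_const_iff)
  qed
  have local: "AE x in lebesgue. x \<in> box l r \<longrightarrow> g x = 0" if lr: "cbox l r \<subseteq> \<Omega>" for l r
  proof -
    define f where "f x = indicator (cbox l r) x *\<^sub>R g x" for x
    have f: "integrable lebesgue f" unfolding f_def using gi[OF lr] .
    have fc: "f integrable_on cbox c d" for c d
      using f integrable_on_lebesgue integrable_on_subcbox by blast
    have zero: "integral (cbox c d) f = 0" for c d
    proof -
      have "integral (cbox c d) f = (LINT x|lebesgue_on (cbox c d). f x)"
      proof (rule lebesgue_integral_eq_integral[symmetric])
        show "integrable (lebesgue_on (cbox c d)) f"
          using integrable_mult_indicator[OF _ f, of "cbox c d"]
          by (subst integrable_restrict_space) simp_all
      qed simp
      also have "\<dots> = (LINT x|lebesgue. indicator (cbox c d) x *\<^sub>R f x)"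
        by (intro integral_restrict_space) auto
      also have "\<dots> = (LINT x|lebesgue. indicator
          (box (\<Sum>i\<in>Basis. max (c \<bullet> i) (l \<bullet> i) *\<^sub>R i)
            (\<Sum>i\<in>Basis. min (d \<bullet> i) (r \<bullet> i) *\<^sub>R i)) x * g x)"
        (is "_ = (LINT x|lebesgue. indicator (box ?L ?R) x * g x)")
      proof (rule integral_cong_AE)
        have C: "cbox c d \<inter> cbox l r = cbox ?L ?R" by (rule Int_interval)
        have eq: "indicator (cbox c d) x *\<^sub>R f x = indicator (cbox ?L ?R) x * g x" for x
          unfolding f_def C[symmetric] by (auto simp: indicator_def)
        show m: "(\<lambda>x. indicator (cbox c d) x *\<^sub>R f x) \<in> borel_measurable lebesgue"
          using f by (intro borel_measurable_scaleR borel_measurable_indicator) auto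
        have "indicator (box ?L ?R) x * g x = indicator (box ?L ?R) x * (indicator (cbox c d) x *\<^sub>R f x)" for x
          unfolding eq using box_subset_cbox[of ?L ?R] by (auto simp: indicator_def)
        then have e2: "(\<lambda>x. indicator (box ?L ?R) x * g x) =
            (\<lambda>x. indicator (box ?L ?R) x * (indicator (cbox c d) x *\<^sub>R f x))" by (rule ext)
        show "(\<lambda>x. indicator (box ?L ?R) x * g x) \<in> borel_measurable lebesgue"
          unfolding e2 by (intro borel_measurable_times m borel_measurable_indicator) auto
        have "cbox ?L ?R - box ?L ?R \<in> null_sets lebesgue"
          using negligible_frontier_interval negligible_iff_null_sets by blast
        then show "AE x in lebesgue. indicator (cbox c d) x *\<^sub>R f x = indicator (box ?L ?R) x * g x"
          unfolding eq by (rule AE_I') (use box_subset_cbox[of ?L ?R] in \<open>auto simp: indicator_def\<close>)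
      qed
      also have "\<dots> = 0"
        by (rule box0) (use lr Int_interval[of c d l r] in blast)
      finally show ?thesis .
    qed
    \<comment> \<open>Lebesgue differentiation along cubes with corner \<open>x\<close>\<close>
    obtain N where N: "negligible N" "\<And>x e. \<lbrakk>x \<notin> N; 0 < e\<rbrakk> \<Longrightarrow> \<exists>d>0. \<forall>h. 0 < h \<and> h < d \<longrightarrow>
        norm (integral (cbox x (x + h *\<^sub>R One)) f /\<^sub>R h ^ DIM('a) - f x) < e"
      using integrable_ccontinuous_explicit[of f] fc by blast
    have "f x = 0" if x: "x \<notin> N" for x
    proof (rule ccontr)
      assume "f x \<noteq> 0"
      then obtain d where "d > 0"
        "\<forall>h. 0 < h \<and> h < d \<longrightarrow> norm (integral (cbox x (x + h *\<^sub>R One)) f /\<^sub>R h ^ DIM('a) - f x) < \<bar>f x\<bar>"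
        using N(2)[OF x, of "\<bar>f x\<bar>"] by auto
      from this(2)[rule_format, of "d/2"] this(1) show False by (simp add: zero)
    qed
    then have "{x. \<not> (x \<in> box l r \<longrightarrow> g x = 0)} \<subseteq> N"
      using box_subset_cbox[of l r] by (force simp: f_def)
    then show ?thesis
      using N(1) unfolding negligible_iff_null_sets by (intro AE_I') auto
  qed
  have "AE x in lebesgue. x \<in> \<Omega> \<longrightarrow> g x = 0"
  proof -
    obtain \<D> where D: "countable \<D>" "\<D> \<subseteq> Pow \<Omega>" "\<And>X. X \<in> \<D> \<Longrightarrow> \<exists>a b. X = cbox a b \<and> cbox a b \<subseteq> \<Omega>"
      "\<Union>\<D> = \<Omega>"
      using open_countable_Union_open_cbox[OF \<Omega>] by (metis PowD subsetD)
    have "AE x in lebesgue. x \<in> X \<longrightarrow> g x = 0" if X_in: "X \<in> \<D>" for X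
    proof -
      obtain l r where X: "X = cbox l r" "cbox l r \<subseteq> \<Omega>" using D(3)[OF X_in] by blast
      have "cbox l r - box l r \<in> null_sets lebesgue"
        using negligible_frontier_interval negligible_iff_null_sets by blast
      then have "AE x in lebesgue. x \<notin> cbox l r - box l r" by (rule AE_not_in)
      with local[OF X(2)] show ?thesis unfolding X(1) by eventually_elim blast
    qed
    then have "AE x in lebesgue. \<forall>X\<in>\<D>. x \<in> X \<longrightarrow> g x = 0"
      by (subst AE_ball_countable[OF D(1)]) blast
    then show ?thesis by eventually_elim (use D(4) in blast)
  qed
  then show ?thesis using \<Omega> by (subst AE_restrict_space_iff) auto
qed

lemma locally_integrable_diff:
  "locally_integrable \<Omega> f \<Longrightarrow> locally_integrable \<Omega> g \<Longrightarrow> locally_integrable \<Omega> (\<lambda>x. f x - g x)"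
  unfolding locally_integrable_def by auto

lemma locally_integrable_mult_test:
  fixes g :: "'a::euclidean_space \<Rightarrow> real"
  assumes "open \<Omega>" "locally_integrable \<Omega> g" "test_function \<Omega> \<psi>"
  shows "integrable (lebesgue_on \<Omega>) (\<lambda>x. g x * \<psi> x)"
    and "b \<in> Basis \<Longrightarrow> integrable (lebesgue_on \<Omega>) (\<lambda>x. g x * partial b \<psi> x)"
proof -
  have s: "compact (supp \<psi>)" "supp \<psi> \<subseteq> \<Omega>" using assms(3) by (auto simp: test_function_def)
  show "integrable (lebesgue_on \<Omega>) (\<lambda>x. g x * \<psi> x)"
    by (intro locally_integrable_mult assms(1,2) s test_function_continuous[OF assms(3)])
  show "integrable (lebesgue_on \<Omega>) (\<lambda>x. g x * partial b \<psi> x)" if "b \<in> Basis"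
    by (intro locally_integrable_mult assms(1,2) compact_supp_partial s
        test_function_partial_continuous[OF assms(3) that] order_trans[OF supp_partial])
qed

lemma has_weak_partial_diff:
  assumes "open \<Omega>" "b \<in> Basis" "has_weak_partial \<Omega> b u v" "has_weak_partial \<Omega> b u' v'"
  shows "has_weak_partial \<Omega> b (\<lambda>x. u x - u' x) (\<lambda>x. v x - v' x)"
  unfolding has_weak_partial_def
proof (intro conjI allI impI)
  have l: "locally_integrable \<Omega> u" "locally_integrable \<Omega> v" "locally_integrable \<Omega> u'" "locally_integrable \<Omega> v'"
    using assms unfolding has_weak_partial_def by auto
  then show "locally_integrable \<Omega> (\<lambda>x. u x - u' x)" "locally_integrable \<Omega> (\<lambda>x. v x - v' x)"
    by (auto intro: locally_integrable_diff)
  fix \<psi> assume \<psi>: "test_function \<Omega> \<psi>"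
  note i = l[THEN locally_integrable_mult_test(1)[OF assms(1) _ \<psi>]]
    l[THEN locally_integrable_mult_test(2)[OF assms(1) _ \<psi> assms(2)]]
  have "(LINT x|lebesgue_on \<Omega>. u x * partial b \<psi> x) = - (LINT x|lebesgue_on \<Omega>. v x * \<psi> x)"
    "(LINT x|lebesgue_on \<Omega>. u' x * partial b \<psi> x) = - (LINT x|lebesgue_on \<Omega>. v' x * \<psi> x)"
    using assms \<psi> unfolding has_weak_partial_def by auto
  then show "(LINT x|lebesgue_on \<Omega>. (u x - u' x) * partial b \<psi> x) =
      - (LINT x|lebesgue_on \<Omega>. (v x - v' x) * \<psi> x)"
    unfolding left_diff_distrib
    using Bochner_Integration.integral_diff[OF i(5,7)] Bochner_Integration.integral_diff[OF i(2,4)] by linarith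
qed

lemma AE_eq_of_test_integrals:
  fixes v v' :: "'a::euclidean_space \<Rightarrow> real"
  assumes "open \<Omega>" "locally_integrable \<Omega> v" "locally_integrable \<Omega> v'"
    "\<And>\<psi>. test_function \<Omega> \<psi> \<Longrightarrow>
      (LINT x|lebesgue_on \<Omega>. v x * \<psi> x) = (LINT x|lebesgue_on \<Omega>. v' x * \<psi> x)"
  shows "AE x in lebesgue_on \<Omega>. v x = v' x"
proof -
  have "AE x in lebesgue_on \<Omega>. v x - v' x = 0"
  proof (rule fundamental_lemma_variations[OF assms(1) locally_integrable_diff[OF assms(2,3)]])
    fix \<psi> assume \<psi>: "test_function \<Omega> \<psi>"
    show "(LINT x|lebesgue_on \<Omega>. (v x - v' x) * \<psi> x) = 0"
      unfolding left_diff_distrib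
      using Bochner_Integration.integral_diff[OF locally_integrable_mult_test(1)[OF assms(1,2) \<psi>]
          locally_integrable_mult_test(1)[OF assms(1,3) \<psi>]] assms(4)[OF \<psi>] by linarith
  qed
  then show ?thesis by simp
qed

lemma has_weak_partial_unique:
  assumes "open \<Omega>" "has_weak_partial \<Omega> b u v" "has_weak_partial \<Omega> b u v'"
  shows "AE x in lebesgue_on \<Omega>. v x = v' x"
proof (rule AE_eq_of_test_integrals[OF assms(1)])
  show "locally_integrable \<Omega> v" "locally_integrable \<Omega> v'"
    using assms unfolding has_weak_partial_def by auto
  fix \<psi> assume "test_function \<Omega> \<psi>"
  then have "(LINT x|lebesgue_on \<Omega>. u x * partial b \<psi> x) = - (LINT x|lebesgue_on \<Omega>. v x * \<psi> x)"
    "(LINT x|lebesgue_on \<Omega>. u x * partial b \<psi> x) = - (LINT x|lebesgue_on \<Omega>. v' x * \<psi> x)"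
    using assms unfolding has_weak_partial_def by auto
  then show "(LINT x|lebesgue_on \<Omega>. v x * \<psi> x) = (LINT x|lebesgue_on \<Omega>. v' x * \<psi> x)" by linarith
qed

text \<open>Whichever function the choice in \<open>weak_partial\<close> returns, it may be replaced almost everywhere by any
  known weak derivative.\<close>

lemma weak_partial:
  assumes "open \<Omega>" "has_weak_partial \<Omega> b u v"
  shows "has_weak_partial \<Omega> b u (weak_partial \<Omega> b u)"
    and "AE x in lebesgue_on \<Omega>. weak_partial \<Omega> b u x = v x"
proof -
  show w: "has_weak_partial \<Omega> b u (weak_partial \<Omega> b u)"
    unfolding weak_partial_def
    by (rule someI[of "has_weak_partial \<Omega> b u", OF assms(2)])
  show "AE x in lebesgue_on \<Omega>. weak_partial \<Omega> b u x = v x"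
    using has_weak_partial_unique[OF assms(1) w assms(2)] .
qed

text \<open>Iterated weak derivatives are weak derivatives of a chosen representative. This invariance gives
  access to them.\<close>

lemma has_weak_partial_cong_AE:
  assumes \<Omega>: "open \<Omega>" and b: "b \<in> Basis" and w: "has_weak_partial \<Omega> b u v"
    and u': "locally_integrable \<Omega> u'" and ae: "AE x in lebesgue_on \<Omega>. u' x = u x"
  shows "has_weak_partial \<Omega> b u' v"
  unfolding has_weak_partial_def
proof (intro conjI allI impI)
  show "locally_integrable \<Omega> u'" by fact
  show "locally_integrable \<Omega> v" using w unfolding has_weak_partial_def by auto
  have u: "locally_integrable \<Omega> u" using w unfolding has_weak_partial_def by auto
  fix \<psi> assume \<psi>: "test_function \<Omega> \<psi>"
  have "(LINT x|lebesgue_on \<Omega>. u' x * partial b \<psi> x) = (LINT x|lebesgue_on \<Omega>. u x * partial b \<psi> x)"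
  proof (rule integral_cong_AE)
    show "(\<lambda>x. u' x * partial b \<psi> x) \<in> borel_measurable (lebesgue_on \<Omega>)"
      using locally_integrable_mult_test(2)[OF \<Omega> u' \<psi> b] by (rule borel_measurable_integrable)
    show "(\<lambda>x. u x * partial b \<psi> x) \<in> borel_measurable (lebesgue_on \<Omega>)"
      using locally_integrable_mult_test(2)[OF \<Omega> u \<psi> b] by (rule borel_measurable_integrable)
    show "AE x in lebesgue_on \<Omega>. u' x * partial b \<psi> x = u x * partial b \<psi> x"
      using ae by eventually_elim simp
  qed
  also have "\<dots> = - (LINT x|lebesgue_on \<Omega>. v x * \<psi> x)"
    using w \<psi> unfolding has_weak_partial_def by blast
  finally show "(LINT x|lebesgue_on \<Omega>. u' x * partial b \<psi> x) = - (LINT x|lebesgue_on \<Omega>. v x * \<psi> x)" .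
qed

lemma has_weak_div_unique:
  assumes "open \<Omega>" "has_weak_div \<Omega> F h" "has_weak_div \<Omega> F h'"
  shows "AE x in lebesgue_on \<Omega>. h x = h' x"
proof (rule AE_eq_of_test_integrals[OF assms(1)])
  show "locally_integrable \<Omega> h" "locally_integrable \<Omega> h'"
    using assms unfolding has_weak_div_def by auto
  fix \<psi> assume "test_function \<Omega> \<psi>"
  then have "(LINT x|lebesgue_on \<Omega>. F x \<bullet> grad \<psi> x) = - (LINT x|lebesgue_on \<Omega>. h x * \<psi> x)"
    "(LINT x|lebesgue_on \<Omega>. F x \<bullet> grad \<psi> x) = - (LINT x|lebesgue_on \<Omega>. h' x * \<psi> x)"
    using assms unfolding has_weak_div_def by auto
  then show "(LINT x|lebesgue_on \<Omega>. h x * \<psi> x) = (LINT x|lebesgue_on \<Omega>. h' x * \<psi> x)" by linarith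
qed

text \<open>Completeness of Lebesgue measure: a chosen representative of a weak derivative inherits
  measurability, so that its norm is an honest integral.\<close>

lemma borel_measurable_lebesgue_on_AE:
  fixes f g :: "'a::euclidean_space \<Rightarrow> real"
  assumes "open \<Omega>" "f \<in> borel_measurable (lebesgue_on \<Omega>)" "AE x in lebesgue_on \<Omega>. g x = f x"
  shows "g \<in> borel_measurable (lebesgue_on \<Omega>)"
proof -
  have S: "\<Omega> \<inter> space lebesgue \<in> sets lebesgue" using assms(1) by auto
  have "(\<lambda>x. indicator \<Omega> x *\<^sub>R f x) \<in> borel_measurable lebesgue"
    using assms(2) borel_measurable_restrict_space_iff[OF S, of f] by (simp add: mult.commute)
  moreover have "AE x in lebesgue. indicator \<Omega> x *\<^sub>R f x = indicator \<Omega> x *\<^sub>R g x"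
    using assms(3) unfolding AE_restrict_space_iff[OF S]
    by eventually_elim (auto simp: indicator_def)
  ultimately have "(\<lambda>x. indicator \<Omega> x *\<^sub>R g x) \<in> borel_measurable lebesgue"
    by (rule borel_measurable_AE)
  then show ?thesis
    using borel_measurable_restrict_space_iff[OF S, of g] by (simp add: mult.commute)
qed

section \<open>Square-integrable functions on a domain\<close>

lemma L2_mult_integrable:
  assumes "in_L2 \<Omega> f" "in_L2 \<Omega> g"
  shows "integrable (lebesgue_on \<Omega>) (\<lambda>x. f x * g x)"
proof (rule Bochner_Integration.integrable_bound)
  show "integrable (lebesgue_on \<Omega>) (\<lambda>x. (f x)\<^sup>2 + (g x)\<^sup>2)"
    using assms by (auto simp: in_L2_def)
  show "(\<lambda>x. f x * g x) \<in> borel_measurable (lebesgue_on \<Omega>)"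
    using assms by (auto simp: in_L2_def)
  show "AE x in lebesgue_on \<Omega>. norm (f x * g x) \<le> norm ((f x)\<^sup>2 + (g x)\<^sup>2)"
  proof (rule AE_I2)
    fix x
    have "2 * (\<bar>f x\<bar> * \<bar>g x\<bar>) \<le> (f x)\<^sup>2 + (g x)\<^sup>2"
      using sum_squares_bound[of "\<bar>f x\<bar>" "\<bar>g x\<bar>"] by simp
    moreover have "0 \<le> \<bar>f x\<bar> * \<bar>g x\<bar>" by simp
    ultimately have "\<bar>f x\<bar> * \<bar>g x\<bar> \<le> (f x)\<^sup>2 + (g x)\<^sup>2" by linarith
    then show "norm (f x * g x) \<le> norm ((f x)\<^sup>2 + (g x)\<^sup>2)"
      by (simp add: abs_mult)
  qed
qed

lemma in_L2_abs: "in_L2 \<Omega> f \<Longrightarrow> in_L2 \<Omega> (\<lambda>x. \<bar>f x\<bar>)"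
  by (auto simp: in_L2_def)

lemma in_L2_bounded_mult:
  assumes "in_L2 \<Omega> f" "g \<in> borel_measurable (lebesgue_on \<Omega>)" "\<And>x. \<bar>g x\<bar> \<le> B"
  shows "in_L2 \<Omega> (\<lambda>x. g x * f x)"
  unfolding in_L2_def
proof
  show m: "(\<lambda>x. g x * f x) \<in> borel_measurable (lebesgue_on \<Omega>)"
    using assms by (auto simp: in_L2_def)
  show "integrable (lebesgue_on \<Omega>) (\<lambda>x. (g x * f x)\<^sup>2)"
  proof (rule Bochner_Integration.integrable_bound)
    show "integrable (lebesgue_on \<Omega>) (\<lambda>x. B\<^sup>2 * (f x)\<^sup>2)"
      using assms(1) by (simp add: in_L2_def)
    show "(\<lambda>x. (g x * f x)\<^sup>2) \<in> borel_measurable (lebesgue_on \<Omega>)" using m by simp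
    show "AE x in lebesgue_on \<Omega>. norm ((g x * f x)\<^sup>2) \<le> norm (B\<^sup>2 * (f x)\<^sup>2)"
    proof (rule AE_I2)
      fix x
      have "(g x)\<^sup>2 \<le> B\<^sup>2" using assms(3)[of x] abs_le_square_iff[of "g x" B] by fastforce
      then show "norm ((g x * f x)\<^sup>2) \<le> norm (B\<^sup>2 * (f x)\<^sup>2)"
        by (simp add: power_mult_distrib mult_right_mono)
    qed
  qed
qed

lemma in_L2_diff:
  assumes "in_L2 \<Omega> f" "in_L2 \<Omega> g"
  shows "in_L2 \<Omega> (\<lambda>x. f x - g x)"
  unfolding in_L2_def
proof
  show "(\<lambda>x. f x - g x) \<in> borel_measurable (lebesgue_on \<Omega>)"
    using assms by (auto simp: in_L2_def)
  have "(\<lambda>x. (f x - g x)\<^sup>2) = (\<lambda>x. (f x)\<^sup>2 + (g x)\<^sup>2 - 2 * (f x * g x))"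
    by (auto simp: power2_diff)
  then show "integrable (lebesgue_on \<Omega>) (\<lambda>x. (f x - g x)\<^sup>2)"
    using assms L2_mult_integrable[OF assms] by (auto simp: in_L2_def)
qed

lemma in_L2_add:
  assumes "in_L2 \<Omega> f" "in_L2 \<Omega> g"
  shows "in_L2 \<Omega> (\<lambda>x. f x + g x)"
  unfolding in_L2_def
proof
  show "(\<lambda>x. f x + g x) \<in> borel_measurable (lebesgue_on \<Omega>)"
    using assms by (auto simp: in_L2_def)
  have "(\<lambda>x. (f x + g x)\<^sup>2) = (\<lambda>x. (f x)\<^sup>2 + (g x)\<^sup>2 + 2 * (f x * g x))"
    by (auto simp: power2_sum)
  then show "integrable (lebesgue_on \<Omega>) (\<lambda>x. (f x + g x)\<^sup>2)"
    using assms L2_mult_integrable[OF assms] by (auto simp: in_L2_def)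
qed

lemma in_L2_sum:
  "finite I \<Longrightarrow> (\<And>i. i \<in> I \<Longrightarrow> in_L2 \<Omega> (f i)) \<Longrightarrow> in_L2 \<Omega> (\<lambda>x. \<Sum>i\<in>I. f i x)"
  by (induction rule: finite_induct) (auto simp: in_L2_add, simp add: in_L2_def)

lemma L2_Cauchy_Schwarz:
  assumes "in_L2 \<Omega> f" "in_L2 \<Omega> g"
  shows "(LINT x|lebesgue_on \<Omega>. \<bar>f x\<bar> * \<bar>g x\<bar>) \<le> L2_norm_on \<Omega> f * L2_norm_on \<Omega> g"
proof -
  let ?M = "lebesgue_on \<Omega>"
  let ?I = "LINT x|?M. \<bar>f x\<bar> * \<bar>g x\<bar>"
  have i: "integrable ?M (\<lambda>x. \<bar>f x\<bar> * \<bar>g x\<bar>)" "integrable ?M (\<lambda>x. (f x)\<^sup>2)" "integrable ?M (\<lambda>x. (g x)\<^sup>2)"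
    using L2_mult_integrable[OF in_L2_abs[OF assms(1)] in_L2_abs[OF assms(2)]] assms
    by (auto simp: in_L2_def)
  have "(\<integral>\<^sup>+x. ennreal \<bar>f x\<bar> * ennreal \<bar>g x\<bar> \<partial>?M)\<^sup>2 \<le>
      (\<integral>\<^sup>+x. (ennreal \<bar>f x\<bar>)\<^sup>2 \<partial>?M) * (\<integral>\<^sup>+x. (ennreal \<bar>g x\<bar>)\<^sup>2 \<partial>?M)"
    using assms by (intro Cauchy_Schwarz_nn_integral) (auto simp: in_L2_def)
  also have "(\<lambda>x. ennreal \<bar>f x\<bar> * ennreal \<bar>g x\<bar>) = (\<lambda>x. ennreal (\<bar>f x\<bar> * \<bar>g x\<bar>))"
    by (auto simp: ennreal_mult)
  also have "(\<lambda>x. (ennreal \<bar>f x\<bar>)\<^sup>2) = (\<lambda>x. ennreal ((f x)\<^sup>2))" by (auto simp: ennreal_power)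
  also have "(\<lambda>x. (ennreal \<bar>g x\<bar>)\<^sup>2) = (\<lambda>x. ennreal ((g x)\<^sup>2))" by (auto simp: ennreal_power)
  also have "(\<integral>\<^sup>+x. ennreal (\<bar>f x\<bar> * \<bar>g x\<bar>) \<partial>?M) = ennreal ?I"
    using i by (intro nn_integral_eq_integral) auto
  also have "(\<integral>\<^sup>+x. ennreal ((f x)\<^sup>2) \<partial>?M) = ennreal (LINT x|?M. (f x)\<^sup>2)"
    using i by (intro nn_integral_eq_integral) auto
  also have "(\<integral>\<^sup>+x. ennreal ((g x)\<^sup>2) \<partial>?M) = ennreal (LINT x|?M. (g x)\<^sup>2)"
    using i by (intro nn_integral_eq_integral) auto
  finally have "ennreal (?I\<^sup>2) \<le> ennreal ((LINT x|?M. (f x)\<^sup>2) * (LINT x|?M. (g x)\<^sup>2))"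
    by (simp add: ennreal_power ennreal_mult)
  then have "?I\<^sup>2 \<le> (LINT x|?M. (f x)\<^sup>2) * (LINT x|?M. (g x)\<^sup>2)"
    by (subst (asm) ennreal_le_iff) (auto intro!: mult_nonneg_nonneg)
  then have "sqrt (?I\<^sup>2) \<le> sqrt ((LINT x|?M. (f x)\<^sup>2) * (LINT x|?M. (g x)\<^sup>2))"
    by (rule real_sqrt_le_mono)
  then show ?thesis by (simp add: L2_norm_on_def real_sqrt_mult)
qed

definition L2_lim :: "'a::euclidean_space set \<Rightarrow> (nat \<Rightarrow> 'a \<Rightarrow> real) \<Rightarrow> ('a \<Rightarrow> real) \<Rightarrow> bool" where
  "L2_lim \<Omega> f g \<longleftrightarrow> (\<forall>n. in_L2 \<Omega> (f n)) \<and> in_L2 \<Omega> g \<and> (\<lambda>n. L2_norm_on \<Omega> (\<lambda>x. f n x - g x)) \<longlonglongrightarrow> 0"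

text \<open>All passages to the limit below are dominated by sequences of this kind; finite sums and multiples
  of them are again of this kind, and products of an \<open>L\<^sup>2\<close>-null sequence with an \<open>L\<^sup>2\<close>-function are.\<close>

definition L1_null :: "'a::euclidean_space set \<Rightarrow> (nat \<Rightarrow> 'a \<Rightarrow> real) \<Rightarrow> bool" where
  "L1_null \<Omega> f \<longleftrightarrow> (\<forall>n. integrable (lebesgue_on \<Omega>) (f n)) \<and> (\<lambda>n. LINT x|lebesgue_on \<Omega>. f n x) \<longlonglongrightarrow> 0"

lemma L1_null_sum:
  assumes "finite I" "\<And>i. i \<in> I \<Longrightarrow> L1_null \<Omega> (f i)"
  shows "L1_null \<Omega> (\<lambda>n x. \<Sum>i\<in>I. f i n x)"
proof -
  have "(\<lambda>n. \<Sum>i\<in>I. LINT x|lebesgue_on \<Omega>. f i n x) \<longlonglongrightarrow> (\<Sum>i\<in>I. 0)"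
    using assms by (intro tendsto_sum) (auto simp: L1_null_def)
  then show ?thesis
    using assms by (auto simp: L1_null_def Bochner_Integration.integral_sum)
qed

lemma L1_null_add: "L1_null \<Omega> f \<Longrightarrow> L1_null \<Omega> g \<Longrightarrow> L1_null \<Omega> (\<lambda>n x. f n x + g n x)"
  unfolding L1_null_def using tendsto_add_zero by fastforce

lemma L1_null_cmult: "L1_null \<Omega> f \<Longrightarrow> L1_null \<Omega> (\<lambda>n x. c * f n x)"
  unfolding L1_null_def using tendsto_mult_right_zero by auto

lemma L2_lim_L1_null:
  assumes "L2_lim \<Omega> f g" "in_L2 \<Omega> k"
  shows "L1_null \<Omega> (\<lambda>n x. \<bar>f n x - g x\<bar> * \<bar>k x\<bar>)"
  unfolding L1_null_def
proof
  have d: "in_L2 \<Omega> (\<lambda>x. f n x - g x)" for n using assms by (auto simp: L2_lim_def intro: in_L2_diff)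
  show "\<forall>n. integrable (lebesgue_on \<Omega>) (\<lambda>x. \<bar>f n x - g x\<bar> * \<bar>k x\<bar>)"
    using L2_mult_integrable[OF in_L2_abs[OF d] in_L2_abs[OF assms(2)]] by blast
  show "(\<lambda>n. LINT x|lebesgue_on \<Omega>. \<bar>f n x - g x\<bar> * \<bar>k x\<bar>) \<longlonglongrightarrow> 0"
  proof (rule tendsto_sandwich[of "\<lambda>_. 0" _ _ "\<lambda>n. L2_norm_on \<Omega> (\<lambda>x. f n x - g x) * L2_norm_on \<Omega> k"])
    show "(\<lambda>n. L2_norm_on \<Omega> (\<lambda>x. f n x - g x) * L2_norm_on \<Omega> k) \<longlonglongrightarrow> 0"
      using assms(1) by (intro tendsto_mult_left_zero) (simp add: L2_lim_def)
  qed (auto simp: L2_Cauchy_Schwarz[OF d assms(2)] intro!: Bochner_Integration.integral_nonneg)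
qed

lemma L1_null_tendsto:
  assumes R: "L1_null \<Omega> R" and i: "\<And>n. integrable (lebesgue_on \<Omega>) (f n)" "integrable (lebesgue_on \<Omega>) g"
    and le: "\<And>n x. x \<in> \<Omega> \<Longrightarrow> \<bar>f n x - g x\<bar> \<le> R n x"
  shows "(\<lambda>n. LINT x|lebesgue_on \<Omega>. f n x) \<longlonglongrightarrow> (LINT x|lebesgue_on \<Omega>. g x)"
proof -
  have "(\<lambda>n. (LINT x|lebesgue_on \<Omega>. f n x) - (LINT x|lebesgue_on \<Omega>. g x)) \<longlonglongrightarrow> 0"
  proof (rule Lim_null_comparison)
    show "(\<lambda>n. LINT x|lebesgue_on \<Omega>. R n x) \<longlonglongrightarrow> 0" using R by (simp add: L1_null_def)
    have "norm ((LINT x|lebesgue_on \<Omega>. f n x) - (LINT x|lebesgue_on \<Omega>. g x)) \<le> (LINT x|lebesgue_on \<Omega>. R n x)" for n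
    proof -
      have "norm ((LINT x|lebesgue_on \<Omega>. f n x) - (LINT x|lebesgue_on \<Omega>. g x)) =
          norm (LINT x|lebesgue_on \<Omega>. f n x - g x)" using i by simp
      also have "\<dots> \<le> (LINT x|lebesgue_on \<Omega>. norm (f n x - g x))"
        by (rule integral_norm_bound)
      also have "\<dots> \<le> (LINT x|lebesgue_on \<Omega>. R n x)"
        using R i le by (intro integral_mono) (auto simp: L1_null_def)
      finally show ?thesis .
    qed
    then show "\<forall>\<^sub>F n in sequentially. norm ((LINT x|lebesgue_on \<Omega>. f n x) - (LINT x|lebesgue_on \<Omega>. g x)) \<le> (LINT x|lebesgue_on \<Omega>. R n x)"
      by simp
  qed
  then show ?thesis by (simp add: LIM_zero_iff)
qed

lemma L2_lim_norm_sq: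
  assumes "L2_lim \<Omega> f g"
  shows "(\<lambda>n. LINT x|lebesgue_on \<Omega>. (f n x)\<^sup>2) \<longlonglongrightarrow> (LINT x|lebesgue_on \<Omega>. (g x)\<^sup>2)"
proof -
  have L: "in_L2 \<Omega> (f n)" "in_L2 \<Omega> g" "in_L2 \<Omega> (\<lambda>x. f n x - g x)" for n
    using assms by (auto simp: L2_lim_def intro: in_L2_diff)
  have "L1_null \<Omega> (\<lambda>n x. (f n x - g x)\<^sup>2)"
    unfolding L1_null_def
  proof
    show "\<forall>n. integrable (lebesgue_on \<Omega>) (\<lambda>x. (f n x - g x)\<^sup>2)" using L(3) by (simp add: in_L2_def)
    have "(\<lambda>n. (L2_norm_on \<Omega> (\<lambda>x. f n x - g x))\<^sup>2) \<longlonglongrightarrow> 0\<^sup>2"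
      using assms by (intro tendsto_power) (simp add: L2_lim_def)
    then show "(\<lambda>n. LINT x|lebesgue_on \<Omega>. (f n x - g x)\<^sup>2) \<longlonglongrightarrow> 0"
      by (simp add: L2_norm_on_def)
  qed
  from L1_null_add[OF this L1_null_cmult[OF L2_lim_L1_null[OF assms L(2)], of 2]]
  show ?thesis
  proof (rule L1_null_tendsto)
    fix n x
    have "(f n x)\<^sup>2 - (g x)\<^sup>2 = (f n x - g x)\<^sup>2 + 2 * ((f n x - g x) * g x)"
      by (simp add: power2_eq_square algebra_simps)
    also have "\<bar>\<dots>\<bar> \<le> (f n x - g x)\<^sup>2 + 2 * (\<bar>f n x - g x\<bar> * \<bar>g x\<bar>)"
      by (rule order_trans[OF abs_triangle_ineq]) (simp add: abs_mult)
    finally show "\<bar>(f n x)\<^sup>2 - (g x)\<^sup>2\<bar> \<le> (f n x - g x)\<^sup>2 + 2 * (\<bar>f n x - g x\<bar> * \<bar>g x\<bar>)" .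
  qed (use L in \<open>auto simp: in_L2_def\<close>)
qed

lemma finite_measure_bounded_open:
  fixes \<Omega> :: "'a::euclidean_space set"
  assumes "open \<Omega>" "bounded \<Omega>"
  shows "finite_measure (lebesgue_on \<Omega>)"
  by (intro finite_measure_lebesgue_on bounded_set_imp_lmeasurable) (use assms in auto)

lemma bounded_in_L2:
  fixes f :: "'a::euclidean_space \<Rightarrow> real"
  assumes "open \<Omega>" "bounded \<Omega>" "f \<in> borel_measurable (lebesgue_on \<Omega>)" "\<And>x. x \<in> \<Omega> \<Longrightarrow> \<bar>f x\<bar> \<le> B"
  shows "in_L2 \<Omega> f"
proof -
  interpret finite_measure "lebesgue_on \<Omega>" using assms by (intro finite_measure_bounded_open)
  have "(f x)\<^sup>2 \<le> B\<^sup>2" if "x \<in> \<Omega>" for x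
    using assms(4)[OF that] abs_le_square_iff[of "f x" B] by fastforce
  then have "integrable (lebesgue_on \<Omega>) (\<lambda>x. (f x)\<^sup>2)"
    using assms(3) by (intro integrable_const_bound[where B = "B\<^sup>2"]) auto
  with assms(3) show ?thesis by (simp add: in_L2_def)
qed

lemma in_L2_integrable:
  fixes f :: "'a::euclidean_space \<Rightarrow> real"
  assumes "open \<Omega>" "bounded \<Omega>" "in_L2 \<Omega> f"
  shows "integrable (lebesgue_on \<Omega>) f"
  using L2_mult_integrable[OF assms(3) bounded_in_L2[OF assms(1,2), of "\<lambda>_. 1" 1]] by simp

lemma integrable_imp_locally_integrable:
  fixes f :: "'a::euclidean_space \<Rightarrow> 'b::{banach,second_countable_topology}"
  assumes "open \<Omega>" "integrable (lebesgue_on \<Omega>) f"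
  shows "locally_integrable \<Omega> f"
  unfolding locally_integrable_def
proof (intro allI impI)
  fix C assume C: "compact C \<and> C \<subseteq> \<Omega>"
  have "integrable lebesgue (\<lambda>x. indicator C x *\<^sub>R (indicator \<Omega> x *\<^sub>R f x))"
    using assms C by (intro integrable_mult_indicator[of C])
      (auto simp: lebesgue_on_integrable_indicator[OF assms(1), symmetric] borel_compact)
  also have "(\<lambda>x. indicator C x *\<^sub>R (indicator \<Omega> x *\<^sub>R f x)) = (\<lambda>x. indicator C x *\<^sub>R f x)"
    using C by (auto simp: indicator_def fun_eq_iff)
  finally show "integrable (lebesgue_on C) f"
    using C by (subst integrable_restrict_space) (auto simp: borel_compact)
qed

lemma continuous_in_L2:
  fixes f :: "'a::euclidean_space \<Rightarrow> real"
  assumes "open \<Omega>" "bounded \<Omega>" "continuous_on UNIV f"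
  shows "in_L2 \<Omega> f"
proof -
  have "compact (closure \<Omega>)" using assms(2) by simp
  then have "compact (f ` closure \<Omega>)"
    using continuous_on_subset[OF assms(3)] by (intro compact_continuous_image) auto
  then have "bounded (f ` closure \<Omega>)" by (rule compact_imp_bounded)
  then obtain B where B: "\<forall>y\<in>f ` closure \<Omega>. norm y \<le> B"
    unfolding bounded_iff by blast
  show ?thesis
  proof (rule bounded_in_L2[OF assms(1,2) continuous_measurable_lebesgue_on[OF assms(3)]])
    fix x assume "x \<in> \<Omega>"
    then show "\<bar>f x\<bar> \<le> B" using B closure_subset[of \<Omega>] by auto
  qed
qed

section \<open>The mean curvature operator\<close>

text \<open>With \<open>p = \<nabla>u\<close>: \<open>inv_area p = 1 / Q\<close>, the numbers \<open>unit_slope b p\<close> are the components of \<open>\<nabla>u / Q\<close>,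
  and \<open>curv_coeff b d p\<close> is the derivative of \<open>unit_slope b\<close> in direction \<open>d\<close>, that is, the
  coefficient of \<open>\<partial>\<^sub>b \<partial>\<^sub>d u\<close> in \<open>div (\<nabla>u / Q)\<close>.\<close>

definition inv_area :: "'a::euclidean_space \<Rightarrow> real" where
  "inv_area p = 1 / sqrt (1 + (norm p)\<^sup>2)"

definition unit_slope :: "'a::euclidean_space \<Rightarrow> 'a \<Rightarrow> real" where
  "unit_slope b p = (p \<bullet> b) * inv_area p"

definition curv_coeff :: "'a::euclidean_space \<Rightarrow> 'a \<Rightarrow> 'a \<Rightarrow> real" where
  "curv_coeff b d p = inv_area p * (of_bool (b = d) - unit_slope b p * unit_slope d p)"

lemma inv_area_bounds: "0 < inv_area p" "inv_area p \<le> 1"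
  unfolding inv_area_def by (auto simp: divide_simps add_pos_nonneg)

lemma inv_area_norm: "norm p * inv_area p \<le> 1"
proof -
  have "norm p \<le> sqrt (1 + (norm p)\<^sup>2)" by (rule real_le_rsqrt) simp
  then show ?thesis unfolding inv_area_def by (simp add: divide_simps add_pos_nonneg)
qed

lemma unit_slope_bound:
  assumes "b \<in> Basis" shows "\<bar>unit_slope b p\<bar> \<le> 1"
proof -
  have "\<bar>unit_slope b p\<bar> = \<bar>p \<bullet> b\<bar> * inv_area p"
    unfolding unit_slope_def using inv_area_bounds[of p] by (simp add: abs_mult)
  also have "\<dots> \<le> norm p * inv_area p"
    using Basis_le_norm[OF assms, of p] inv_area_bounds[of p] by (intro mult_right_mono) auto
  finally show ?thesis using inv_area_norm[of p] by linarith
qed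

text \<open>The function \<open>sqrt (1 + r\<^sup>2)\<close> is the norm of \<open>(1, r)\<close>, hence Lipschitz with constant \<open>1\<close>. The factors
  \<open>inv_area\<close> are kept because one of them compensates the growth of \<open>q\<close> in \<open>unit_slope_lipschitz\<close>.\<close>

lemma inv_area_lipschitz: "\<bar>inv_area p - inv_area q\<bar> \<le> inv_area p * inv_area q * norm (p - q)"
proof -
  have pos: "sqrt (1 + (norm p)\<^sup>2) > 0" "sqrt (1 + (norm q)\<^sup>2) > 0"
    by (auto simp: add_pos_nonneg)
  have "\<bar>sqrt (1 + (norm q)\<^sup>2) - sqrt (1 + (norm p)\<^sup>2)\<bar> \<le> \<bar>norm q - norm p\<bar>"
  proof -
    have "sqrt (1 + (norm q)\<^sup>2) = norm (1::real, q)" "sqrt (1 + (norm p)\<^sup>2) = norm (1::real, p)"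
      by (simp_all add: norm_Pair)
    moreover have "\<bar>norm (1::real, norm q) - norm (1::real, norm p)\<bar> \<le> norm ((1::real, norm q) - (1, norm p))"
      by (rule norm_triangle_ineq3)
    ultimately show ?thesis by (simp add: norm_Pair)
  qed
  also have "\<dots> \<le> norm (p - q)" by (metis norm_triangle_ineq3 norm_minus_commute)
  finally have *: "\<bar>sqrt (1 + (norm q)\<^sup>2) - sqrt (1 + (norm p)\<^sup>2)\<bar> \<le> norm (p - q)" .
  have "inv_area p - inv_area q = inv_area p * inv_area q * (sqrt (1 + (norm q)\<^sup>2) - sqrt (1 + (norm p)\<^sup>2))"
    using pos unfolding inv_area_def by (simp add: field_simps)
  then have "\<bar>inv_area p - inv_area q\<bar> = inv_area p * inv_area q * \<bar>sqrt (1 + (norm q)\<^sup>2) - sqrt (1 + (norm p)\<^sup>2)\<bar>"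
    using inv_area_bounds[of p] inv_area_bounds[of q] by (simp add: abs_mult)
  then show ?thesis
    using * inv_area_bounds[of p] inv_area_bounds[of q] by (simp add: mult_left_mono)
qed

lemma inv_area_lipschitz_1: "\<bar>inv_area p - inv_area q\<bar> \<le> norm (p - q)"
proof -
  have "inv_area p * inv_area q \<le> 1"
    using inv_area_bounds[of p] inv_area_bounds[of q] by (simp add: mult_le_one)
  then have "inv_area p * inv_area q * norm (p - q) \<le> norm (p - q)"
    using inv_area_bounds[of p] inv_area_bounds[of q] by (intro mult_left_le_one_le) auto
  then show ?thesis using inv_area_lipschitz[of p q] by linarith
qed

lemma unit_slope_lipschitz:
  assumes "b \<in> Basis"
  shows "\<bar>unit_slope b p - unit_slope b q\<bar> \<le> 2 * norm (p - q)"
proof -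
  have "unit_slope b p - unit_slope b q =
      ((p - q) \<bullet> b) * inv_area p + (q \<bullet> b) * (inv_area p - inv_area q)"
    unfolding unit_slope_def by (simp add: algebra_simps)
  also have "\<bar>\<dots>\<bar> \<le> \<bar>(p - q) \<bullet> b\<bar> * inv_area p + \<bar>q \<bullet> b\<bar> * \<bar>inv_area p - inv_area q\<bar>"
    using inv_area_bounds[of p] by (intro order_trans[OF abs_triangle_ineq]) (simp add: abs_mult)
  also have "\<dots> \<le> norm (p - q) * 1 + norm q * (inv_area p * inv_area q * norm (p - q))"
    using inv_area_bounds[of p] Basis_le_norm[OF assms] inv_area_lipschitz[of p q]
    by (intro add_mono mult_mono) auto
  also have "norm q * (inv_area p * inv_area q * norm (p - q)) =
      (norm q * inv_area q) * (inv_area p * norm (p - q))" by simp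
  also have "\<dots> \<le> 1 * (1 * norm (p - q))"
    using inv_area_bounds[of p] inv_area_bounds[of q] inv_area_norm[of q]
    by (intro mult_mono) auto
  finally show ?thesis by simp
qed

lemma curv_coeff_bound:
  assumes "b \<in> Basis" "d \<in> Basis"
  shows "\<bar>curv_coeff b d p\<bar> \<le> 2"
proof -
  have "\<bar>unit_slope b p\<bar> * \<bar>unit_slope d p\<bar> \<le> 1"
    using unit_slope_bound assms by (intro mult_le_one) auto
  then have "\<bar>of_bool (b = d) - unit_slope b p * unit_slope d p\<bar> \<le> 2"
    by (intro order_trans[OF abs_triangle_ineq4]) (auto simp: abs_mult of_bool_def)
  then have "inv_area p * \<bar>of_bool (b = d) - unit_slope b p * unit_slope d p\<bar> \<le> 1 * 2"
    using inv_area_bounds[of p] by (intro mult_mono) auto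
  then show ?thesis using inv_area_bounds[of p] by (simp add: curv_coeff_def abs_mult)
qed

text \<open>Since the coefficients are bounded and Lipschitz in the gradient, convergence of the first and
  second derivatives in \<open>L\<^sup>2\<close> gives convergence of the curvatures in \<open>L\<^sup>1\<close>.\<close>

lemma curv_coeff_lipschitz:
  assumes "b \<in> Basis" "d \<in> Basis"
  shows "\<bar>curv_coeff b d p - curv_coeff b d q\<bar> \<le> 6 * norm (p - q)"
proof -
  let ?e = "of_bool (b = d) :: real"
  have u: "\<bar>unit_slope b p\<bar> \<le> 1" "\<bar>unit_slope d q\<bar> \<le> 1" "\<bar>unit_slope d p\<bar> \<le> 1" "\<bar>unit_slope b q\<bar> \<le> 1"
    using unit_slope_bound assms by auto
  have 1: "\<bar>unit_slope b p * unit_slope d p - unit_slope b q * unit_slope d q\<bar> \<le> 4 * norm (p - q)"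
  proof -
    have "unit_slope b p * unit_slope d p - unit_slope b q * unit_slope d q =
        unit_slope b p * (unit_slope d p - unit_slope d q) + unit_slope d q * (unit_slope b p - unit_slope b q)"
      by (simp add: algebra_simps)
    also have "\<bar>\<dots>\<bar> \<le> \<bar>unit_slope b p\<bar> * \<bar>unit_slope d p - unit_slope d q\<bar> + \<bar>unit_slope d q\<bar> * \<bar>unit_slope b p - unit_slope b q\<bar>"
      by (intro order_trans[OF abs_triangle_ineq]) (simp add: abs_mult)
    also have "\<dots> \<le> 1 * (2 * norm (p - q)) + 1 * (2 * norm (p - q))"
      using u unit_slope_lipschitz assms by (intro add_mono mult_mono) auto
    finally show ?thesis by simp
  qed
  have 2: "\<bar>?e - unit_slope b p * unit_slope d p\<bar> \<le> 2"
  proof -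
    have "\<bar>unit_slope b p\<bar> * \<bar>unit_slope d p\<bar> \<le> 1"
      using u by (intro mult_le_one) auto
    then show ?thesis
      by (intro order_trans[OF abs_triangle_ineq4]) (auto simp: abs_mult of_bool_def)
  qed
  have "curv_coeff b d p - curv_coeff b d q =
      (inv_area p - inv_area q) * (?e - unit_slope b p * unit_slope d p) -
      inv_area q * (unit_slope b p * unit_slope d p - unit_slope b q * unit_slope d q)"
    unfolding curv_coeff_def by (simp add: algebra_simps)
  also have "\<bar>\<dots>\<bar> \<le> \<bar>inv_area p - inv_area q\<bar> * \<bar>?e - unit_slope b p * unit_slope d p\<bar> +
      inv_area q * \<bar>unit_slope b p * unit_slope d p - unit_slope b q * unit_slope d q\<bar>"
    using inv_area_bounds[of q] by (intro order_trans[OF abs_triangle_ineq4]) (simp add: abs_mult)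
  also have "\<dots> \<le> norm (p - q) * 2 + 1 * (4 * norm (p - q))"
    using 1 2 inv_area_lipschitz_1[of p q] inv_area_bounds[of q] by (intro add_mono mult_mono) auto
  finally show ?thesis by simp
qed

lemma continuous_on_inv_area: "continuous_on S inv_area"
proof -
  have "sqrt (1 + (norm x)\<^sup>2) \<noteq> 0" for x :: 'a
    using add_pos_nonneg[of 1 "(norm x)\<^sup>2"] by simp
  then show ?thesis unfolding inv_area_def by (intro continuous_intros) auto
qed

lemma continuous_on_unit_slope: "continuous_on S (unit_slope b)"
  unfolding unit_slope_def by (intro continuous_intros continuous_on_inv_area)

lemma continuous_on_curv_coeff: "continuous_on S (curv_coeff b d)"
  unfolding curv_coeff_def by (intro continuous_intros continuous_on_inv_area continuous_on_unit_slope)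

lemma unit_slope_has_derivative:
  assumes b: "b \<in> Basis"
  shows "(unit_slope b has_derivative (\<lambda>h. \<Sum>d\<in>Basis. curv_coeff b d p * (h \<bullet> d))) (at p)"
proof -
  have pos: "1 + p \<bullet> p > 0" by (simp add: add_pos_nonneg)
  have eq: "unit_slope b = (\<lambda>p. (p \<bullet> b) / sqrt (1 + p \<bullet> p))"
    by (auto simp: unit_slope_def inv_area_def power2_norm_eq_inner)
  have iv: "inv_area p = 1 / sqrt (1 + p \<bullet> p)" by (simp add: inv_area_def power2_norm_eq_inner)
  have "(unit_slope b has_derivative (\<lambda>h. (h \<bullet> b) * inv_area p - (p \<bullet> b) * ((p \<bullet> h) * inv_area p ^ 3))) (at p)"
    unfolding eq iv using pos
    by (auto intro!: derivative_eq_intros ext simp: inner_commute power3_eq_cube divide_simps)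
  also have "(\<lambda>h. (h \<bullet> b) * inv_area p - (p \<bullet> b) * ((p \<bullet> h) * inv_area p ^ 3)) =
      (\<lambda>h. \<Sum>d\<in>Basis. curv_coeff b d p * (h \<bullet> d))"
  proof
    fix h
    have "(\<Sum>d\<in>Basis. curv_coeff b d p * (h \<bullet> d)) =
        inv_area p * (\<Sum>d\<in>Basis. of_bool (b = d) * (h \<bullet> d)) -
        inv_area p ^ 3 * (p \<bullet> b) * (\<Sum>d\<in>Basis. (p \<bullet> d) * (h \<bullet> d))"
      unfolding sum_distrib_left sum_subtractf[symmetric]
      by (intro sum.cong) (auto simp: curv_coeff_def unit_slope_def algebra_simps power3_eq_cube)
    also have "(\<Sum>d\<in>Basis. of_bool (b = d) * (h \<bullet> d)) = h \<bullet> b"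
      using b by (simp add: of_bool_def if_distrib[of "\<lambda>t. t * _"] sum.delta cong: if_cong)
    also have "(\<Sum>d\<in>Basis. (p \<bullet> d) * (h \<bullet> d)) = p \<bullet> h"
      by (rule euclidean_inner[symmetric])
    finally show "(h \<bullet> b) * inv_area p - (p \<bullet> b) * ((p \<bullet> h) * inv_area p ^ 3) =
        (\<Sum>d\<in>Basis. curv_coeff b d p * (h \<bullet> d))" by simp
  qed
  finally show ?thesis .
qed

lemma grad_has_derivative:
  assumes "C_k 2 v"
  shows "(grad v has_derivative (\<lambda>h. \<Sum>d\<in>Basis. (grad (partial d v) x \<bullet> h) *\<^sub>R d)) (at x)"
proof -
  have "grad v = (\<lambda>x. \<Sum>d\<in>Basis. partial d v x *\<^sub>R d)" by (auto simp: grad_def)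
  moreover have "partial d v differentiable at x" if "d \<in> Basis" for d
    using C_k_Suc_differentiable[OF C_2_partial[OF assms that]] .
  ultimately show ?thesis
    by (auto intro!: has_derivative_sum has_derivative_scaleR_left has_derivative_grad)
qed

lemma continuous_on_grad:
  assumes "C_k (Suc 0) v" shows "continuous_on UNIV (grad v)"
  unfolding grad_def using assms by (intro continuous_intros) auto

text \<open>The mean curvature of the graph of a \<open>C\<^sup>2\<close> function, in nondivergence form.\<close>

definition graph_curvature :: "('a::euclidean_space \<Rightarrow> real) \<Rightarrow> 'a \<Rightarrow> real" where
  "graph_curvature v x = (\<Sum>b\<in>Basis. \<Sum>d\<in>Basis. curv_coeff b d (grad v x) * partial b (partial d v) x)"

lemma unit_slope_grad:
  assumes v: "C_k 2 v" and b: "b \<in> Basis"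
  shows "C_k (Suc 0) (\<lambda>x. unit_slope b (grad v x))"
    and "partial c (\<lambda>x. unit_slope b (grad v x)) x =
      (\<Sum>d\<in>Basis. curv_coeff b d (grad v x) * (grad (partial d v) x \<bullet> c))"
proof -
  have D: "((\<lambda>x. unit_slope b (grad v x)) has_derivative
      (\<lambda>h. \<Sum>d\<in>Basis. curv_coeff b d (grad v x) * (grad (partial d v) x \<bullet> h))) (at x)" for x
    using has_derivative_compose[OF grad_has_derivative[OF v, of x] unit_slope_has_derivative[OF b]]
    by (simp add: inner_sum_left_Basis)
  from partial_eqI[OF D] show "partial c (\<lambda>x. unit_slope b (grad v x)) x =
      (\<Sum>d\<in>Basis. curv_coeff b d (grad v x) * (grad (partial d v) x \<bullet> c))" .
  have v1: "C_k (Suc 0) v" using v by (rule C_2_imp_C_1)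
  show "C_k (Suc 0) (\<lambda>x. unit_slope b (grad v x))"
  proof (rule C_k_SucI[OF D])
    fix c :: 'a assume c: "c \<in> Basis"
    have "continuous_on UNIV (\<lambda>x. curv_coeff b d (grad v x))" if "d \<in> Basis" for d
      by (rule continuous_on_compose2[OF continuous_on_curv_coeff continuous_on_grad[OF v1]]) auto
    moreover have "continuous_on UNIV (grad (partial d v))" if "d \<in> Basis" for d
      using v that by (intro continuous_on_grad C_2_partial)
    ultimately show "C_k 0 (\<lambda>x. \<Sum>d\<in>Basis. curv_coeff b d (grad v x) * (grad (partial d v) x \<bullet> c))"
      by (auto intro!: continuous_intros)
  qed
qed

lemma graph_curvature_weak:
  fixes v \<zeta> :: "'a::euclidean_space \<Rightarrow> real"
  assumes \<Omega>: "open \<Omega>" and v: "C_k 2 v" and \<zeta>: "C_k (Suc 0) \<zeta>" "compact (supp \<zeta>)" "supp \<zeta> \<subseteq> \<Omega>"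
  shows "(LINT x|lebesgue_on \<Omega>. (\<Sum>b\<in>Basis. unit_slope b (grad v x) * partial b \<zeta> x)) =
    - (LINT x|lebesgue_on \<Omega>. graph_curvature v x * \<zeta> x)"
proof -
  let ?s = "\<lambda>b x. unit_slope b (grad v x)"
  have c: "continuous_on UNIV (?s b)" "continuous_on UNIV (partial b (?s b))" if "b \<in> Basis" for b
    using unit_slope_grad(1)[OF v that] that C_k_continuous C_1_partial_continuous by blast+
  have i1: "integrable (lebesgue_on \<Omega>) (\<lambda>x. ?s b x * partial b \<zeta> x)" if "b \<in> Basis" for b
    by (intro locally_integrable_mult \<Omega> locally_integrable_continuous c that compact_supp_partial \<zeta>
        C_1_partial_continuous[OF \<zeta>(1)] order_trans[OF supp_partial])
  have i2: "integrable (lebesgue_on \<Omega>) (\<lambda>x. partial b (?s b) x * \<zeta> x)" if "b \<in> Basis" for b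
    by (intro locally_integrable_mult \<Omega> locally_integrable_continuous c that \<zeta> C_k_continuous[OF \<zeta>(1)])
  have gc: "graph_curvature v x = (\<Sum>b\<in>Basis. partial b (?s b) x)" for x
    unfolding graph_curvature_def
    by (intro sum.cong) (auto simp: unit_slope_grad(2)[OF v] grad_inner_Basis)
  have "(LINT x|lebesgue_on \<Omega>. (\<Sum>b\<in>Basis. ?s b x * partial b \<zeta> x)) =
      (\<Sum>b\<in>Basis. (LINT x|lebesgue_on \<Omega>. ?s b x * partial b \<zeta> x))"
    by (rule Bochner_Integration.integral_sum) (rule i1)
  also have "\<dots> = (\<Sum>b\<in>Basis. - (LINT x|lebesgue_on \<Omega>. partial b (?s b) x * \<zeta> x))"
    by (intro sum.cong integration_by_parts_on \<Omega> unit_slope_grad(1)[OF v] \<zeta>) auto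
  also have "\<dots> = - (LINT x|lebesgue_on \<Omega>. (\<Sum>b\<in>Basis. partial b (?s b) x * \<zeta> x))"
    unfolding sum_negf using i2 by (subst Bochner_Integration.integral_sum) auto
  finally show ?thesis unfolding gc sum_distrib_right .
qed

section \<open>Approximation in \<open>W\<^sup>2\<^sup>,\<^sup>2\<close> and the weak mean curvature\<close>

definition W22_approx :: "'a::euclidean_space set \<Rightarrow> (nat \<Rightarrow> 'a \<Rightarrow> real) \<Rightarrow> ('a \<Rightarrow> real) \<Rightarrow> bool" where
  "W22_approx \<Omega> v u \<longleftrightarrow> (\<forall>n. C_k 2 (v n)) \<and> L2_lim \<Omega> v u \<and>
    (\<forall>b\<in>Basis. L2_lim \<Omega> (\<lambda>n. partial b (v n)) (weak_partial \<Omega> b u)) \<and>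
    (\<forall>b\<in>Basis. \<forall>d\<in>Basis. L2_lim \<Omega> (\<lambda>n. partial b (partial d (v n))) (weak_partial \<Omega> b (weak_partial \<Omega> d u)))"

lemma sobolev_norm_sq_nonneg: "sobolev_norm_sq k \<Omega> u \<ge> 0"
  by (induction k arbitrary: u) (auto intro!: add_nonneg_nonneg sum_nonneg)

lemma sobolev_norm_sq_partial_le:
  "b \<in> Basis \<Longrightarrow> sobolev_norm_sq k \<Omega> (weak_partial \<Omega> b u) \<le> sobolev_norm_sq (Suc k) \<Omega> u"
  using member_le_sum[of b Basis "\<lambda>b. sobolev_norm_sq k \<Omega> (weak_partial \<Omega> b u)"]
  by (simp add: sobolev_norm_sq_nonneg add_increasing)

lemma L2_norm_sq_le_sobolev: "(L2_norm_on \<Omega> u)\<^sup>2 \<le> sobolev_norm_sq k \<Omega> u"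
  by (cases k) (auto intro!: sum_nonneg sobolev_norm_sq_nonneg)

lemma L2_norm_on_nonneg: "L2_norm_on \<Omega> f \<ge> 0"
  by (simp add: L2_norm_on_def)

lemma in_L2_AE:
  fixes f g :: "'a::euclidean_space \<Rightarrow> real"
  assumes "open \<Omega>" "in_L2 \<Omega> f" "AE x in lebesgue_on \<Omega>. g x = f x"
  shows "in_L2 \<Omega> g" and "L2_norm_on \<Omega> g = L2_norm_on \<Omega> f"
proof -
  have m: "g \<in> borel_measurable (lebesgue_on \<Omega>)" "f \<in> borel_measurable (lebesgue_on \<Omega>)"
    using borel_measurable_lebesgue_on_AE[OF assms(1) _ assms(3)] assms(2) by (auto simp: in_L2_def)
  have ae: "AE x in lebesgue_on \<Omega>. (g x)\<^sup>2 = (f x)\<^sup>2" using assms(3) by eventually_elim simp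
  have "integrable (lebesgue_on \<Omega>) (\<lambda>x. (g x)\<^sup>2) \<longleftrightarrow> integrable (lebesgue_on \<Omega>) (\<lambda>x. (f x)\<^sup>2)"
    using m by (intro integrable_cong_AE ae) auto
  then show "in_L2 \<Omega> g" using m assms(2) by (simp add: in_L2_def)
  have "(LINT x|lebesgue_on \<Omega>. (g x)\<^sup>2) = (LINT x|lebesgue_on \<Omega>. (f x)\<^sup>2)"
    using m by (intro integral_cong_AE ae) auto
  then show "L2_norm_on \<Omega> g = L2_norm_on \<Omega> f" by (simp add: L2_norm_on_def)
qed

lemma has_weak_partial_locally_integrable:
  assumes "has_weak_partial \<Omega> b u v"
  shows "locally_integrable \<Omega> u" "locally_integrable \<Omega> v"
  using assms unfolding has_weak_partial_def by auto

lemma in_sobolev_2_weak_partials: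
  fixes u :: "'a::euclidean_space \<Rightarrow> real"
  assumes \<Omega>: "open \<Omega>" and u: "in_sobolev 2 \<Omega> u"
  shows "in_L2 \<Omega> u"
    and "b \<in> Basis \<Longrightarrow> has_weak_partial \<Omega> b u (weak_partial \<Omega> b u)"
    and "b \<in> Basis \<Longrightarrow> in_L2 \<Omega> (weak_partial \<Omega> b u)"
    and "b \<in> Basis \<Longrightarrow> d \<in> Basis \<Longrightarrow>
      has_weak_partial \<Omega> b (weak_partial \<Omega> d u) (weak_partial \<Omega> b (weak_partial \<Omega> d u))"
    and "b \<in> Basis \<Longrightarrow> d \<in> Basis \<Longrightarrow> in_L2 \<Omega> (weak_partial \<Omega> b (weak_partial \<Omega> d u))"
proof -
  show "in_L2 \<Omega> u" using u by (simp add: numeral_2_eq_2)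
  have ex: "\<exists>v. has_weak_partial \<Omega> d u v \<and> in_L2 \<Omega> v \<and>
      (\<forall>b\<in>Basis. \<exists>w. has_weak_partial \<Omega> b v w \<and> in_L2 \<Omega> w)" if "d \<in> Basis" for d
    using u that by (simp add: numeral_2_eq_2)
  show 1: "has_weak_partial \<Omega> d u (weak_partial \<Omega> d u)" if "d \<in> Basis" for d
    using ex[OF that] weak_partial(1)[OF \<Omega>] by blast
  show "in_L2 \<Omega> (weak_partial \<Omega> d u)" if "d \<in> Basis" for d
    using ex[OF that] weak_partial(2)[OF \<Omega>] in_L2_AE(1)[OF \<Omega>] by blast
  have ex2: "\<exists>w. has_weak_partial \<Omega> b (weak_partial \<Omega> d u) w \<and> in_L2 \<Omega> w" if "b \<in> Basis" "d \<in> Basis" for b d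
  proof -
    obtain v where v: "has_weak_partial \<Omega> d u v"
      and "\<forall>b\<in>Basis. \<exists>w. has_weak_partial \<Omega> b v w \<and> in_L2 \<Omega> w"
      using ex[OF \<open>d \<in> Basis\<close>] by blast
    then obtain w where w: "has_weak_partial \<Omega> b v w" "in_L2 \<Omega> w" using \<open>b \<in> Basis\<close> by blast
    have "has_weak_partial \<Omega> b (weak_partial \<Omega> d u) w"
      by (rule has_weak_partial_cong_AE[OF \<Omega> \<open>b \<in> Basis\<close> w(1)])
        (rule has_weak_partial_locally_integrable(2)[OF 1[OF \<open>d \<in> Basis\<close>]], rule weak_partial(2)[OF \<Omega> v])
    with w(2) show ?thesis by blast
  qed
  show "has_weak_partial \<Omega> b (weak_partial \<Omega> d u) (weak_partial \<Omega> b (weak_partial \<Omega> d u))"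
    if "b \<in> Basis" "d \<in> Basis" for b d
    using ex2[OF that] weak_partial(1)[OF \<Omega>] by blast
  show "in_L2 \<Omega> (weak_partial \<Omega> b (weak_partial \<Omega> d u))" if "b \<in> Basis" "d \<in> Basis" for b d
    using ex2[OF that] weak_partial(2)[OF \<Omega>] in_L2_AE(1)[OF \<Omega>] by blast
qed

text \<open>The derivatives inside the Sobolev norm of \<open>g = v - u\<close> are choices made for \<open>g\<close> and for a chosen
  derivative of \<open>g\<close>. Uniqueness identifies them almost everywhere with the differences of the
  classical derivatives of \<open>v\<close> and the choices made for \<open>u\<close>.\<close>

lemma sobolev_norm_controls_derivatives:
  fixes u v :: "'a::euclidean_space \<Rightarrow> real"
  assumes \<Omega>: "open \<Omega>" "bounded \<Omega>" and u: "in_sobolev 2 \<Omega> u" and v: "C_k 2 v"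
    and g: "\<And>x. g x = v x - u x"
  shows "L2_norm_on \<Omega> (\<lambda>x. v x - u x) \<le> sobolev_norm 2 \<Omega> g"
    and "b \<in> Basis \<Longrightarrow> L2_norm_on \<Omega> (\<lambda>x. partial b v x - weak_partial \<Omega> b u x) \<le> sobolev_norm 2 \<Omega> g"
    and "b \<in> Basis \<Longrightarrow> d \<in> Basis \<Longrightarrow>
      L2_norm_on \<Omega> (\<lambda>x. partial b (partial d v) x - weak_partial \<Omega> b (weak_partial \<Omega> d u) x) \<le> sobolev_norm 2 \<Omega> g"
proof -
  have le: "L2_norm_on \<Omega> f \<le> sobolev_norm 2 \<Omega> g" if "(L2_norm_on \<Omega> f)\<^sup>2 \<le> sobolev_norm_sq 2 \<Omega> g" for f
    unfolding sobolev_norm_def using that by (rule real_le_rsqrt)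
  have geq: "g = (\<lambda>x. v x - u x)" using g by auto
  show "L2_norm_on \<Omega> (\<lambda>x. v x - u x) \<le> sobolev_norm 2 \<Omega> g"
    unfolding geq[symmetric] by (rule le[OF L2_norm_sq_le_sobolev])
  have v1: "C_k (Suc 0) v" using v by (rule C_2_imp_C_1)
  have v2: "C_k (Suc 0) (partial d v)" if "d \<in> Basis" for d
    using v that by (rule C_2_partial)
  note wu = in_sobolev_2_weak_partials[OF \<Omega>(1) u]
  have hw: "has_weak_partial \<Omega> d g (\<lambda>x. partial d v x - weak_partial \<Omega> d u x)" if "d \<in> Basis" for d
    unfolding geq by (intro has_weak_partial_diff \<Omega> that C_1_has_weak_partial v1 wu)
  note wg = weak_partial[OF \<Omega>(1) hw]
  have d1: "in_L2 \<Omega> (\<lambda>x. partial d v x - weak_partial \<Omega> d u x)" if "d \<in> Basis" for d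
    by (intro in_L2_diff continuous_in_L2 \<Omega> wu that C_1_partial_continuous[OF v1])
  show "L2_norm_on \<Omega> (\<lambda>x. partial d v x - weak_partial \<Omega> d u x) \<le> sobolev_norm 2 \<Omega> g"
    if d: "d \<in> Basis" for d
  proof (rule le)
    have "L2_norm_on \<Omega> (\<lambda>x. partial d v x - weak_partial \<Omega> d u x) = L2_norm_on \<Omega> (weak_partial \<Omega> d g)"
      by (rule in_L2_AE(2)[OF \<Omega>(1) d1[OF d] wg(2)[OF d], symmetric])
    also have "(L2_norm_on \<Omega> (weak_partial \<Omega> d g))\<^sup>2 \<le> sobolev_norm_sq 1 \<Omega> (weak_partial \<Omega> d g)"
      by (rule L2_norm_sq_le_sobolev)
    also have "\<dots> \<le> sobolev_norm_sq (Suc 1) \<Omega> g" by (rule sobolev_norm_sq_partial_le[OF d])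
    finally show "(L2_norm_on \<Omega> (\<lambda>x. partial d v x - weak_partial \<Omega> d u x))\<^sup>2 \<le> sobolev_norm_sq 2 \<Omega> g"
      by (simp add: numeral_2_eq_2)
  qed
  show "L2_norm_on \<Omega> (\<lambda>x. partial b (partial d v) x - weak_partial \<Omega> b (weak_partial \<Omega> d u) x) \<le> sobolev_norm 2 \<Omega> g"
    if b: "b \<in> Basis" and d: "d \<in> Basis" for b d
  proof (rule le)
    let ?f = "\<lambda>x. partial b (partial d v) x - weak_partial \<Omega> b (weak_partial \<Omega> d u) x"
    have "has_weak_partial \<Omega> b (\<lambda>x. partial d v x - weak_partial \<Omega> d u x) ?f"
      by (intro has_weak_partial_diff \<Omega> b C_1_has_weak_partial v2 d wu)
    then have h: "has_weak_partial \<Omega> b (weak_partial \<Omega> d g) ?f"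
      by (rule has_weak_partial_cong_AE[OF \<Omega>(1) b])
        (rule has_weak_partial_locally_integrable(2)[OF wg(1)[OF d]], rule wg(2)[OF d])
    have f: "in_L2 \<Omega> ?f"
      by (intro in_L2_diff continuous_in_L2 \<Omega> wu b d C_1_partial_continuous[OF v2])
    have "L2_norm_on \<Omega> ?f = L2_norm_on \<Omega> (weak_partial \<Omega> b (weak_partial \<Omega> d g))"
      by (rule in_L2_AE(2)[OF \<Omega>(1) f weak_partial(2)[OF \<Omega>(1) h], symmetric])
    also have "(L2_norm_on \<Omega> (weak_partial \<Omega> b (weak_partial \<Omega> d g)))\<^sup>2 \<le>
        sobolev_norm_sq 0 \<Omega> (weak_partial \<Omega> b (weak_partial \<Omega> d g))"
      by (rule L2_norm_sq_le_sobolev)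
    also have "\<dots> \<le> sobolev_norm_sq (Suc 0) \<Omega> (weak_partial \<Omega> d g)" by (rule sobolev_norm_sq_partial_le[OF b])
    also have "\<dots> \<le> sobolev_norm_sq (Suc (Suc 0)) \<Omega> g" by (rule sobolev_norm_sq_partial_le[OF d])
    finally show "(L2_norm_on \<Omega> ?f)\<^sup>2 \<le> sobolev_norm_sq 2 \<Omega> g"
      by (simp add: numeral_2_eq_2)
  qed
qed

text \<open>Adding \<open>\<phi>\<close> to test functions that approximate \<open>u - \<phi>\<close> fixes the boundary values exactly.\<close>

lemma exists_W22_approx:
  fixes u \<phi> :: "'a::euclidean_space \<Rightarrow> real"
  assumes \<Omega>: "open \<Omega>" "bounded \<Omega>" and \<phi>: "C2_compact \<phi>" and u: "in_sobolev 2 \<Omega> u"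
    and u0: "in_sobolev_0 2 \<Omega> (\<lambda>x. u x - \<phi> x)"
  shows "\<exists>v. W22_approx \<Omega> v u \<and> (\<forall>n. compact (supp (v n))) \<and> (\<forall>n. \<forall>x\<in>frontier \<Omega>. v n x = \<phi> x)"
proof -
  have "\<forall>n. \<exists>\<psi>. test_function \<Omega> \<psi> \<and> sobolev_norm 2 \<Omega> (\<lambda>x. \<psi> x - (u x - \<phi> x)) < inverse (real (Suc n))"
    using u0 unfolding in_sobolev_0_def by (metis inverse_positive_iff_positive of_nat_0_less_iff zero_less_Suc)
  then obtain \<psi> where \<psi>: "\<And>n. test_function \<Omega> (\<psi> n)"
    "\<And>n. sobolev_norm 2 \<Omega> (\<lambda>x. \<psi> n x - (u x - \<phi> x)) < inverse (real (Suc n))"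
    by metis
  define v where "v n x = \<psi> n x + \<phi> x" for n x
  have C2: "C_k 2 (v n)" for n
    unfolding v_def using \<phi> test_function_C_k[OF \<psi>(1)] by (intro C_k_add) (auto simp: C2_compact_def)
  have v1: "C_k (Suc 0) (v n)" for n using C2 by (rule C_2_imp_C_1)
  have v2: "C_k (Suc 0) (partial d (v n))" if "d \<in> Basis" for d n
    using C2 that by (rule C_2_partial)
  note wu = in_sobolev_2_weak_partials[OF \<Omega>(1) u]
  have g: "\<psi> n x - (u x - \<phi> x) = v n x - u x" for n x by (simp add: v_def)
  note ctrl = sobolev_norm_controls_derivatives[OF \<Omega> u C2 g]
  have null: "(\<lambda>n. L2_norm_on \<Omega> (f n)) \<longlonglongrightarrow> 0"
    if "\<And>n. L2_norm_on \<Omega> (f n) \<le> sobolev_norm 2 \<Omega> (\<lambda>x. \<psi> n x - (u x - \<phi> x))" for f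
  proof (rule tendsto_sandwich[OF _ _ tendsto_const LIMSEQ_inverse_real_of_nat])
    show "\<forall>\<^sub>F n in sequentially. L2_norm_on \<Omega> (f n) \<le> inverse (real (Suc n))"
      using that \<psi>(2) by (intro always_eventually allI) (meson less_imp_le order_trans)
  qed (simp add: L2_norm_on_nonneg)
  have "W22_approx \<Omega> v u"
    unfolding W22_approx_def L2_lim_def
    by (intro conjI allI ballI C2 null ctrl wu continuous_in_L2 \<Omega> C_k_continuous[OF v1]
        C_1_partial_continuous[OF v1] C_1_partial_continuous[OF v2])
  moreover have "compact (supp (v n))" for n
  proof -
    have c: "compact (supp (\<psi> n))" "compact (supp \<phi>)"
      using \<psi>(1)[of n] \<phi> by (auto simp: test_function_def C2_compact_def)
    have "supp (v n) \<subseteq> supp (\<psi> n) \<union> supp \<phi>"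
      unfolding supp_def closure_Un[symmetric] by (rule closure_mono) (auto simp: v_def)
    moreover have "closed (supp (v n))" by (simp add: supp_def)
    ultimately show ?thesis
      using compact_Int_closed[OF compact_Un[OF c]] by (metis Int_absorb1)
  qed
  moreover have "v n x = \<phi> x" if "x \<in> frontier \<Omega>" for n x
  proof -
    have "x \<notin> \<Omega>" using that \<Omega>(1) by (simp add: frontier_def interior_open)
    then have "\<psi> n x = 0" using \<psi>(1)[of n] not_supp_zero[of x "\<psi> n"] by (auto simp: test_function_def)
    then show ?thesis by (simp add: v_def)
  qed
  ultimately show ?thesis by blast
qed

lemma norm_grad_diff_le:
  "norm (grad v x - weak_grad \<Omega> u x) \<le> (\<Sum>b\<in>Basis. \<bar>partial b v x - weak_partial \<Omega> b u x\<bar>)"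
  using norm_le_l1[of "grad v x - weak_grad \<Omega> u x"]
  by (simp add: grad_def weak_grad_def inner_diff_left inner_sum_left_Basis)

lemma weak_grad_measurable:
  fixes u :: "'a::euclidean_space \<Rightarrow> real"
  assumes "\<And>b. b \<in> Basis \<Longrightarrow> in_L2 \<Omega> (weak_partial \<Omega> b u)"
  shows "weak_grad \<Omega> u \<in> borel_measurable (lebesgue_on \<Omega>)"
  unfolding weak_grad_def using assms
  by (intro borel_measurable_sum borel_measurable_scaleR) (auto simp: in_L2_def)

lemma continuous_weak_grad_measurable:
  fixes u :: "'a::euclidean_space \<Rightarrow> real" and f :: "'a \<Rightarrow> real"
  assumes "\<And>b. b \<in> Basis \<Longrightarrow> in_L2 \<Omega> (weak_partial \<Omega> b u)" "continuous_on UNIV f"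
  shows "(\<lambda>x. f (weak_grad \<Omega> u x)) \<in> borel_measurable (lebesgue_on \<Omega>)"
  using measurable_compose[OF weak_grad_measurable[OF assms(1)] borel_measurable_continuous_onI[OF assms(2)]] .

definition weak_graph_curvature :: "'a::euclidean_space set \<Rightarrow> ('a \<Rightarrow> real) \<Rightarrow> 'a \<Rightarrow> real" where
  "weak_graph_curvature \<Omega> u x = (\<Sum>b\<in>Basis. \<Sum>d\<in>Basis.
     curv_coeff b d (weak_grad \<Omega> u x) * weak_partial \<Omega> b (weak_partial \<Omega> d u) x)"

lemma unit_slope_in_L2:
  fixes u :: "'a::euclidean_space \<Rightarrow> real"
  assumes "open \<Omega>" "bounded \<Omega>" "\<And>b. b \<in> Basis \<Longrightarrow> in_L2 \<Omega> (weak_partial \<Omega> b u)" "b \<in> Basis"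
  shows "in_L2 \<Omega> (\<lambda>x. unit_slope b (weak_grad \<Omega> u x))"
  by (rule bounded_in_L2[OF assms(1,2) continuous_weak_grad_measurable[OF assms(3) continuous_on_unit_slope]
        unit_slope_bound[OF assms(4)]])

lemma weak_graph_curvature_in_L2:
  fixes u :: "'a::euclidean_space \<Rightarrow> real"
  assumes "open \<Omega>" "in_sobolev 2 \<Omega> u"
  shows "in_L2 \<Omega> (weak_graph_curvature \<Omega> u)"
  unfolding weak_graph_curvature_def[abs_def]
  by (intro in_L2_sum finite_Basis in_L2_bounded_mult[OF _ _ curv_coeff_bound]
      continuous_weak_grad_measurable in_sobolev_2_weak_partials[OF assms] continuous_on_curv_coeff)

text \<open>The identity holds for the approximations by classical integration by parts, and both sides pass to
  the limit because the slopes and coefficients are Lipschitz in the gradient. Test functions that are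
  merely \<open>C\<^sup>1\<close> are covered since the products of cutoffs and approximations are of this class.\<close>

lemma weak_graph_curvature_identity:
  fixes u \<zeta> :: "'a::euclidean_space \<Rightarrow> real"
  assumes \<Omega>: "open \<Omega>" "bounded \<Omega>" and u: "in_sobolev 2 \<Omega> u" and v: "W22_approx \<Omega> v u"
    and \<zeta>: "C_k (Suc 0) \<zeta>" "compact (supp \<zeta>)" "supp \<zeta> \<subseteq> \<Omega>"
  shows "(LINT x|lebesgue_on \<Omega>. (\<Sum>b\<in>Basis. unit_slope b (weak_grad \<Omega> u x) * partial b \<zeta> x)) =
    - (LINT x|lebesgue_on \<Omega>. weak_graph_curvature \<Omega> u x * \<zeta> x)"
proof -
  note wu = in_sobolev_2_weak_partials[OF \<Omega>(1) u]
  have lim1: "L2_lim \<Omega> (\<lambda>n. partial b (v n)) (weak_partial \<Omega> b u)" if "b \<in> Basis" for b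
    using v that by (auto simp: W22_approx_def)
  have lim2: "L2_lim \<Omega> (\<lambda>n. partial b (partial d (v n))) (weak_partial \<Omega> b (weak_partial \<Omega> d u))"
    if "b \<in> Basis" "d \<in> Basis" for b d
    using v that by (auto simp: W22_approx_def)
  have C2: "C_k 2 (v n)" for n using v by (auto simp: W22_approx_def)
  have v1: "C_k (Suc 0) (v n)" for n using C2 by (rule C_2_imp_C_1)
  have v2: "C_k (Suc 0) (partial d (v n))" if "d \<in> Basis" for d n
    using C2 that by (rule C_2_partial)
  have \<zeta>_L2: "in_L2 \<Omega> \<zeta>" by (rule continuous_in_L2[OF \<Omega> C_k_continuous[OF \<zeta>(1)]])
  have \<zeta>'_L2: "in_L2 \<Omega> (partial b \<zeta>)" if "b \<in> Basis" for b
    by (rule continuous_in_L2[OF \<Omega> C_1_partial_continuous[OF \<zeta>(1) that]])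
  obtain B where B: "\<forall>x. \<bar>\<zeta> x\<bar> \<le> B"
    using continuous_supp_bounded[OF C_k_continuous[OF \<zeta>(1)] \<zeta>(2)] by blast
  have w2\<zeta>: "in_L2 \<Omega> (\<lambda>x. \<zeta> x * weak_partial \<Omega> b (weak_partial \<Omega> d u) x)"
    if "b \<in> Basis" "d \<in> Basis" for b d
    using \<zeta>_L2 B by (intro in_L2_bounded_mult[where B = B] wu that) (auto simp: in_L2_def)
  have gc: "continuous_on UNIV (\<lambda>x. f (grad (v n) x))" if "continuous_on UNIV f" for n and f :: "'a \<Rightarrow> real"
    by (rule continuous_on_compose2[OF that continuous_on_grad[OF v1]]) auto
  have 1: "(\<lambda>n. LINT x|lebesgue_on \<Omega>. (\<Sum>b\<in>Basis. unit_slope b (grad (v n) x) * partial b \<zeta> x)) \<longlonglongrightarrow>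
      (LINT x|lebesgue_on \<Omega>. (\<Sum>b\<in>Basis. unit_slope b (weak_grad \<Omega> u x) * partial b \<zeta> x))"
  proof (rule L1_null_tendsto)
    let ?R = "\<lambda>n x. \<Sum>b\<in>Basis. \<Sum>c\<in>Basis. 2 * (\<bar>partial c (v n) x - weak_partial \<Omega> c u x\<bar> * \<bar>partial b \<zeta> x\<bar>)"
    show "L1_null \<Omega> ?R"
      by (intro L1_null_sum finite_Basis L1_null_cmult L2_lim_L1_null lim1 \<zeta>'_L2)
    show "integrable (lebesgue_on \<Omega>) (\<lambda>x. \<Sum>b\<in>Basis. unit_slope b (grad (v n) x) * partial b \<zeta> x)" for n
      by (intro Bochner_Integration.integrable_sum L2_mult_integrable \<zeta>'_L2 continuous_in_L2[OF \<Omega>] gc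
          continuous_on_unit_slope)
    show "integrable (lebesgue_on \<Omega>) (\<lambda>x. \<Sum>b\<in>Basis. unit_slope b (weak_grad \<Omega> u x) * partial b \<zeta> x)"
      by (intro Bochner_Integration.integrable_sum L2_mult_integrable \<zeta>'_L2 unit_slope_in_L2[OF \<Omega>] wu)
    fix n x
    have "\<bar>(\<Sum>b\<in>Basis. unit_slope b (grad (v n) x) * partial b \<zeta> x) -
        (\<Sum>b\<in>Basis. unit_slope b (weak_grad \<Omega> u x) * partial b \<zeta> x)\<bar> =
        \<bar>\<Sum>b\<in>Basis. (unit_slope b (grad (v n) x) - unit_slope b (weak_grad \<Omega> u x)) * partial b \<zeta> x\<bar>"
      by (simp add: sum_subtractf left_diff_distrib)
    also have "\<dots> \<le> (\<Sum>b\<in>Basis. \<bar>unit_slope b (grad (v n) x) - unit_slope b (weak_grad \<Omega> u x)\<bar> * \<bar>partial b \<zeta> x\<bar>)"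
      by (rule order_trans[OF sum_abs]) (simp add: abs_mult)
    also have "\<dots> \<le> (\<Sum>b\<in>Basis. (2 * (\<Sum>c\<in>Basis. \<bar>partial c (v n) x - weak_partial \<Omega> c u x\<bar>)) * \<bar>partial b \<zeta> x\<bar>)"
      by (intro sum_mono mult_right_mono order_trans[OF unit_slope_lipschitz] mult_left_mono norm_grad_diff_le) auto
    also have "\<dots> = ?R n x"
      by (simp add: sum_distrib_left sum_distrib_right mult.assoc)
    finally show "\<bar>(\<Sum>b\<in>Basis. unit_slope b (grad (v n) x) * partial b \<zeta> x) -
        (\<Sum>b\<in>Basis. unit_slope b (weak_grad \<Omega> u x) * partial b \<zeta> x)\<bar> \<le> ?R n x" .
  qed
  have 2: "(\<lambda>n. LINT x|lebesgue_on \<Omega>. graph_curvature (v n) x * \<zeta> x) \<longlonglongrightarrow>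
      (LINT x|lebesgue_on \<Omega>. weak_graph_curvature \<Omega> u x * \<zeta> x)"
  proof (rule L1_null_tendsto)
    let ?w = "\<lambda>b d. weak_partial \<Omega> b (weak_partial \<Omega> d u)"
    let ?p = "\<lambda>b d n. partial b (partial d (v n))"
    let ?R = "\<lambda>n x. \<Sum>b\<in>Basis. \<Sum>d\<in>Basis.
        2 * (\<bar>?p b d n x - ?w b d x\<bar> * \<bar>\<zeta> x\<bar>) +
        (\<Sum>c\<in>Basis. 6 * (\<bar>partial c (v n) x - weak_partial \<Omega> c u x\<bar> * \<bar>\<zeta> x * ?w b d x\<bar>))"
    show "L1_null \<Omega> ?R"
      by (intro L1_null_sum L1_null_add finite_Basis L1_null_cmult L2_lim_L1_null lim1 lim2 \<zeta>_L2 w2\<zeta>)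
    show "integrable (lebesgue_on \<Omega>) (\<lambda>x. graph_curvature (v n) x * \<zeta> x)" for n
      unfolding graph_curvature_def
      by (intro L2_mult_integrable \<zeta>_L2 continuous_in_L2[OF \<Omega>] continuous_intros gc
          continuous_on_curv_coeff C_1_partial_continuous[OF v2])
    show "integrable (lebesgue_on \<Omega>) (\<lambda>x. weak_graph_curvature \<Omega> u x * \<zeta> x)"
      by (intro L2_mult_integrable \<zeta>_L2 weak_graph_curvature_in_L2 \<Omega> u)
    fix n x
    let ?a = "\<lambda>b d. curv_coeff b d (grad (v n) x)"
    let ?a' = "\<lambda>b d. curv_coeff b d (weak_grad \<Omega> u x)"
    have "\<bar>graph_curvature (v n) x * \<zeta> x - weak_graph_curvature \<Omega> u x * \<zeta> x\<bar> =
        \<bar>\<Sum>b\<in>Basis. \<Sum>d\<in>Basis. (?a b d * ?p b d n x - ?a' b d * ?w b d x) * \<zeta> x\<bar>"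
      unfolding graph_curvature_def weak_graph_curvature_def
      by (simp add: sum_subtractf left_diff_distrib sum_distrib_right)
    also have "\<dots> \<le> (\<Sum>b\<in>Basis. \<Sum>d\<in>Basis. \<bar>(?a b d * ?p b d n x - ?a' b d * ?w b d x) * \<zeta> x\<bar>)"
      by (intro order_trans[OF sum_abs] sum_mono sum_abs)
    also have "\<dots> \<le> ?R n x"
    proof (intro sum_mono)
      fix b d :: 'a assume bd: "b \<in> Basis" "d \<in> Basis"
      \<comment> \<open>Grouping the bounded factor \<open>\<zeta>\<close> with the second derivative of \<open>u\<close> leaves a product of
        two functions in \<open>L\<^sup>2\<close>, the other being a difference of gradients.\<close>
      have eq: "(?a b d * ?p b d n x - ?a' b d * ?w b d x) * \<zeta> x =
          ?a b d * ((?p b d n x - ?w b d x) * \<zeta> x) + (?a b d - ?a' b d) * (\<zeta> x * ?w b d x)"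
        by (simp add: algebra_simps)
      have "\<bar>(?a b d * ?p b d n x - ?a' b d * ?w b d x) * \<zeta> x\<bar> \<le>
          \<bar>?a b d\<bar> * (\<bar>?p b d n x - ?w b d x\<bar> * \<bar>\<zeta> x\<bar>) +
          \<bar>?a b d - ?a' b d\<bar> * \<bar>\<zeta> x * ?w b d x\<bar>"
        unfolding eq by (rule order_trans[OF abs_triangle_ineq]) (simp only: abs_mult order_refl)
      also have "\<dots> \<le> 2 * (\<bar>?p b d n x - ?w b d x\<bar> * \<bar>\<zeta> x\<bar>) +
          (6 * (\<Sum>c\<in>Basis. \<bar>partial c (v n) x - weak_partial \<Omega> c u x\<bar>)) * \<bar>\<zeta> x * ?w b d x\<bar>"
      proof -
        have 1: "\<bar>?a b d\<bar> \<le> 2" by (rule curv_coeff_bound[OF bd])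
        have 2: "\<bar>?a b d - ?a' b d\<bar> \<le> 6 * (\<Sum>c\<in>Basis. \<bar>partial c (v n) x - weak_partial \<Omega> c u x\<bar>)"
          by (rule order_trans[OF curv_coeff_lipschitz[OF bd] mult_left_mono[OF norm_grad_diff_le]]) simp
        show ?thesis by (intro add_mono mult_right_mono[OF 1] mult_right_mono[OF 2]) simp_all
      qed
      finally show "\<bar>(?a b d * ?p b d n x - ?a' b d * ?w b d x) * \<zeta> x\<bar> \<le>
          2 * (\<bar>?p b d n x - ?w b d x\<bar> * \<bar>\<zeta> x\<bar>) +
          (\<Sum>c\<in>Basis. 6 * (\<bar>partial c (v n) x - weak_partial \<Omega> c u x\<bar> * \<bar>\<zeta> x * ?w b d x\<bar>))"
        by (simp only: sum_distrib_left sum_distrib_right mult.assoc)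
    qed
    finally show "\<bar>graph_curvature (v n) x * \<zeta> x - weak_graph_curvature \<Omega> u x * \<zeta> x\<bar> \<le> ?R n x" .
  qed
  have "(\<lambda>n. LINT x|lebesgue_on \<Omega>. (\<Sum>b\<in>Basis. unit_slope b (grad (v n) x) * partial b \<zeta> x)) \<longlonglongrightarrow>
      - (LINT x|lebesgue_on \<Omega>. weak_graph_curvature \<Omega> u x * \<zeta> x)"
    unfolding graph_curvature_weak[OF \<Omega>(1) C2 \<zeta>] by (rule tendsto_minus[OF 2])
  with 1 show ?thesis by (rule LIMSEQ_unique)
qed

lemma unit_normal_inner:
  fixes F u \<Omega>
  defines "F \<equiv> \<lambda>x. weak_grad \<Omega> u x /\<^sub>R area_element \<Omega> u x"
  shows "F x \<bullet> y = (\<Sum>b\<in>Basis. unit_slope b (weak_grad \<Omega> u x) * (y \<bullet> b))"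
proof -
  have "F x \<bullet> y = inv_area (weak_grad \<Omega> u x) * (weak_grad \<Omega> u x \<bullet> y)"
    by (simp add: F_def inv_area_def area_element_def inverse_eq_divide)
  also have "\<dots> = inv_area (weak_grad \<Omega> u x) * (\<Sum>b\<in>Basis. (weak_grad \<Omega> u x \<bullet> b) * (y \<bullet> b))"
    by (simp only: euclidean_inner[of "weak_grad \<Omega> u x" y])
  finally show ?thesis by (simp add: sum_distrib_left unit_slope_def mult_ac)
qed

text \<open>The preceding identity exhibits a weak divergence of the vector field \<open>\<nabla>u / Q\<close>; by uniqueness
  the chosen one agrees with it.\<close>

lemma graph_mean_curvature_AE:
  fixes u :: "'a::euclidean_space \<Rightarrow> real"
  assumes \<Omega>: "open \<Omega>" "bounded \<Omega>" and u: "in_sobolev 2 \<Omega> u" and v: "W22_approx \<Omega> v u"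
  shows "AE x in lebesgue_on \<Omega>. graph_mean_curvature \<Omega> u x = weak_graph_curvature \<Omega> u x"
proof -
  let ?F = "\<lambda>x. weak_grad \<Omega> u x /\<^sub>R area_element \<Omega> u x"
  note wu = in_sobolev_2_weak_partials[OF \<Omega>(1) u]
  have "has_weak_div \<Omega> ?F (weak_graph_curvature \<Omega> u)"
    unfolding has_weak_div_def
  proof (intro conjI allI impI)
    have "?F = (\<lambda>x. \<Sum>b\<in>Basis. unit_slope b (weak_grad \<Omega> u x) *\<^sub>R b)"
    proof
      fix x
      have "?F x = (\<Sum>b\<in>Basis. (?F x \<bullet> b) *\<^sub>R b)" by (rule euclidean_representation[symmetric])
      also have "\<dots> = (\<Sum>b\<in>Basis. unit_slope b (weak_grad \<Omega> u x) *\<^sub>R b)"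
        by (intro sum.cong) (auto simp: unit_slope_def inv_area_def area_element_def inverse_eq_divide)
      finally show "?F x = (\<Sum>b\<in>Basis. unit_slope b (weak_grad \<Omega> u x) *\<^sub>R b)" .
    qed
    moreover have "integrable (lebesgue_on \<Omega>) (\<lambda>x. \<Sum>b\<in>Basis. unit_slope b (weak_grad \<Omega> u x) *\<^sub>R b)"
      by (intro Bochner_Integration.integrable_sum integrable_scaleR_left in_L2_integrable \<Omega>
          unit_slope_in_L2 wu)
    ultimately show "locally_integrable \<Omega> ?F"
      by (intro integrable_imp_locally_integrable \<Omega>) simp
    show "locally_integrable \<Omega> (weak_graph_curvature \<Omega> u)"
      by (intro integrable_imp_locally_integrable in_L2_integrable weak_graph_curvature_in_L2 \<Omega> u)
    fix \<psi> assume "test_function \<Omega> \<psi>"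
    then have "C_k (Suc 0) \<psi>" "compact (supp \<psi>)" "supp \<psi> \<subseteq> \<Omega>"
      using test_function_C_k by (auto simp only: test_function_def)
    from weak_graph_curvature_identity[OF \<Omega> u v this]
    show "(LINT x|lebesgue_on \<Omega>. ?F x \<bullet> grad \<psi> x) = - (LINT x|lebesgue_on \<Omega>. weak_graph_curvature \<Omega> u x * \<psi> x)"
      unfolding unit_normal_inner by (simp add: grad_inner_Basis)
  qed
  moreover from this have "has_weak_div \<Omega> ?F (graph_mean_curvature \<Omega> u)"
    unfolding graph_mean_curvature_def weak_div_def by (rule someI[of "has_weak_div \<Omega> ?F"])
  ultimately show ?thesis using has_weak_div_unique[OF \<Omega>(1)] by blast
qed

section \<open>The planar Sobolev inequality\<close>

lemma abs_le_nn_integral_derivative: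
  fixes f f' :: "real \<Rightarrow> real"
  assumes d: "\<And>t. (f has_real_derivative f' t) (at t)" and c: "continuous_on UNIV f'"
    and z: "\<And>t. t < R \<Longrightarrow> f t = 0"
  shows "ennreal \<bar>f t\<bar> \<le> (\<integral>\<^sup>+r. ennreal \<bar>f' r\<bar> \<partial>lborel)"
proof -
  \<comment> \<open>a point to the left of both \<open>t\<close> and the support\<close>
  define a where "a = min (R - 1) t"
  have a: "a \<le> t" "f a = 0" using z[of a] by (auto simp: a_def)
  have i: "integrable lborel (\<lambda>r. indicator {a..t} r *\<^sub>R f' r)"
    using continuous_on_subset[OF c] by (intro borel_integrable_compact) auto
  have "(LINT r|lborel. indicator {a..t} r *\<^sub>R f' r) = f t - f a"
  proof (rule integral_FTC_Icc[OF a(1)])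
    show "(f has_vector_derivative f' x) (at x within {a..t})" for x
      using d[of x] by (simp add: has_field_derivative_at_within has_real_derivative_iff_has_vector_derivative[symmetric])
    show "continuous_on {a..t} f'" using continuous_on_subset[OF c] by auto
  qed
  then have "ennreal \<bar>f t\<bar> = ennreal (norm (LINT r|lborel. indicator {a..t} r *\<^sub>R f' r))"
    using a(2) by simp
  also have "\<dots> \<le> (\<integral>\<^sup>+r. norm (indicator {a..t} r *\<^sub>R f' r) \<partial>lborel)"
    by (rule integral_norm_bound_ennreal[OF i])
  also have "\<dots> \<le> (\<integral>\<^sup>+r. ennreal \<bar>f' r\<bar> \<partial>lborel)"
    by (intro nn_integral_mono) (auto simp: indicator_def)
  finally show ?thesis .
qed

abbreviation e1 :: "real^2" where "e1 \<equiv> axis 1 1"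
abbreviation e2 :: "real^2" where "e2 \<equiv> axis 2 1"

lemma Basis_real2: "(Basis :: (real^2) set) = {e1, e2}" "e1 \<noteq> e2"
proof -
  show "(Basis :: (real^2) set) = {e1, e2}"
    by (auto simp: Basis_vec_def UNIV_2)
  show "e1 \<noteq> e2" by (simp add: axis_eq_axis)
qed

definition plane_point :: "real \<Rightarrow> real \<Rightarrow> real^2" where
  "plane_point s t = s *\<^sub>R e1 + t *\<^sub>R e2"

lemma plane_point_nth: "plane_point s t $ 1 = s" "plane_point s t $ 2 = t"
  by (auto simp: plane_point_def axis_def)

lemma plane_point_inner: "plane_point s t \<bullet> e1 = s" "plane_point s t \<bullet> e2 = t"
  by (auto simp: inner_axis plane_point_nth)

lemma continuous_on_plane_point: "continuous_on S (\<lambda>p. plane_point (fst p) (snd p))"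
  unfolding plane_point_def by (intro continuous_intros)

lemma plane_point_measurable: "(\<lambda>p. plane_point (fst p) (snd p)) \<in> borel_measurable borel"
  by (rule borel_measurable_continuous_onI[OF continuous_on_plane_point])

text \<open>Tonelli's theorem is stated for products of measure spaces; this transports it to vectors with two
  components.\<close>

lemma lborel_real2_eq_distr:
  "(lborel :: (real^2) measure) = distr lborel borel (\<lambda>p. plane_point (fst p) (snd p))"
proof (rule lborel_eqI)
  fix l u :: "real^2" assume lu: "\<And>b. b \<in> Basis \<Longrightarrow> l \<bullet> b \<le> u \<bullet> b"
  then have le: "l \<bullet> e1 \<le> u \<bullet> e1" "l \<bullet> e2 \<le> u \<bullet> e2" by (auto simp: Basis_real2(1))
  have "(\<lambda>p. plane_point (fst p) (snd p)) -` box l u \<inter> space lborel =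
      {l \<bullet> e1<..<u \<bullet> e1} \<times> {l \<bullet> e2<..<u \<bullet> e2}"
    by (auto simp: box_def Basis_real2(1) plane_point_inner)
  then have "emeasure (distr lborel borel (\<lambda>p. plane_point (fst p) (snd p))) (box l u) =
      emeasure (lborel \<Otimes>\<^sub>M lborel) ({l \<bullet> e1<..<u \<bullet> e1} \<times> {l \<bullet> e2<..<u \<bullet> e2})"
    using plane_point_measurable by (subst emeasure_distr) (auto simp: lborel_prod)
  also have "\<dots> = ennreal (u \<bullet> e1 - l \<bullet> e1) * ennreal (u \<bullet> e2 - l \<bullet> e2)"
    using le by (subst lborel.emeasure_pair_measure_Times) auto
  also have "\<dots> = ennreal (\<Prod>b\<in>Basis. (u - l) \<bullet> b)"
    using le Basis_real2(2) by (simp add: Basis_real2(1) inner_diff_left ennreal_mult)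
  finally show "emeasure (distr lborel borel (\<lambda>p. plane_point (fst p) (snd p))) (box l u) =
      (\<Prod>b\<in>Basis. (u - l) \<bullet> b)" .
qed simp

lemma
  fixes f :: "real^2 \<Rightarrow> ennreal"
  assumes [measurable]: "f \<in> borel_measurable borel"
  shows nn_integral_real2: "(\<integral>\<^sup>+x. f x \<partial>lborel) = (\<integral>\<^sup>+s. \<integral>\<^sup>+t. f (plane_point s t) \<partial>lborel \<partial>lborel)"
    and nn_integral_real2_swap: "(\<integral>\<^sup>+x. f x \<partial>lborel) = (\<integral>\<^sup>+t. \<integral>\<^sup>+s. f (plane_point s t) \<partial>lborel \<partial>lborel)"
    and nn_integral_real2_measurable1: "(\<lambda>s. \<integral>\<^sup>+t. f (plane_point s t) \<partial>lborel) \<in> borel_measurable lborel"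
    and nn_integral_real2_measurable2: "(\<lambda>t. \<integral>\<^sup>+s. f (plane_point s t) \<partial>lborel) \<in> borel_measurable lborel"
proof -
  have fm: "(\<lambda>p. f (plane_point (fst p) (snd p))) \<in> borel_measurable (lborel \<Otimes>\<^sub>M lborel)"
    using measurable_compose[OF plane_point_measurable assms] by (simp add: lborel_prod)
  have "(\<integral>\<^sup>+x. f x \<partial>lborel) = (\<integral>\<^sup>+p. f (plane_point (fst p) (snd p)) \<partial>(lborel \<Otimes>\<^sub>M lborel))"
    unfolding lborel_prod using plane_point_measurable
    by (subst lborel_real2_eq_distr, subst nn_integral_distr) auto
  moreover have "(\<integral>\<^sup>+p. f (plane_point (fst p) (snd p)) \<partial>(lborel \<Otimes>\<^sub>M lborel)) =
      (\<integral>\<^sup>+s. \<integral>\<^sup>+t. f (plane_point s t) \<partial>lborel \<partial>lborel)"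
    using lborel.nn_integral_fst[OF fm] by simp
  moreover have "(\<integral>\<^sup>+p. f (plane_point (fst p) (snd p)) \<partial>(lborel \<Otimes>\<^sub>M lborel)) =
      (\<integral>\<^sup>+t. \<integral>\<^sup>+s. f (plane_point s t) \<partial>lborel \<partial>lborel)"
    using lborel_pair.nn_integral_snd[OF fm] by simp
  ultimately show "(\<integral>\<^sup>+x. f x \<partial>lborel) = (\<integral>\<^sup>+s. \<integral>\<^sup>+t. f (plane_point s t) \<partial>lborel \<partial>lborel)"
    "(\<integral>\<^sup>+x. f x \<partial>lborel) = (\<integral>\<^sup>+t. \<integral>\<^sup>+s. f (plane_point s t) \<partial>lborel \<partial>lborel)" by simp_all
  show "(\<lambda>s. \<integral>\<^sup>+t. f (plane_point s t) \<partial>lborel) \<in> borel_measurable lborel"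
    using lborel.borel_measurable_nn_integral_fst[OF fm] by simp
  have "(\<lambda>p. f (plane_point (snd p) (fst p))) \<in> borel_measurable (lborel \<Otimes>\<^sub>M lborel)"
    using measurable_compose[OF measurable_pair_swap' fm] by (simp add: case_prod_beta')
  from lborel.borel_measurable_nn_integral_fst[OF this]
  show "(\<lambda>t. \<integral>\<^sup>+s. f (plane_point s t) \<partial>lborel) \<in> borel_measurable lborel" by simp
qed

lemma abs_le_line_integral:
  fixes \<zeta> :: "real^2 \<Rightarrow> real"
  assumes \<zeta>: "C_k (Suc 0) \<zeta>" "compact (supp \<zeta>)" and b: "b \<in> Basis"
  shows "ennreal \<bar>\<zeta> x\<bar> \<le> (\<integral>\<^sup>+r. ennreal \<bar>partial b \<zeta> (x + (r - x \<bullet> b) *\<^sub>R b)\<bar> \<partial>lborel)"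
proof -
  let ?x0 = "x - (x \<bullet> b) *\<^sub>R b"
  obtain R where R: "\<forall>y\<in>supp \<zeta>. norm y \<le> R"
    using compact_imp_bounded[OF \<zeta>(2)] unfolding bounded_iff by blast
  have "ennreal \<bar>\<zeta> (?x0 + (x \<bullet> b) *\<^sub>R b)\<bar> \<le> (\<integral>\<^sup>+r. ennreal \<bar>partial b \<zeta> (?x0 + r *\<^sub>R b)\<bar> \<partial>lborel)"
  proof (rule abs_le_nn_integral_derivative[where f = "\<lambda>r. \<zeta> (?x0 + r *\<^sub>R b)" and R = "- R"])
    show "((\<lambda>r. \<zeta> (?x0 + r *\<^sub>R b)) has_real_derivative partial b \<zeta> (?x0 + t *\<^sub>R b)) (at t)" for t
      by (intro line_has_derivative b C_k_Suc_differentiable[OF \<zeta>(1)])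
    show "continuous_on UNIV (\<lambda>r. partial b \<zeta> (?x0 + r *\<^sub>R b))"
      by (rule continuous_on_compose2[OF C_1_partial_continuous[OF \<zeta>(1) b]]) (auto intro!: continuous_intros)
    show "\<zeta> (?x0 + t *\<^sub>R b) = 0" if "t < - R" for t
    proof -
      have "(?x0 + t *\<^sub>R b) \<bullet> b = t" using b by (simp add: inner_diff_left inner_add_left)
      then have "\<bar>t\<bar> \<le> norm (?x0 + t *\<^sub>R b)" using Basis_le_norm[OF b, of "?x0 + t *\<^sub>R b"] by simp
      then have "?x0 + t *\<^sub>R b \<notin> supp \<zeta>" using R that by force
      then show ?thesis by (rule not_supp_zero)
    qed
  qed
  then show ?thesis by (simp add: algebra_simps)
qed

text \<open>The argument of Gagliardo and Nirenberg: \<open>|\<zeta> (s, t)|\<close> is bounded by the integral of \<open>|\<partial>\<^sub>1 \<zeta>|\<close> over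
  the horizontal line through \<open>(s, t)\<close>, which depends on \<open>t\<close> only, and by the integral of \<open>|\<partial>\<^sub>2 \<zeta>|\<close> over
  the vertical line, which depends on \<open>s\<close> only. The integral of the product of the two bounds factors.\<close>

lemma planar_sobolev_inequality:
  fixes \<zeta> :: "real^2 \<Rightarrow> real"
  assumes \<zeta>: "C_k (Suc 0) \<zeta>" "compact (supp \<zeta>)"
  shows "sqrt (LINT x|lborel. (\<zeta> x)\<^sup>2) \<le> (LINT x|lborel. norm (grad \<zeta> x))"
proof -
  have B: "e1 \<in> Basis" "e2 \<in> Basis" by (auto simp: Basis_real2(1))
  have c: "continuous_on UNIV \<zeta>" "continuous_on UNIV (partial e1 \<zeta>)" "continuous_on UNIV (partial e2 \<zeta>)"
    using C_k_continuous[OF \<zeta>(1)] C_1_partial_continuous[OF \<zeta>(1)] B by blast+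
  let ?g1 = "\<lambda>t. \<integral>\<^sup>+r. ennreal \<bar>partial e1 \<zeta> (plane_point r t)\<bar> \<partial>lborel"
  let ?g2 = "\<lambda>s. \<integral>\<^sup>+r. ennreal \<bar>partial e2 \<zeta> (plane_point s r)\<bar> \<partial>lborel"
  have m: "(\<lambda>x. ennreal ((\<zeta> x)\<^sup>2)) \<in> borel_measurable borel"
    "(\<lambda>x. ennreal \<bar>partial e1 \<zeta> x\<bar>) \<in> borel_measurable borel"
    "(\<lambda>x. ennreal \<bar>partial e2 \<zeta> x\<bar>) \<in> borel_measurable borel"
    using c[THEN borel_measurable_continuous_onI] by auto
  have b1: "ennreal \<bar>\<zeta> (plane_point s t)\<bar> \<le> ?g1 t" for s t
    using abs_le_line_integral[OF \<zeta> B(1), of "plane_point s t"]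
    by (simp add: plane_point_inner) (simp add: plane_point_def algebra_simps)
  have b2: "ennreal \<bar>\<zeta> (plane_point s t)\<bar> \<le> ?g2 s" for s t
    using abs_le_line_integral[OF \<zeta> B(2), of "plane_point s t"]
    by (simp add: plane_point_inner) (simp add: plane_point_def algebra_simps)
  have "(\<integral>\<^sup>+x. ennreal ((\<zeta> x)\<^sup>2) \<partial>lborel) =
      (\<integral>\<^sup>+s. \<integral>\<^sup>+t. ennreal ((\<zeta> (plane_point s t))\<^sup>2) \<partial>lborel \<partial>lborel)"
    by (rule nn_integral_real2[OF m(1)])
  also have "\<dots> \<le> (\<integral>\<^sup>+s. \<integral>\<^sup>+t. ?g2 s * ?g1 t \<partial>lborel \<partial>lborel)"
  proof (intro nn_integral_mono)
    fix s t
    have "ennreal ((\<zeta> (plane_point s t))\<^sup>2) = ennreal \<bar>\<zeta> (plane_point s t)\<bar> * ennreal \<bar>\<zeta> (plane_point s t)\<bar>"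
      by (simp add: ennreal_mult[symmetric] power2_eq_square abs_mult_self_eq)
    also have "\<dots> \<le> ?g2 s * ?g1 t" by (intro mult_mono b1 b2) auto
    finally show "ennreal ((\<zeta> (plane_point s t))\<^sup>2) \<le> ?g2 s * ?g1 t" .
  qed
  also have "\<dots> = (\<integral>\<^sup>+s. ?g2 s * (\<integral>\<^sup>+t. ?g1 t \<partial>lborel) \<partial>lborel)"
    by (intro nn_integral_cong nn_integral_cmult nn_integral_real2_measurable2[OF m(2)])
  also have "\<dots> = (\<integral>\<^sup>+s. ?g2 s \<partial>lborel) * (\<integral>\<^sup>+t. ?g1 t \<partial>lborel)"
    by (intro nn_integral_multc nn_integral_real2_measurable1[OF m(3)])
  also have "(\<integral>\<^sup>+t. ?g1 t \<partial>lborel) = (\<integral>\<^sup>+x. ennreal \<bar>partial e1 \<zeta> x\<bar> \<partial>lborel)"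
    by (rule nn_integral_real2_swap[OF m(2), symmetric])
  also have "(\<integral>\<^sup>+s. ?g2 s \<partial>lborel) = (\<integral>\<^sup>+x. ennreal \<bar>partial e2 \<zeta> x\<bar> \<partial>lborel)"
    by (rule nn_integral_real2[OF m(3), symmetric])
  also have "(\<integral>\<^sup>+x. ennreal \<bar>partial e2 \<zeta> x\<bar> \<partial>lborel) * (\<integral>\<^sup>+x. ennreal \<bar>partial e1 \<zeta> x\<bar> \<partial>lborel) \<le>
      (\<integral>\<^sup>+x. ennreal (norm (grad \<zeta> x)) \<partial>lborel) * (\<integral>\<^sup>+x. ennreal (norm (grad \<zeta> x)) \<partial>lborel)"
    using Basis_le_norm[OF B(1)] Basis_le_norm[OF B(2)] grad_inner_Basis[OF B(1)] grad_inner_Basis[OF B(2)]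
    by (intro mult_mono nn_integral_mono ennreal_leI) (metis, metis, auto)
  finally have main: "(\<integral>\<^sup>+x. ennreal ((\<zeta> x)\<^sup>2) \<partial>lborel) \<le>
      (\<integral>\<^sup>+x. ennreal (norm (grad \<zeta> x)) \<partial>lborel) * (\<integral>\<^sup>+x. ennreal (norm (grad \<zeta> x)) \<partial>lborel)" .
  have i1: "integrable lborel (\<lambda>x. norm (grad \<zeta> x))"
  proof (rule continuous_supp_integrable)
    show "continuous_on UNIV (\<lambda>x. norm (grad \<zeta> x))"
      by (intro continuous_on_norm continuous_on_grad \<zeta>)
    have "supp (\<lambda>x. norm (grad \<zeta> x)) \<subseteq> supp \<zeta>"
      unfolding supp_def[of "\<lambda>x. norm (grad \<zeta> x)"]
    proof (rule closure_minimal)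
      show "{x. norm (grad \<zeta> x) \<noteq> 0} \<subseteq> supp \<zeta>"
      proof (rule subsetI, rule ccontr)
        fix x assume "x \<in> {x. norm (grad \<zeta> x) \<noteq> 0}" "x \<notin> supp \<zeta>"
        moreover from this have "partial b \<zeta> x = 0" for b
          using supp_partial[of b \<zeta>] not_supp_zero[of x "partial b \<zeta>"] by blast
        ultimately show False by (simp add: grad_def)
      qed
    qed (simp add: supp_def)
    then show "compact (supp (\<lambda>x. norm (grad \<zeta> x)))" by (rule compact_supp_subset[OF _ \<zeta>(2)])
  qed
  have i2: "integrable lborel (\<lambda>x. (\<zeta> x)\<^sup>2)"
    unfolding power2_eq_square
    by (intro continuous_supp_integrable continuous_on_mult c compact_supp_mult \<zeta>)
  have "ennreal (LINT x|lborel. (\<zeta> x)\<^sup>2) = (\<integral>\<^sup>+x. ennreal ((\<zeta> x)\<^sup>2) \<partial>lborel)"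
    using i2 by (intro nn_integral_eq_integral[symmetric]) auto
  also note main
  also have "(\<integral>\<^sup>+x. ennreal (norm (grad \<zeta> x)) \<partial>lborel) = ennreal (LINT x|lborel. norm (grad \<zeta> x))"
    using i1 by (intro nn_integral_eq_integral) auto
  also have "ennreal (LINT x|lborel. norm (grad \<zeta> x)) * ennreal (LINT x|lborel. norm (grad \<zeta> x)) =
      ennreal ((LINT x|lborel. norm (grad \<zeta> x))\<^sup>2)"
    by (simp add: ennreal_mult[symmetric] power2_eq_square)
  finally have "(LINT x|lborel. (\<zeta> x)\<^sup>2) \<le> (LINT x|lborel. norm (grad \<zeta> x))\<^sup>2"
    by (subst (asm) ennreal_le_iff) auto
  then show ?thesis by (intro real_le_lsqrt) auto
qed

section \<open>Cutting off along the boundary\<close>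

lemma max_sq_has_derivative:
  "((\<lambda>t::real. (max 0 t)\<^sup>2) has_real_derivative 2 * max 0 t) (at t)"
proof -
  consider "t < 0" | "t > 0" | "t = 0" by linarith
  then show ?thesis
  proof cases
    case 1
    have ev: "eventually (\<lambda>s. 0 = (max 0 s)\<^sup>2) (nhds t)"
      using eventually_nhds_in_open[of "{..<0}" t] 1 by (auto elim!: eventually_mono)
    have "((\<lambda>t::real. 0) has_real_derivative 0) (at t)" by simp
    then have "((\<lambda>t::real. (max 0 t)\<^sup>2) has_real_derivative 0) (at t)"
      using DERIV_cong_ev[OF refl ev refl] by blast
    then show ?thesis using 1 by simp
  next
    case 2
    have ev: "eventually (\<lambda>s. s\<^sup>2 = (max 0 s)\<^sup>2) (nhds t)"
      using eventually_nhds_in_open[of "{0<..}" t] 2 by (auto elim!: eventually_mono)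
    have "((\<lambda>t::real. t\<^sup>2) has_real_derivative 2 * t) (at t)"
      by (auto intro!: derivative_eq_intros)
    then have "((\<lambda>t::real. (max 0 t)\<^sup>2) has_real_derivative 2 * t) (at t)"
      using DERIV_cong_ev[OF refl ev refl] by blast
    then show ?thesis using 2 by simp
  next
    case 3
    have "((\<lambda>h::real. (max 0 h)\<^sup>2 / h) \<longlongrightarrow> 0) (at 0)"
    proof (rule Lim_null_comparison)
      show "((\<lambda>h::real. \<bar>h\<bar>) \<longlongrightarrow> 0) (at 0)" by (auto intro!: tendsto_eq_intros)
      show "\<forall>\<^sub>F h::real in at 0. norm ((max 0 h)\<^sup>2 / h) \<le> \<bar>h\<bar>"
        by (auto simp: max_def power2_eq_square)
    qed
    then show ?thesis using 3 by (simp add: has_field_derivative_iff)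
  qed
qed

text \<open>With \<open>r = |x - p| / \<rho>\<close>: for \<open>r \<le> 1\<close> the inner maximum is \<open>0\<close> and the value is \<open>0\<close>; for \<open>r\<^sup>2 \<ge> 2\<close> the
  outer maximum is \<open>0\<close> and the value is \<open>1\<close>. Squares of positive parts are \<open>C\<^sup>1\<close>, so this is a \<open>C\<^sup>1\<close>
  transition within the annulus \<open>\<rho> \<le> |x - p| \<le> 2 \<rho>\<close>.\<close>

definition annulus_cutoff :: "'a::euclidean_space \<Rightarrow> real \<Rightarrow> 'a \<Rightarrow> real" where
  "annulus_cutoff p \<rho> x = 1 - (max 0 (1 - (max 0 ((norm (x - p))\<^sup>2 / \<rho>\<^sup>2 - 1))\<^sup>2))\<^sup>2"

lemma annulus_cutoff_range: "0 \<le> annulus_cutoff p \<rho> x" "annulus_cutoff p \<rho> x \<le> 1"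
  unfolding annulus_cutoff_def by (auto intro!: power_le_one)

lemma annulus_cutoff_eq_0:
  assumes "\<rho> > 0" "x \<in> ball p \<rho>"
  shows "annulus_cutoff p \<rho> x = 0"
proof -
  have "(norm (x - p))\<^sup>2 \<le> \<rho>\<^sup>2"
    using assms by (intro power_mono) (auto simp: dist_norm norm_minus_commute)
  then have "max 0 ((norm (x - p))\<^sup>2 / \<rho>\<^sup>2 - 1) = 0"
    using assms(1) by (simp add: max_def field_simps)
  then show ?thesis by (simp add: annulus_cutoff_def)
qed

lemma annulus_cutoff_outside:
  assumes "\<rho> > 0" "x \<notin> ball p (2 * \<rho>)"
  shows "max 0 (1 - (max 0 ((norm (x - p))\<^sup>2 / \<rho>\<^sup>2 - 1))\<^sup>2) = 0"
proof -
  have "(2 * \<rho>)\<^sup>2 \<le> (norm (x - p))\<^sup>2"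
    using assms by (intro power_mono) (auto simp: dist_norm norm_minus_commute)
  moreover have "(2 * \<rho>)\<^sup>2 = 4 * \<rho>\<^sup>2" by simp
  ultimately have "2 * \<rho>\<^sup>2 \<le> (norm (x - p))\<^sup>2"
    using zero_le_power2[of \<rho>] by linarith
  then have "(norm (x - p))\<^sup>2 / \<rho>\<^sup>2 - 1 \<ge> 1"
    using assms(1) by (simp add: field_simps)
  then have "(max 0 ((norm (x - p))\<^sup>2 / \<rho>\<^sup>2 - 1))\<^sup>2 \<ge> 1" by simp
  then show ?thesis by simp
qed

lemma annulus_cutoff_eq_1:
  assumes "\<rho> > 0" "x \<notin> ball p (2 * \<rho>)"
  shows "annulus_cutoff p \<rho> x = 1"
  unfolding annulus_cutoff_def annulus_cutoff_outside[OF assms] by simp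

lemma
  fixes p :: "'a::euclidean_space"
  assumes \<rho>: "\<rho> > 0"
  shows annulus_cutoff_C_1: "C_k (Suc 0) (annulus_cutoff p \<rho>)"
    and annulus_cutoff_grad: "norm (grad (annulus_cutoff p \<rho>) x) \<le> 16 / \<rho> * indicator (ball p (2 * \<rho>)) x"
proof -
  let ?s = "\<lambda>x. (norm (x - p))\<^sup>2 / \<rho>\<^sup>2 - 1"
  let ?m = "\<lambda>x. 1 - (max 0 (?s x))\<^sup>2"
  let ?c = "\<lambda>x. 2 * max 0 (?m x) * (2 * max 0 (?s x)) * (2 / \<rho>\<^sup>2)"
  have D: "(annulus_cutoff p \<rho> has_derivative (\<lambda>h. ?c x * ((x - p) \<bullet> h))) (at x)" for x
  proof -
    have s: "(?s has_derivative (\<lambda>h. 2 / \<rho>\<^sup>2 * ((x - p) \<bullet> h))) (at x)"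
      unfolding power2_norm_eq_inner using \<rho>
      by (auto intro!: derivative_eq_intros ext simp: inner_commute field_simps)
    have "((\<lambda>x. (max 0 (?s x))\<^sup>2) has_derivative (\<lambda>h. 2 * max 0 (?s x) * (2 / \<rho>\<^sup>2 * ((x - p) \<bullet> h)))) (at x)"
      by (rule has_derivative_compose[OF s max_sq_has_derivative[unfolded has_field_derivative_def]])
    from has_derivative_diff[OF has_derivative_const[of 1] this]
    have m: "(?m has_derivative (\<lambda>h. 0 - 2 * max 0 (?s x) * (2 / \<rho>\<^sup>2 * ((x - p) \<bullet> h)))) (at x)" .
    have "((\<lambda>x. (max 0 (?m x))\<^sup>2) has_derivative
        (\<lambda>h. 2 * max 0 (?m x) * (0 - 2 * max 0 (?s x) * (2 / \<rho>\<^sup>2 * ((x - p) \<bullet> h))))) (at x)"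
      by (rule has_derivative_compose[OF m max_sq_has_derivative[unfolded has_field_derivative_def]])
    from has_derivative_diff[OF has_derivative_const[of 1] this]
    have "(annulus_cutoff p \<rho> has_derivative
        (\<lambda>h. 0 - 2 * max 0 (?m x) * (0 - 2 * max 0 (?s x) * (2 / \<rho>\<^sup>2 * ((x - p) \<bullet> h))))) (at x)"
      unfolding annulus_cutoff_def[abs_def] .
    moreover have "(\<lambda>h. 0 - 2 * max 0 (?m x) * (0 - 2 * max 0 (?s x) * (2 / \<rho>\<^sup>2 * ((x - p) \<bullet> h)))) =
        (\<lambda>h. ?c x * ((x - p) \<bullet> h))" by (rule ext) (simp only: minus_diff_eq diff_0 mult_minus_right minus_minus mult.assoc)
    ultimately show ?thesis by (simp only:)
  qed
  have cont: "continuous_on UNIV (\<lambda>x. ?c x * ((x - p) \<bullet> b))" for b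
    using \<rho> by (intro continuous_intros) auto
  show "C_k (Suc 0) (annulus_cutoff p \<rho>)"
    by (rule C_k_SucI[OF D]) (use cont in simp)
  have "grad (annulus_cutoff p \<rho>) x = (\<Sum>b\<in>Basis. (?c x * ((x - p) \<bullet> b)) *\<^sub>R b)"
    unfolding grad_def using partial_eqI[OF D] by simp
  also have "\<dots> = ?c x *\<^sub>R (\<Sum>b\<in>Basis. ((x - p) \<bullet> b) *\<^sub>R b)"
    by (simp only: scaleR_sum_right scaleR_scaleR)
  also have "\<dots> = ?c x *\<^sub>R (x - p)" by (simp only: euclidean_representation)
  finally have g: "grad (annulus_cutoff p \<rho>) x = ?c x *\<^sub>R (x - p)" .
  show "norm (grad (annulus_cutoff p \<rho>) x) \<le> 16 / \<rho> * indicator (ball p (2 * \<rho>)) x"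
  proof (cases "x \<in> ball p (2 * \<rho>)")
    case False
    then show ?thesis unfolding g annulus_cutoff_outside[OF \<rho> False] by simp
  next
    case True
    \<comment> \<open>When \<open>?s x\<close> exceeds \<open>1\<close> the other factor vanishes.\<close>
    have m1: "max 0 (?m x) * max 0 (?s x) \<le> 1"
    proof (cases "?s x \<le> 1")
      case True
      then have "max 0 (?m x) \<le> 1" "max 0 (?s x) \<le> 1" by auto
      then show ?thesis by (intro mult_le_one) auto
    next
      case False
      then have "1 \<le> (max 0 (?s x))\<^sup>2" by simp
      then have "max 0 (?m x) = 0" by simp
      then show ?thesis by simp
    qed
    have n: "norm (x - p) \<le> 2 * \<rho>" using True by (simp add: dist_norm norm_minus_commute)
    have "norm (?c x *\<^sub>R (x - p)) = 8 / \<rho>\<^sup>2 * ((max 0 (?m x) * max 0 (?s x)) * norm (x - p))"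
      by (simp add: abs_mult)
    also have "\<dots> \<le> 8 / \<rho>\<^sup>2 * (1 * (2 * \<rho>))"
      using m1 n by (intro mult_left_mono mult_mono) auto
    also have "\<dots> = 16 / \<rho>" using \<rho> by (simp add: power2_eq_square)
    finally show ?thesis unfolding g using True by simp
  qed
qed

lemma grad_mult:
  assumes "f differentiable at x" "g differentiable at x"
  shows "grad (\<lambda>x. f x * g x) x = f x *\<^sub>R grad g x + g x *\<^sub>R grad f x"
  unfolding grad_def partial_mult[OF assms]
  by (simp add: scaleR_sum_right sum.distrib[symmetric] scaleR_add_left mult.commute)

lemma norm_grad_prod_le:
  fixes f :: "'i \<Rightarrow> 'a::euclidean_space \<Rightarrow> real"
  assumes "finite I" "\<And>i. i \<in> I \<Longrightarrow> C_k (Suc 0) (f i)" "\<And>i x. i \<in> I \<Longrightarrow> 0 \<le> f i x \<and> f i x \<le> 1"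
  shows "norm (grad (\<lambda>x. \<Prod>i\<in>I. f i x) x) \<le> (\<Sum>i\<in>I. norm (grad (f i) x))"
  using assms
proof (induction rule: finite_induct)
  case empty
  then show ?case by (simp add: grad_def partial_const)
next
  case (insert i I)
  let ?P = "\<lambda>x. \<Prod>i\<in>I. f i x"
  have d: "f i differentiable at x" "?P differentiable at x"
    using insert.prems(1) C_k_prod[OF insert.hyps(1), of "Suc 0" f]
    by (meson C_k_Suc_differentiable insertCI)+
  have P: "0 \<le> ?P x" "?P x \<le> 1"
    using insert.prems(2) by (auto intro!: prod_nonneg prod_le_1)
  have fi: "0 \<le> f i x" "f i x \<le> 1" using insert.prems(2) by auto
  have "grad (\<lambda>x. \<Prod>i\<in>insert i I. f i x) x = f i x *\<^sub>R grad ?P x + ?P x *\<^sub>R grad (f i) x"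
    using insert.hyps grad_mult[OF d] by simp
  also have "norm \<dots> \<le> f i x * norm (grad ?P x) + ?P x * norm (grad (f i) x)"
    by (rule order_trans[OF norm_triangle_ineq]) (use P fi in simp)
  also have "\<dots> \<le> 1 * norm (grad ?P x) + 1 * norm (grad (f i) x)"
    using P fi by (intro add_mono mult_right_mono) auto
  also have "\<dots> \<le> (\<Sum>i\<in>insert i I. norm (grad (f i) x))"
    using insert by simp
  finally show ?case .
qed

text \<open>A point outside \<open>\<Omega>\<close> lies in \<open>U\<close> or outside the closure of \<open>\<Omega>\<close>. In either case the product with the
  indicator vanishes nearby, so the jump of the indicator is harmless.\<close>

lemma C_k_restrict_open:
  fixes f :: "'a::euclidean_space \<Rightarrow> real"
  assumes \<Omega>: "open \<Omega>" and U: "open U" "frontier \<Omega> \<subseteq> U"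
  shows "C_k k f \<Longrightarrow> (\<And>x. x \<in> U \<Longrightarrow> f x = 0) \<Longrightarrow> C_k k (\<lambda>x. indicator \<Omega> x * f x)"
    and "f differentiable at x \<Longrightarrow> (\<And>x. x \<in> U \<Longrightarrow> f x = 0) \<Longrightarrow>
      ((\<lambda>x. indicator \<Omega> x * f x) has_derivative (\<lambda>h. indicator \<Omega> x * (grad f x \<bullet> h))) (at x)"
proof -
  let ?V = "U \<union> - closure \<Omega>"
  have V: "open ?V" using U by auto
  have cover: "\<Omega> \<union> ?V = UNIV"
    using U(2) \<Omega> closure_subset by (auto simp: frontier_def interior_open)
  have V0: "indicator \<Omega> y * f y = 0" if "y \<in> ?V" "\<And>x. x \<in> U \<Longrightarrow> f x = 0" for y and f :: "'a \<Rightarrow> real"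
    using that closure_subset[of \<Omega>] by (auto simp: indicator_def)
  show deriv: "((\<lambda>x. indicator \<Omega> x * f x) has_derivative (\<lambda>h. indicator \<Omega> x * (grad f x \<bullet> h))) (at x)"
    if d: "f differentiable at x" and 0: "\<And>x. x \<in> U \<Longrightarrow> f x = 0" for f x
  proof (cases "x \<in> \<Omega>")
    case True
    then have "((\<lambda>x. indicator \<Omega> x * f x) has_derivative (\<lambda>h. grad f x \<bullet> h)) (at x)"
      by (intro has_derivative_transform_within_open[OF has_derivative_grad[OF d] \<Omega>]) auto
    then show ?thesis using True by simp
  next
    case False
    then have "x \<in> ?V" using cover by blast
    then have "((\<lambda>x. indicator \<Omega> x * f x) has_derivative (\<lambda>h. 0)) (at x)"
      by (rule has_derivative_transform_within_open[OF has_derivative_const V])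
        (rule V0[OF _ 0, symmetric])
    then show ?thesis using False by simp
  qed
  show "C_k k f \<Longrightarrow> (\<And>x. x \<in> U \<Longrightarrow> f x = 0) \<Longrightarrow> C_k k (\<lambda>x. indicator \<Omega> x * f x)"
  proof (induction k arbitrary: f)
    case 0
    have "continuous_on \<Omega> (\<lambda>x. indicator \<Omega> x * f x)"
      using 0(1) by (subst continuous_on_cong[OF refl, of _ _ f]) (auto intro: continuous_on_subset)
    moreover have "continuous_on ?V (\<lambda>x. indicator \<Omega> x * f x)"
    proof (subst continuous_on_cong[OF refl])
      show "indicator \<Omega> x * f x = 0" if "x \<in> ?V" for x
        using that 0(2) by (rule V0)
    qed simp
    ultimately have "continuous_on (\<Omega> \<union> ?V) (\<lambda>x. indicator \<Omega> x * f x)"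
      by (rule continuous_on_open_Un[OF \<Omega> V])
    then show ?case unfolding cover by simp
  next
    case (Suc k)
    show ?case
    proof (rule C_k_SucI[OF deriv[OF C_k_Suc_differentiable[OF Suc.prems(1)] Suc.prems(2)]])
      fix b :: 'a assume b: "b \<in> Basis"
      have "partial b f x = 0" if "x \<in> U" for x
      proof -
        have "(f has_derivative (\<lambda>h. 0)) (at x)"
          using Suc.prems(2) that
          by (intro has_derivative_transform_within_open[OF has_derivative_const U(1), of x 0]) auto
        from partial_eqI[OF this] show ?thesis .
      qed
      then show "C_k k (\<lambda>x. indicator \<Omega> x * (grad f x \<bullet> b))"
        unfolding grad_inner_Basis[OF b] using Suc.IH C_k_Suc_partial[OF Suc.prems(1) b] by blast
    qed
  qed
qed

text \<open>The product of the annulus cutoffs, restricted to \<open>\<Omega>\<close>. Its gradient is bounded by the sum of the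
  gradients of the factors, so overlaps of the balls need not be counted.\<close>

lemma cutoff_near_balls:
  fixes \<Omega> :: "'a::euclidean_space set" and p :: "'i \<Rightarrow> 'a"
  assumes \<Omega>: "open \<Omega>" "bounded \<Omega>" and I: "finite I" "\<And>i. i \<in> I \<Longrightarrow> \<rho> i > 0"
    and cover: "frontier \<Omega> \<subseteq> (\<Union>i\<in>I. ball (p i) (\<rho> i))"
  shows "\<exists>\<eta>. C_k (Suc 0) \<eta> \<and> compact (supp \<eta>) \<and> supp \<eta> \<subseteq> \<Omega> \<and> (\<forall>x. 0 \<le> \<eta> x \<and> \<eta> x \<le> 1) \<and>
    (\<forall>x\<in>\<Omega>. (\<forall>i\<in>I. x \<notin> ball (p i) (2 * \<rho> i)) \<longrightarrow> \<eta> x = 1) \<and>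
    (\<forall>x. norm (grad \<eta> x) \<le> (\<Sum>i\<in>I. 16 / \<rho> i * indicator (ball (p i) (2 * \<rho> i)) x))"
proof -
  define f where "f x = (\<Prod>i\<in>I. annulus_cutoff (p i) (\<rho> i) x)" for x
  define \<eta> where "\<eta> x = indicator \<Omega> x * f x" for x
  let ?U = "\<Union>i\<in>I. ball (p i) (\<rho> i)"
  have f1: "C_k (Suc 0) f"
    unfolding f_def using I by (intro C_k_prod annulus_cutoff_C_1) auto
  have f0: "f x = 0" if x: "x \<in> ?U" for x
  proof -
    obtain i where i: "i \<in> I" "x \<in> ball (p i) (\<rho> i)" using x by blast
    then have "annulus_cutoff (p i) (\<rho> i) x = 0" using I(2) by (intro annulus_cutoff_eq_0)
    then show ?thesis unfolding f_def using I(1) i(1) by (intro prod_zero) auto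
  qed
  have f_range: "0 \<le> f x" "f x \<le> 1" for x
    unfolding f_def by (auto intro!: prod_nonneg prod_le_1 simp: annulus_cutoff_range)
  have U: "open ?U" by auto
  have \<eta>1: "C_k (Suc 0) \<eta>"
    unfolding \<eta>_def[abs_def] by (rule C_k_restrict_open(1)[OF \<Omega>(1) U cover f1 f0])
  have supp: "supp \<eta> \<subseteq> closure \<Omega> - ?U"
    unfolding supp_def
  proof (rule closure_minimal)
    show "{x. \<eta> x \<noteq> 0} \<subseteq> closure \<Omega> - ?U"
    proof
      fix x assume "x \<in> {x. \<eta> x \<noteq> 0}"
      then have "x \<in> \<Omega>" "f x \<noteq> 0" by (auto simp: \<eta>_def indicator_def split: if_splits)
      then show "x \<in> closure \<Omega> - ?U" using f0[of x] closure_subset[of \<Omega>] by blast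
    qed
    show "closed (closure \<Omega> - ?U)" by (intro closed_Diff U closed_closure)
  qed
  have "compact (closure \<Omega>)" using \<Omega>(2) by simp
  moreover have "closed (supp \<eta>)" by (simp add: supp_def)
  ultimately have c: "compact (supp \<eta>)"
    using supp compact_Int_closed[of "closure \<Omega>" "supp \<eta>"] by (metis Diff_subset Int_absorb1 order_trans)
  have s: "supp \<eta> \<subseteq> \<Omega>"
    using supp cover \<Omega>(1) by (auto simp: frontier_def interior_open)
  have "\<eta> x = 1" if "x \<in> \<Omega>" "\<forall>i\<in>I. x \<notin> ball (p i) (2 * \<rho> i)" for x
  proof -
    have "annulus_cutoff (p i) (\<rho> i) x = 1" if "i \<in> I" for i
      using that \<open>\<forall>i\<in>I. x \<notin> ball (p i) (2 * \<rho> i)\<close> I(2) by (intro annulus_cutoff_eq_1) auto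
    then have "f x = 1" unfolding f_def by (intro prod.neutral) blast
    then show ?thesis using \<open>x \<in> \<Omega>\<close> by (simp add: \<eta>_def)
  qed
  moreover have "norm (grad \<eta> x) \<le> (\<Sum>i\<in>I. 16 / \<rho> i * indicator (ball (p i) (2 * \<rho> i)) x)" for x
  proof -
    have "(\<eta> has_derivative (\<lambda>h. indicator \<Omega> x * (grad f x \<bullet> h))) (at x)"
      unfolding \<eta>_def[abs_def]
      by (rule C_k_restrict_open(2)[OF \<Omega>(1) U cover C_k_Suc_differentiable[OF f1] f0])
    from partial_eqI[OF this]
    have "grad \<eta> x = (\<Sum>b\<in>Basis. (indicator \<Omega> x * partial b f x) *\<^sub>R b)"
      unfolding grad_def by (intro sum.cong) (auto simp: grad_inner_Basis)
    also have "\<dots> = indicator \<Omega> x *\<^sub>R grad f x"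
      unfolding grad_def by (simp add: scaleR_sum_right)
    also have "norm \<dots> \<le> norm (grad f x)" by (simp add: indicator_def)
    also have "\<dots> \<le> (\<Sum>i\<in>I. norm (grad (annulus_cutoff (p i) (\<rho> i)) x))"
      unfolding f_def[abs_def]
      by (intro norm_grad_prod_le annulus_cutoff_C_1 conjI annulus_cutoff_range I)
    also have "\<dots> \<le> (\<Sum>i\<in>I. 16 / \<rho> i * indicator (ball (p i) (2 * \<rho> i)) x)"
      by (intro sum_mono annulus_cutoff_grad I)
    finally show ?thesis .
  qed
  moreover have "0 \<le> \<eta> x \<and> \<eta> x \<le> 1" for x
    using f_range[of x] by (auto simp: \<eta>_def indicator_def)
  ultimately show ?thesis using \<eta>1 c s by blast
qed

text \<open>A ball of radius \<open>2 \<rho>\<close> has area at most \<open>16 \<rho>\<^sup>2\<close> and the gradient there is of size \<open>16 / \<rho>\<close>: each ball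
  contributes a multiple of its radius, as a boundary arc of that length does.\<close>

lemma integral_near_balls:
  fixes w :: "real^2 \<Rightarrow> real" and p :: "'i \<Rightarrow> real^2"
  assumes \<Omega>: "open \<Omega>" "bounded \<Omega>" and I: "finite I" "\<And>i. i \<in> I \<Longrightarrow> \<rho> i > 0"
    and w: "continuous_on UNIV w" and g: "continuous_on UNIV g"
    and wS: "\<And>i x. i \<in> I \<Longrightarrow> x \<in> ball (p i) (2 * \<rho> i) \<Longrightarrow> \<bar>w x\<bar> \<le> S i"
    and gle: "\<And>x. \<bar>g x\<bar> \<le> (\<Sum>i\<in>I. 16 / \<rho> i * indicator (ball (p i) (2 * \<rho> i)) x)"
  shows "(LINT x|lebesgue_on \<Omega>. \<bar>w x\<bar> * \<bar>g x\<bar>) \<le> (\<Sum>i\<in>I. 256 * \<rho> i * S i)"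
proof -
  have ib: "integrable lborel (\<lambda>x. indicator (ball (p i) (2 * \<rho> i)) x * c)" for i and c :: real
    using emeasure_bounded_finite[of "ball (p i) (2 * \<rho> i)"] by (intro integrable_mult_left) (auto simp: top.not_eq_extremum)
  have Sn: "S i \<ge> 0" if "i \<in> I" for i
    using wS[OF that, of "p i"] I(2)[OF that] by auto
  have pt: "indicator \<Omega> x *\<^sub>R (\<bar>w x\<bar> * \<bar>g x\<bar>) \<le> (\<Sum>i\<in>I. indicator (ball (p i) (2 * \<rho> i)) x * (16 / \<rho> i * S i))" for x
  proof -
    have "indicator \<Omega> x *\<^sub>R (\<bar>w x\<bar> * \<bar>g x\<bar>) \<le> \<bar>w x\<bar> * \<bar>g x\<bar>" by (simp add: indicator_def)
    also have "\<dots> \<le> \<bar>w x\<bar> * (\<Sum>i\<in>I. 16 / \<rho> i * indicator (ball (p i) (2 * \<rho> i)) x)"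
      by (intro mult_left_mono gle) auto
    also have "\<dots> = (\<Sum>i\<in>I. indicator (ball (p i) (2 * \<rho> i)) x * (16 / \<rho> i * \<bar>w x\<bar>))"
      by (simp add: sum_distrib_left mult_ac)
    also have "\<dots> \<le> (\<Sum>i\<in>I. indicator (ball (p i) (2 * \<rho> i)) x * (16 / \<rho> i * S i))"
    proof (rule sum_mono)
      fix i assume i: "i \<in> I"
      show "indicator (ball (p i) (2 * \<rho> i)) x * (16 / \<rho> i * \<bar>w x\<bar>) \<le>
          indicator (ball (p i) (2 * \<rho> i)) x * (16 / \<rho> i * S i)"
        using wS[OF i, of x] I(2)[OF i] by (cases "x \<in> ball (p i) (2 * \<rho> i)") (auto intro!: divide_right_mono)
    qed
    finally show ?thesis .
  qed
  have bi: "integrable lborel (\<lambda>x. \<Sum>i\<in>I. indicator (ball (p i) (2 * \<rho> i)) x * (16 / \<rho> i * S i))"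
    by (intro Bochner_Integration.integrable_sum ib)
  have "(LINT x|lebesgue_on \<Omega>. \<bar>w x\<bar> * \<bar>g x\<bar>) = (LINT x|lebesgue. indicator \<Omega> x *\<^sub>R (\<bar>w x\<bar> * \<bar>g x\<bar>))"
    by (rule lebesgue_on_integral_indicator[OF \<Omega>(1)])
  also have "\<dots> \<le> (LINT x|lebesgue. (\<Sum>i\<in>I. indicator (ball (p i) (2 * \<rho> i)) x * (16 / \<rho> i * S i)))"
  proof (rule Bochner_Integration.integral_mono)
    show bi': "integrable lebesgue (\<lambda>x. \<Sum>i\<in>I. indicator (ball (p i) (2 * \<rho> i)) x * (16 / \<rho> i * S i))"
      using bi borel_measurable_integrable[OF bi] by (subst integrable_completion) auto
    have "integrable (lebesgue_on \<Omega>) (\<lambda>x. \<bar>w x\<bar> * \<bar>g x\<bar>)"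
      using w g by (intro L2_mult_integrable continuous_in_L2 \<Omega> continuous_intros)
    then show "integrable lebesgue (\<lambda>x. indicator \<Omega> x *\<^sub>R (\<bar>w x\<bar> * \<bar>g x\<bar>))"
      by (simp only: lebesgue_on_integrable_indicator[OF \<Omega>(1)])
  qed (rule pt)
  also have "\<dots> = (LINT x|lborel. (\<Sum>i\<in>I. indicator (ball (p i) (2 * \<rho> i)) x * (16 / \<rho> i * S i)))"
    using borel_measurable_integrable[OF bi] by (intro integral_completion) auto
  also have "\<dots> = (\<Sum>i\<in>I. LINT x|lborel. indicator (ball (p i) (2 * \<rho> i)) x * (16 / \<rho> i * S i))"
    by (intro Bochner_Integration.integral_sum ib)
  also have "\<dots> \<le> (\<Sum>i\<in>I. 256 * \<rho> i * S i)"
  proof (rule sum_mono)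
    fix i assume i: "i \<in> I"
    have "measure lborel (ball (p i) (2 * \<rho> i)) = pi * (2 * \<rho> i)\<^sup>2"
      using I(2)[OF i] content_ball[of "2 * \<rho> i" "p i"] by (simp add: unit_ball_vol_2)
    also have "\<dots> \<le> 4 * (2 * \<rho> i)\<^sup>2" using pi_less_4 by (intro mult_right_mono) auto
    finally have m: "measure lborel (ball (p i) (2 * \<rho> i)) \<le> 4 * (2 * \<rho> i)\<^sup>2" .
    have "(LINT x|lborel. indicator (ball (p i) (2 * \<rho> i)) x * (16 / \<rho> i * S i)) =
        measure lborel (ball (p i) (2 * \<rho> i)) * (16 / \<rho> i * S i)" by simp
    also have "\<dots> \<le> 4 * (2 * \<rho> i)\<^sup>2 * (16 / \<rho> i * S i)"
      using m I(2)[OF i] Sn[OF i] by (intro mult_right_mono) auto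
    also have "\<dots> = 256 * \<rho> i * S i" using I(2)[OF i] by (simp add: power2_eq_square)
    finally show "(LINT x|lborel. indicator (ball (p i) (2 * \<rho> i)) x * (16 / \<rho> i * S i)) \<le> 256 * \<rho> i * S i" .
  qed
  finally show ?thesis .
qed

lemma unit_speed_Lipschitz:
  fixes \<gamma> :: "real \<Rightarrow> 'a::euclidean_space"
  assumes "\<And>t. t \<in> {a..b} \<Longrightarrow> (\<gamma> has_vector_derivative \<gamma>' t) (at t within {a..b}) \<and> norm (\<gamma>' t) = 1"
    and "s \<in> {a..b}" "t \<in> {a..b}"
  shows "dist (\<gamma> s) (\<gamma> t) \<le> \<bar>s - t\<bar>"
proof -
  have "norm (\<gamma> s - \<gamma> t) \<le> 1 * norm (s - t)"
  proof (rule differentiable_bound[OF convex_real_interval(5)[of a b]])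
    show "(\<gamma> has_derivative (\<lambda>h. h *\<^sub>R \<gamma>' x)) (at x within {a..b})" if "x \<in> {a..b}" for x
      using assms(1)[OF that] by (simp add: has_vector_derivative_def)
    show "onorm (\<lambda>h. h *\<^sub>R \<gamma>' x) \<le> 1" if "x \<in> {a..b}" for x
      using assms(1)[OF that] by (intro onorm_bound) auto
  qed (use assms in auto)
  then show ?thesis by (simp add: dist_norm)
qed

lemma integral_uniform_partition:
  fixes g :: "real \<Rightarrow> real"
  assumes "continuous_on {a..a + real n * h} g" "h \<ge> 0"
  shows "(\<Sum>j<n. integral {a + real j * h..a + real (Suc j) * h} g) = integral {a..a + real n * h} g"
  using assms(1)
proof (induction n)
  case 0
  then show ?case by simp
next
  case (Suc n)
  have le: "a \<le> a + real n * h" "a + real n * h \<le> a + real (Suc n) * h"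
    using assms(2) by (auto simp: algebra_simps)
  have "continuous_on {a..a + real n * h} g"
    by (rule continuous_on_subset[OF Suc.prems]) (use le in auto)
  then have "(\<Sum>j<Suc n. integral {a + real j * h..a + real (Suc j) * h} g) =
      integral {a..a + real n * h} g + integral {a + real n * h..a + real (Suc n) * h} g"
    using Suc.IH by simp
  also have "\<dots> = integral {a..a + real (Suc n) * h} g"
    by (rule Henstock_Kurzweil_Integration.integral_combine[OF le integrable_continuous_real[OF Suc.prems]])
  finally show ?case .
qed

text \<open>A Riemann sum for the integral of \<open>|w|\<close> along the curve, with the error controlled by the modulus of
  continuity of \<open>w\<close>.\<close>

lemma curve_sum_le_integral:
  fixes \<gamma> :: "real \<Rightarrow> 'a::euclidean_space" and w :: "'a \<Rightarrow> real"
  assumes ab: "a < b" and N: "N > 0" and h: "h = (b - a) / real N"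
    and lip: "\<And>s t. s \<in> {a..b} \<Longrightarrow> t \<in> {a..b} \<Longrightarrow> dist (\<gamma> s) (\<gamma> t) \<le> \<bar>s - t\<bar>"
    and w: "continuous_on UNIV w" and unif: "\<And>x y. dist x y < d \<Longrightarrow> \<bar>w x - w y\<bar> \<le> \<tau>" and hd: "h < d"
  shows "(\<Sum>j<N. h * \<bar>w (\<gamma> (a + real j * h))\<bar>) \<le> (LINT t|lebesgue_on {a..b}. \<bar>w (\<gamma> t)\<bar>) + \<tau> * (b - a)"
proof -
  have h0: "h > 0" and Nh: "a + real N * h = b" using ab N by (auto simp: h)
  have \<gamma>: "continuous_on {a..b} \<gamma>"
    unfolding continuous_on_iff
  proof (intro ballI allI impI)
    fix x e :: real assume "x \<in> {a..b}" "e > 0"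
    then show "\<exists>d>0. \<forall>y\<in>{a..b}. dist y x < d \<longrightarrow> dist (\<gamma> y) (\<gamma> x) < e"
      using lip by (intro exI[of _ e]) (force simp: dist_real_def)
  qed
  let ?g = "\<lambda>t. \<bar>w (\<gamma> t)\<bar> + \<tau>"
  have gc: "continuous_on {a..b} (\<lambda>t. \<bar>w (\<gamma> t)\<bar>)"
    by (intro continuous_intros continuous_on_compose2[OF w \<gamma>]) auto
  have g: "continuous_on {a..b} ?g" by (intro continuous_on_add gc continuous_on_const)
  have "(\<Sum>j<N. h * \<bar>w (\<gamma> (a + real j * h))\<bar>) \<le> (\<Sum>j<N. integral {a + real j * h..a + real (Suc j) * h} ?g)"
  proof (rule sum_mono)
    fix j assume "j \<in> {..<N}"
    then have "real (Suc j) \<le> real N" by simp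
    then have "a + real (Suc j) * h \<le> b"
      unfolding Nh[symmetric] using h0 by (intro add_left_mono mult_right_mono) auto
    then have sub: "{a + real j * h..a + real (Suc j) * h} \<subseteq> {a..b}" using h0 by (auto simp: algebra_simps)
    have "h * \<bar>w (\<gamma> (a + real j * h))\<bar> = integral {a + real j * h..a + real (Suc j) * h} (\<lambda>_. \<bar>w (\<gamma> (a + real j * h))\<bar>)"
      using h0 by (simp add: algebra_simps)
    also have "\<dots> \<le> integral {a + real j * h..a + real (Suc j) * h} ?g"
    proof (rule integral_le)
      show "?g integrable_on {a + real j * h..a + real (Suc j) * h}"
        by (rule integrable_continuous_real[OF continuous_on_subset[OF g sub]])
      fix t assume t: "t \<in> {a + real j * h..a + real (Suc j) * h}"
      have "a + real j * h \<in> {a + real j * h..a + real (Suc j) * h}" using h0 by (simp add: algebra_simps)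
      then have "dist (\<gamma> (a + real j * h)) (\<gamma> t) \<le> \<bar>a + real j * h - t\<bar>"
        using sub t by (intro lip) auto
      also have "\<dots> \<le> h" using t by (auto simp: algebra_simps)
      also have "\<dots> < d" by (rule hd)
      finally have "\<bar>w (\<gamma> (a + real j * h)) - w (\<gamma> t)\<bar> \<le> \<tau>" by (rule unif)
      then show "\<bar>w (\<gamma> (a + real j * h))\<bar> \<le> \<bar>w (\<gamma> t)\<bar> + \<tau>" by linarith
    qed (rule integrable_const_ivl)
    finally show "h * \<bar>w (\<gamma> (a + real j * h))\<bar> \<le> integral {a + real j * h..a + real (Suc j) * h} ?g" .
  qed
  also have "\<dots> = integral {a..b} ?g"
    using integral_uniform_partition[of a N h ?g] g h0 unfolding Nh by simp
  also have "\<dots> = integral {a..b} (\<lambda>t. \<bar>w (\<gamma> t)\<bar>) + \<tau> * (b - a)"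
    using ab integrable_continuous_real[OF gc]
    by (subst Henstock_Kurzweil_Integration.integral_add) (auto intro: integrable_const_ivl)
  also have "integral {a..b} (\<lambda>t. \<bar>w (\<gamma> t)\<bar>) = (LINT t|lebesgue_on {a..b}. \<bar>w (\<gamma> t)\<bar>)"
    by (rule lebesgue_integral_eq_integral[symmetric]) (auto intro: continuous_imp_integrable_real[OF gc])
  finally show ?thesis .
qed

lemma continuous_supp_uniformly_continuous:
  fixes w :: "'a::euclidean_space \<Rightarrow> real"
  assumes w: "continuous_on UNIV w" "compact (supp w)" and "\<sigma> > 0"
  shows "\<exists>d>0. \<forall>x y. dist x y < d \<longrightarrow> \<bar>w x - w y\<bar> \<le> \<sigma>"
proof -
  obtain R where R: "\<forall>y\<in>supp w. norm y \<le> R"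
    using compact_imp_bounded[OF w(2)] unfolding bounded_iff by blast
  have "uniformly_continuous_on (cball 0 (R + 1)) w"
    using continuous_on_subset[OF w(1)] by (intro compact_uniformly_continuous) auto
  then obtain d where d: "d > 0"
    "\<And>x y. x \<in> cball 0 (R + 1) \<Longrightarrow> y \<in> cball 0 (R + 1) \<Longrightarrow> dist y x < d \<Longrightarrow> dist (w y) (w x) < \<sigma>"
    unfolding uniformly_continuous_on_def using \<open>\<sigma> > 0\<close> by metis
  have zero: "w x = 0" if "norm x > R" for x
    using R that by (intro not_supp_zero) force
  have "\<bar>w x - w y\<bar> \<le> \<sigma>" if xy: "dist x y < min d 1" for x y
  proof (cases "norm x \<le> R + 1 \<and> norm y \<le> R + 1")
    case True
    then have "dist (w x) (w y) < \<sigma>" using d(2)[of y x] xy by simp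
    then show ?thesis by (simp add: dist_real_def)
  next
    case False
    have "norm x \<le> norm y + dist x y" "norm y \<le> norm x + dist x y"
      using norm_triangle_ineq2[of x y] norm_triangle_ineq2[of y x]
      by (simp_all add: dist_norm norm_minus_commute)
    then have "norm x > R" "norm y > R" using False xy by auto
    then show ?thesis using zero \<open>\<sigma> > 0\<close> by simp
  qed
  with d(1) show ?thesis by (intro exI[of _ "min d 1"]) auto
qed

lemma arclength_parametrization_facts:
  assumes "arclength_parametrization n a b \<gamma> S" and "k < n"
  shows "a k < b k"
    and "s \<in> {a k..b k} \<Longrightarrow> t \<in> {a k..b k} \<Longrightarrow> dist (\<gamma> k s) (\<gamma> k t) \<le> \<bar>s - t\<bar>"
    and "t \<in> {a k..b k} \<Longrightarrow> \<gamma> k t \<in> S"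
proof -
  note curve = assms(1)[unfolded arclength_parametrization_def, THEN conjunct1, rule_format, OF assms(2)]
  show "a k < b k" using curve by (rule conjunct1)
  obtain \<gamma>' where speed: "\<forall>t\<in>{a k..b k}. (\<gamma> k has_vector_derivative \<gamma>' t) (at t within {a k..b k}) \<and> norm (\<gamma>' t) = 1"
    using curve by blast
  show "dist (\<gamma> k s) (\<gamma> k t) \<le> \<bar>s - t\<bar>" if "s \<in> {a k..b k}" "t \<in> {a k..b k}"
    by (rule unit_speed_Lipschitz[OF bspec[OF speed] that])
  have "(\<Union>k<n. \<gamma> k ` {a k..b k}) = S"
    using assms(1) unfolding arclength_parametrization_def by (elim conjE)
  then show "\<gamma> k t \<in> S" if "t \<in> {a k..b k}" using assms(2) that by blast
qed

lemma nearest_partition_point: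
  fixes x :: real
  assumes "0 \<le> x" "x \<le> real (Suc N)"
  shows "\<exists>j<Suc N. \<bar>x - real j\<bar> \<le> 1"
proof (cases "x < real (Suc N)")
  case True
  have "\<bar>x - real (nat \<lfloor>x\<rfloor>)\<bar> \<le> 1" "nat \<lfloor>x\<rfloor> < Suc N"
    using assms(1) True by linarith+
  then show ?thesis by blast
next
  case False
  then show ?thesis using assms by (intro exI[of _ N]) auto
qed

text \<open>Each boundary curve is divided into \<open>N + 1\<close> arcs of equal length \<open>h\<close>, and \<open>\<Omega>\<close> is cut off at balls of
  radius \<open>2 h\<close> around the initial points of the arcs, which cover the boundary by unit speed. The
  integral of \<open>|w| |\<nabla>\<eta>|\<close> is then bounded by \<open>256 \<cdot> 2 h\<close> times a sum of values of \<open>|w|\<close>, a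
  Riemann sum of \<open>512 |w|\<close> along the boundary.\<close>

lemma boundary_cutoffs:
  fixes \<Omega> :: "(real^2) set" and w :: "real^2 \<Rightarrow> real"
  assumes \<Omega>: "open \<Omega>" "bounded \<Omega>" and arc: "arclength_parametrization n a b \<gamma> (frontier \<Omega>)"
    and w: "continuous_on UNIV w" "compact (supp w)"
  shows "\<exists>\<eta> :: nat \<Rightarrow> real^2 \<Rightarrow> real.
    (\<forall>N. C_k (Suc 0) (\<eta> N) \<and> compact (supp (\<eta> N)) \<and> supp (\<eta> N) \<subseteq> \<Omega> \<and> (\<forall>x. 0 \<le> \<eta> N x \<and> \<eta> N x \<le> 1)) \<and>
    (\<forall>x\<in>\<Omega>. (\<lambda>N. \<eta> N x) \<longlonglongrightarrow> 1) \<and>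
    (\<forall>\<tau>>0. \<forall>\<^sub>F N in sequentially. (LINT x|lebesgue_on \<Omega>. \<bar>w x\<bar> * norm (grad (\<eta> N) x)) \<le>
        512 * L1_boundary_norm n a b \<gamma> w + \<tau>)"
proof -
  note ab = arclength_parametrization_facts(1)[OF arc]
  note lip = arclength_parametrization_facts(2)[OF arc]
  note on_frontier = arclength_parametrization_facts(3)[OF arc]
  define h where "h N k = (b k - a k) / real (Suc N)" for N k
  define T where "T N k j = a k + real j * h N k" for N k j
  define I where "I N = (SIGMA k:{..<n}. {..<Suc N})" for N
  define p where "p N = (\<lambda>(k, j). \<gamma> k (T N k j))" for N
  define \<rho> where "\<rho> N = (\<lambda>(k, j::nat). 2 * h N k)" for N
  have h0: "h N k > 0" if "k < n" for N k using ab[OF that] by (simp add: h_def)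
  have Nh: "real (Suc N) * h N k = b k - a k" for N k by (simp add: h_def)
  have T: "T N k j \<in> {a k..b k}" if "k < n" "j < Suc N" for N k j
  proof -
    have "real j * h N k \<le> real (Suc N) * h N k"
      using that h0[OF that(1), of N] by (intro mult_right_mono) auto
    then show ?thesis using h0[OF that(1), of N] unfolding Nh by (simp add: T_def)
  qed
  have fin: "finite (I N)" for N by (simp add: I_def)
  have \<rho>0: "\<rho> N i > 0" if "i \<in> I N" for N i
    using that h0 by (auto simp: I_def \<rho>_def)
  have cover: "frontier \<Omega> \<subseteq> (\<Union>i\<in>I N. ball (p N i) (\<rho> N i))" for N
  proof
    fix x assume "x \<in> frontier \<Omega>"
    moreover have "(\<Union>k<n. \<gamma> k ` {a k..b k}) = frontier \<Omega>"
      using arc unfolding arclength_parametrization_def by (elim conjE)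
    ultimately obtain k t where k: "k < n" "t \<in> {a k..b k}" "x = \<gamma> k t" by blast
    have hk: "h N k > 0" by (rule h0[OF k(1)])
    have "0 \<le> (t - a k) / h N k" using k(2) hk by simp
    moreover have "(t - a k) / h N k \<le> real (Suc N)"
      using k(2) hk Nh[of N k] by (simp add: pos_divide_le_eq del: of_nat_Suc)
    ultimately obtain j where j: "j < Suc N" "\<bar>(t - a k) / h N k - real j\<bar> \<le> 1"
      using nearest_partition_point by blast
    have "\<bar>t - T N k j\<bar> = h N k * \<bar>(t - a k) / h N k - real j\<bar>"
    proof -
      have "t - T N k j = h N k * ((t - a k) / h N k - real j)"
        using hk by (simp add: T_def field_simps)
      then show ?thesis using hk by (simp add: abs_mult)
    qed
    also have "\<dots> \<le> h N k * 1" using j(2) hk by (intro mult_left_mono) auto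
    finally have "dist (\<gamma> k (T N k j)) (\<gamma> k t) \<le> h N k"
      using lip[OF k(1) T[OF k(1) j(1)] k(2)] by linarith
    then have "x \<in> ball (p N (k, j)) (\<rho> N (k, j))" using hk k(3) by (simp add: p_def \<rho>_def)
    moreover have "(k, j) \<in> I N" using k(1) j(1) by (simp add: I_def)
    ultimately show "x \<in> (\<Union>i\<in>I N. ball (p N i) (\<rho> N i))" by blast
  qed
  obtain \<eta> where \<eta>: "\<And>N. C_k (Suc 0) (\<eta> N)" "\<And>N. compact (supp (\<eta> N))" "\<And>N. supp (\<eta> N) \<subseteq> \<Omega>"
    "\<And>N x. 0 \<le> \<eta> N x \<and> \<eta> N x \<le> 1"
    "\<And>N x. x \<in> \<Omega> \<Longrightarrow> (\<forall>i\<in>I N. x \<notin> ball (p N i) (2 * \<rho> N i)) \<Longrightarrow> \<eta> N x = 1"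
    "\<And>N x. norm (grad (\<eta> N) x) \<le> (\<Sum>i\<in>I N. 16 / \<rho> N i * indicator (ball (p N i) (2 * \<rho> N i)) x)"
  proof -
    have "\<forall>N. \<exists>\<eta>. C_k (Suc 0) \<eta> \<and> compact (supp \<eta>) \<and> supp \<eta> \<subseteq> \<Omega> \<and> (\<forall>x. 0 \<le> \<eta> x \<and> \<eta> x \<le> 1) \<and>
      (\<forall>x\<in>\<Omega>. (\<forall>i\<in>I N. x \<notin> ball (p N i) (2 * \<rho> N i)) \<longrightarrow> \<eta> x = 1) \<and>
      (\<forall>x. norm (grad \<eta> x) \<le> (\<Sum>i\<in>I N. 16 / \<rho> N i * indicator (ball (p N i) (2 * \<rho> N i)) x))"
      by (intro allI cutoff_near_balls \<Omega> fin \<rho>0 cover)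
    from choice[OF this] show thesis using that by blast
  qed
  have small: "\<forall>\<^sub>F N in sequentially. \<forall>k\<in>{..<n}. 4 * h N k < d" if "d > 0" for d
  proof (intro eventually_ball_finite ballI)
    fix k
    have "(\<lambda>N. 4 * ((b k - a k) * (1 / real (Suc N)))) \<longlonglongrightarrow> 4 * ((b k - a k) * 0)"
      by (intro tendsto_intros LIMSEQ_Suc[OF lim_1_over_n])
    then have "(\<lambda>N. 4 * h N k) \<longlonglongrightarrow> 0" by (simp add: h_def)
    then show "\<forall>\<^sub>F N in sequentially. 4 * h N k < d" using \<open>d > 0\<close> by (rule order_tendstoD)
  qed simp
  have "(\<lambda>N. \<eta> N x) \<longlonglongrightarrow> 1" if x: "x \<in> \<Omega>" for x
  proof -
    obtain d where d: "d > 0" "ball x d \<subseteq> \<Omega>" using \<Omega>(1) x open_contains_ball by blast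
    \<comment> \<open>Once \<open>4 h\<close> is less than the distance of \<open>x\<close> to the boundary, no ball reaches \<open>x\<close>.\<close>
    have "\<forall>\<^sub>F N in sequentially. \<eta> N x = 1"
      using small[OF d(1)]
    proof eventually_elim
      case (elim N)
      show ?case
      proof (rule \<eta>(5)[OF x], rule ballI)
        fix i assume "i \<in> I N"
        then obtain k j where i: "i = (k, j)" "k < n" "j < Suc N" by (auto simp: I_def)
        have "p N i \<in> frontier \<Omega>" using on_frontier[OF i(2) T[OF i(2,3)]] by (simp add: p_def i(1))
        then have "p N i \<notin> ball x d" using d(2) \<Omega>(1) by (auto simp: frontier_def interior_open)
        moreover have "2 * \<rho> N i < d" using elim i by (simp add: \<rho>_def)
        ultimately show "x \<notin> ball (p N i) (2 * \<rho> N i)" by (simp add: dist_commute)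
      qed
    qed
    then show ?thesis by (rule tendsto_eventually)
  qed
  moreover have "\<forall>\<^sub>F N in sequentially. (LINT x|lebesgue_on \<Omega>. \<bar>w x\<bar> * norm (grad (\<eta> N) x)) \<le>
        512 * L1_boundary_norm n a b \<gamma> w + \<tau>" if \<tau>: "\<tau> > 0" for \<tau>
  proof -
    define L where "L = (\<Sum>k<n. b k - a k)"
    have L: "L \<ge> 0" unfolding L_def using ab by (intro sum_nonneg) (auto intro: less_imp_le)
    \<comment> \<open>Oscillation allowed for \<open>w\<close> on a ball and along an arc: each costs \<open>512 \<sigma> L\<close> in total.\<close>
    define \<sigma> where "\<sigma> = \<tau> / (L + 1) / 1024"
    have \<sigma>: "\<sigma> > 0" using \<tau> L by (simp add: \<sigma>_def)
    have \<sigma>L: "1024 * \<sigma> * L \<le> \<tau>"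
    proof -
      have "1024 * \<sigma> * L = \<tau> * (L / (L + 1))" using L by (simp add: \<sigma>_def field_simps)
      also have "\<dots> \<le> \<tau> * 1" using L \<tau> by (intro mult_left_mono) auto
      finally show ?thesis by simp
    qed
    obtain d where d: "d > 0" "\<And>x y. dist x y < d \<Longrightarrow> \<bar>w x - w y\<bar> \<le> \<sigma>"
      using continuous_supp_uniformly_continuous[OF w \<sigma>] by blast
    show ?thesis using small[OF d(1)]
    proof eventually_elim
      case (elim N)
      define S where "S i = \<bar>w (p N i)\<bar> + \<sigma>" for i
      have "(LINT x|lebesgue_on \<Omega>. \<bar>w x\<bar> * \<bar>norm (grad (\<eta> N) x)\<bar>) \<le> (\<Sum>i\<in>I N. 256 * \<rho> N i * S i)"
      proof (rule integral_near_balls[OF \<Omega> fin \<rho>0 w(1)])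
        show "continuous_on UNIV (\<lambda>x. norm (grad (\<eta> N) x))"
          by (intro continuous_on_norm continuous_on_grad \<eta>)
        show "\<bar>norm (grad (\<eta> N) x)\<bar> \<le> (\<Sum>i\<in>I N. 16 / \<rho> N i * indicator (ball (p N i) (2 * \<rho> N i)) x)" for x
          using \<eta>(6) by simp
        fix i x assume i: "i \<in> I N" and x: "x \<in> ball (p N i) (2 * \<rho> N i)"
        have "2 * \<rho> N i < d" using i elim by (auto simp: I_def \<rho>_def)
        then have "\<bar>w (p N i) - w x\<bar> \<le> \<sigma>" using x by (intro d(2)) auto
        then show "\<bar>w x\<bar> \<le> S i" by (simp add: S_def)
      qed
      also have "\<dots> = (\<Sum>k<n. \<Sum>j<Suc N. 256 * \<rho> N (k, j) * S (k, j))"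
        unfolding I_def by (subst sum.Sigma) auto
      also have "\<dots> \<le> (\<Sum>k<n. 512 * (LINT t|lebesgue_on {a k..b k}. \<bar>w (\<gamma> k t)\<bar>) + 1024 * \<sigma> * (b k - a k))"
      proof (rule sum_mono)
        fix k assume "k \<in> {..<n}"
        then have k: "k < n" by simp
        have "h N k < d" using elim k h0[OF k, of N] by force
        then have "(\<Sum>j<Suc N. h N k * \<bar>w (\<gamma> k (a k + real j * h N k))\<bar>) \<le>
            (LINT t|lebesgue_on {a k..b k}. \<bar>w (\<gamma> k t)\<bar>) + \<sigma> * (b k - a k)"
          by (intro curve_sum_le_integral[OF ab[OF k] _ h_def lip[OF k] w(1) d(2)]) auto
        moreover have "(\<Sum>j<Suc N. 256 * \<rho> N (k, j) * S (k, j)) =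
            512 * (\<Sum>j<Suc N. h N k * \<bar>w (\<gamma> k (a k + real j * h N k))\<bar>) + 512 * \<sigma> * (real (Suc N) * h N k)"
          unfolding S_def p_def \<rho>_def T_def
          by (simp add: sum_distrib_left sum.distrib distrib_left algebra_simps del: sum.lessThan_Suc of_nat_Suc)
        ultimately show "(\<Sum>j<Suc N. 256 * \<rho> N (k, j) * S (k, j)) \<le>
            512 * (LINT t|lebesgue_on {a k..b k}. \<bar>w (\<gamma> k t)\<bar>) + 1024 * \<sigma> * (b k - a k)"
          unfolding Nh by simp
      qed
      also have "\<dots> = 512 * L1_boundary_norm n a b \<gamma> w + 1024 * \<sigma> * L"
        by (simp add: sum.distrib L1_boundary_norm_def L_def sum_distrib_left)
      also have "\<dots> \<le> 512 * L1_boundary_norm n a b \<gamma> w + \<tau>" using \<sigma>L by simp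
      finally show ?case by simp
    qed
  qed
  ultimately show ?thesis using \<eta>(1-4) by (intro exI[of _ \<eta>] conjI allI ballI impI) blast+
qed

section \<open>The energy estimate and the theorem\<close>

lemma unit_slope_sum_eq: "(\<Sum>b\<in>Basis. unit_slope b p * (y \<bullet> b)) = inv_area p * (p \<bullet> y)"
proof -
  have "inv_area p * (p \<bullet> y) = inv_area p * (\<Sum>b\<in>Basis. (p \<bullet> b) * (y \<bullet> b))"
    by (simp only: euclidean_inner[of p y])
  then show ?thesis by (simp add: sum_distrib_left unit_slope_def mult_ac)
qed

lemma abs_unit_slope_sum_le: "\<bar>\<Sum>b\<in>Basis. unit_slope b p * (y \<bullet> b)\<bar> \<le> norm y"
proof -
  have "\<bar>inv_area p * (p \<bullet> y)\<bar> \<le> inv_area p * (norm p * norm y)"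
    using inv_area_bounds[of p] Cauchy_Schwarz_ineq2[of p y] by (simp add: abs_mult)
  also have "\<dots> = (norm p * inv_area p) * norm y" by simp
  also have "\<dots> \<le> 1 * norm y" by (intro mult_right_mono inv_area_norm) simp
  finally show ?thesis by (simp add: unit_slope_sum_eq)
qed

text \<open>In the weak curvature identity and in the Sobolev inequality \<open>w\<close> is multiplied by the cutoffs. The
  terms in which the cutoff is differentiated give the boundary integral; in the others the cutoffs
  tend to \<open>1\<close> in \<open>\<Omega>\<close>.\<close>

lemma boundary_energy_and_sobolev:
  fixes \<Omega> :: "(real^2) set" and u w :: "real^2 \<Rightarrow> real"
  assumes \<Omega>: "open \<Omega>" "bounded \<Omega>" and arc: "arclength_parametrization n a b \<gamma> (frontier \<Omega>)"
    and u: "in_sobolev 2 \<Omega> u" and v: "W22_approx \<Omega> v u"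
    and w: "C_k (Suc 0) w" "compact (supp w)"
  shows "(LINT x|lebesgue_on \<Omega>. (\<Sum>b\<in>Basis. unit_slope b (weak_grad \<Omega> u x) * partial b w x)) \<le>
      (LINT x|lebesgue_on \<Omega>. \<bar>weak_graph_curvature \<Omega> u x\<bar> * \<bar>w x\<bar>) + 512 * L1_boundary_norm n a b \<gamma> w"
    and "L2_norm_on \<Omega> w \<le> (LINT x|lebesgue_on \<Omega>. norm (grad w x)) + 512 * L1_boundary_norm n a b \<gamma> w"
proof -
  let ?M = "lebesgue_on \<Omega>"
  let ?D = "L1_boundary_norm n a b \<gamma> w"
  let ?H = "weak_graph_curvature \<Omega> u"
  let ?F = "\<lambda>y x. \<Sum>b\<in>Basis. unit_slope b (weak_grad \<Omega> u x) * (y \<bullet> b)"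
  note wu = in_sobolev_2_weak_partials[OF \<Omega>(1) u]
  have wc: "continuous_on UNIV w" "continuous_on UNIV (grad w)"
    using C_k_continuous[OF w(1)] continuous_on_grad[OF w(1)] by auto
  obtain \<eta> :: "nat \<Rightarrow> real^2 \<Rightarrow> real" where
    \<eta>: "\<And>N. C_k (Suc 0) (\<eta> N)" "\<And>N. compact (supp (\<eta> N))" "\<And>N. supp (\<eta> N) \<subseteq> \<Omega>"
      "\<And>N x. 0 \<le> \<eta> N x" "\<And>N x. \<eta> N x \<le> 1"
    and \<eta>1: "\<And>x. x \<in> \<Omega> \<Longrightarrow> (\<lambda>N. \<eta> N x) \<longlonglongrightarrow> 1"
    and \<eta>D: "\<And>\<tau>. \<tau> > 0 \<Longrightarrow> \<forall>\<^sub>F N in sequentially. (LINT x|?M. \<bar>w x\<bar> * norm (grad (\<eta> N) x)) \<le> 512 * ?D + \<tau>"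
    using boundary_cutoffs[OF \<Omega> arc wc(1) w(2)] by blast
  have \<eta>c: "continuous_on UNIV (\<eta> N)" "continuous_on UNIV (grad (\<eta> N))" for N
    using C_k_continuous[OF \<eta>(1)] continuous_on_grad[OF \<eta>(1)] by auto
  have int_c: "integrable ?M f" if "continuous_on UNIV f" for f :: "real^2 \<Rightarrow> real"
    by (intro in_L2_integrable continuous_in_L2 \<Omega> that)
  have Fint: "integrable ?M (\<lambda>x. g x * ?F (y x) x)"
    if "continuous_on UNIV g" "continuous_on UNIV y" for g y
  proof -
    have "integrable ?M (\<lambda>x. \<Sum>b\<in>Basis. unit_slope b (weak_grad \<Omega> u x) * (g x * (y x \<bullet> b)))"
      by (intro Bochner_Integration.integrable_sum L2_mult_integrable unit_slope_in_L2 \<Omega> wu continuous_in_L2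
          continuous_intros that)
    then show ?thesis by (simp add: sum_distrib_left mult_ac)
  qed
  have i_wg: "integrable ?M (\<lambda>x. \<bar>w x\<bar> * norm (grad (\<eta> N) x))" for N
    by (intro int_c continuous_intros wc \<eta>c)
  have d\<eta>: "\<eta> N differentiable at x" and dw: "w differentiable at x" for N x
    using C_k_Suc_differentiable[OF \<eta>(1)] C_k_Suc_differentiable[OF w(1)] by auto
  have gp: "grad (\<lambda>x. \<eta> N x * w x) x = \<eta> N x *\<^sub>R grad w x + w x *\<^sub>R grad (\<eta> N) x" for N x
    by (rule grad_mult[OF d\<eta> dw])
  have \<zeta>: "C_k (Suc 0) (\<lambda>x. \<eta> N x * w x)" "compact (supp (\<lambda>x. \<eta> N x * w x))" "supp (\<lambda>x. \<eta> N x * w x) \<subseteq> \<Omega>" for N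
    using supp_mult[of "\<eta> N" w] \<eta>(3)[of N] by (blast intro: C_k_mult[OF \<eta>(1) w(1)] compact_supp_mult[OF w(2)])+
  have iH: "integrable ?M (\<lambda>x. \<bar>?H x\<bar> * \<bar>w x\<bar>)"
    by (intro L2_mult_integrable in_L2_abs weak_graph_curvature_in_L2 \<Omega> u continuous_in_L2 wc)
  have energy_N: "(LINT x|?M. \<eta> N x * ?F (grad w x) x) \<le>
      (LINT x|?M. \<bar>?H x\<bar> * \<bar>w x\<bar>) + (LINT x|?M. \<bar>w x\<bar> * norm (grad (\<eta> N) x))" for N
  proof -
    have "(LINT x|?M. \<eta> N x * ?F (grad w x) x) + (LINT x|?M. w x * ?F (grad (\<eta> N) x) x) =
        (LINT x|?M. \<eta> N x * ?F (grad w x) x + w x * ?F (grad (\<eta> N) x) x)"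
      by (intro Bochner_Integration.integral_add[symmetric] Fint wc \<eta>c)
    also have "(\<lambda>x. \<eta> N x * ?F (grad w x) x + w x * ?F (grad (\<eta> N) x) x) =
        (\<lambda>x. \<Sum>b\<in>Basis. unit_slope b (weak_grad \<Omega> u x) * partial b (\<lambda>x. \<eta> N x * w x) x)"
    proof
      fix x
      have "(\<Sum>b\<in>Basis. unit_slope b (weak_grad \<Omega> u x) * partial b (\<lambda>x. \<eta> N x * w x) x) =
          ?F (grad (\<lambda>x. \<eta> N x * w x) x) x"
        by (intro sum.cong) (auto simp: grad_inner_Basis)
      also have "\<dots> = \<eta> N x * ?F (grad w x) x + w x * ?F (grad (\<eta> N) x) x"
        unfolding gp unit_slope_sum_eq by (simp add: inner_add_right algebra_simps)
      finally show "\<eta> N x * ?F (grad w x) x + w x * ?F (grad (\<eta> N) x) x =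
          (\<Sum>b\<in>Basis. unit_slope b (weak_grad \<Omega> u x) * partial b (\<lambda>x. \<eta> N x * w x) x)" by simp
    qed
    also have "(LINT x|?M. (\<Sum>b\<in>Basis. unit_slope b (weak_grad \<Omega> u x) * partial b (\<lambda>x. \<eta> N x * w x) x)) =
        - (LINT x|?M. ?H x * (\<eta> N x * w x))"
      by (rule weak_graph_curvature_identity[OF \<Omega> u v \<zeta>])
    finally have eq: "(LINT x|?M. \<eta> N x * ?F (grad w x) x) =
        - (LINT x|?M. ?H x * (\<eta> N x * w x)) - (LINT x|?M. w x * ?F (grad (\<eta> N) x) x)" by simp
    have "- (LINT x|?M. ?H x * (\<eta> N x * w x)) \<le> (LINT x|?M. norm (?H x * (\<eta> N x * w x)))"
      using integral_norm_bound[of ?M "\<lambda>x. ?H x * (\<eta> N x * w x)"] unfolding real_norm_def by linarith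
    also have "\<dots> \<le> (LINT x|?M. \<bar>?H x\<bar> * \<bar>w x\<bar>)"
    proof (rule integral_mono[OF _ iH])
      show "integrable ?M (\<lambda>x. norm (?H x * (\<eta> N x * w x)))"
        by (intro integrable_norm L2_mult_integrable weak_graph_curvature_in_L2 \<Omega> u continuous_in_L2
            continuous_on_mult wc \<eta>c)
      show "norm (?H x * (\<eta> N x * w x)) \<le> \<bar>?H x\<bar> * \<bar>w x\<bar>" for x
        using \<eta>(4,5)[of N x] by (simp add: abs_mult mult_left_mono mult_left_le_one_le)
    qed
    finally have 1: "- (LINT x|?M. ?H x * (\<eta> N x * w x)) \<le> (LINT x|?M. \<bar>?H x\<bar> * \<bar>w x\<bar>)" .
    have "- (LINT x|?M. w x * ?F (grad (\<eta> N) x) x) \<le> (LINT x|?M. norm (w x * ?F (grad (\<eta> N) x) x))"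
      using integral_norm_bound[of ?M "\<lambda>x. w x * ?F (grad (\<eta> N) x) x"] unfolding real_norm_def by linarith
    also have "\<dots> \<le> (LINT x|?M. \<bar>w x\<bar> * norm (grad (\<eta> N) x))"
    proof (rule integral_mono[OF integrable_norm[OF Fint[OF wc(1) \<eta>c(2)]] i_wg])
      show "norm (w x * ?F (grad (\<eta> N) x) x) \<le> \<bar>w x\<bar> * norm (grad (\<eta> N) x)" for x
        unfolding real_norm_def abs_mult by (intro mult_left_mono abs_unit_slope_sum_le abs_ge_zero)
    qed
    finally have 2: "- (LINT x|?M. w x * ?F (grad (\<eta> N) x) x) \<le> (LINT x|?M. \<bar>w x\<bar> * norm (grad (\<eta> N) x))" .
    show ?thesis unfolding eq using 1 2 by linarith
  qed
  have lim_E: "(\<lambda>N. LINT x|?M. \<eta> N x * ?F (grad w x) x) \<longlonglongrightarrow> (LINT x|?M. ?F (grad w x) x)"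
  proof (rule integral_dominated_convergence[where w = "\<lambda>x. norm (grad w x)"])
    show "(\<lambda>x. ?F (grad w x) x) \<in> borel_measurable ?M"
      using Fint[of "\<lambda>_. 1" "grad w"] wc by (simp add: borel_measurable_integrable)
    show "(\<lambda>x. \<eta> N x * ?F (grad w x) x) \<in> borel_measurable ?M" for N
      using Fint[OF \<eta>c(1) wc(2)] by (rule borel_measurable_integrable)
    show "integrable ?M (\<lambda>x. norm (grad w x))" by (intro int_c continuous_intros wc)
    show "AE x in ?M. (\<lambda>N. \<eta> N x * ?F (grad w x) x) \<longlonglongrightarrow> ?F (grad w x) x"
    proof (rule AE_I2)
      fix x assume "x \<in> space ?M"
      then have "(\<lambda>N. \<eta> N x * ?F (grad w x) x) \<longlonglongrightarrow> 1 * ?F (grad w x) x"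
        by (intro tendsto_mult \<eta>1 tendsto_const) simp
      then show "(\<lambda>N. \<eta> N x * ?F (grad w x) x) \<longlonglongrightarrow> ?F (grad w x) x" by (simp only: mult_1)
    qed
    show "AE x in ?M. norm (\<eta> N x * ?F (grad w x) x) \<le> norm (grad w x)" for N
    proof (rule AE_I2)
      fix x
      have "norm (\<eta> N x * ?F (grad w x) x) \<le> 1 * norm (grad w x)"
        unfolding real_norm_def abs_mult
        using \<eta>(4,5)[of N x] by (intro mult_mono abs_unit_slope_sum_le) auto
      then show "norm (\<eta> N x * ?F (grad w x) x) \<le> norm (grad w x)" by simp
    qed
  qed
  have "(LINT x|?M. ?F (grad w x) x) \<le> (LINT x|?M. \<bar>?H x\<bar> * \<bar>w x\<bar>) + 512 * ?D"
  proof (rule field_le_epsilon)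
    fix \<tau> :: real assume "\<tau> > 0"
    have "\<forall>\<^sub>F N in sequentially. (LINT x|?M. \<eta> N x * ?F (grad w x) x) \<le>
        (LINT x|?M. \<bar>?H x\<bar> * \<bar>w x\<bar>) + 512 * ?D + \<tau>"
      using \<eta>D[OF \<open>\<tau> > 0\<close>] by eventually_elim (rule order_trans[OF energy_N], linarith)
    then show "(LINT x|?M. ?F (grad w x) x) \<le> (LINT x|?M. \<bar>?H x\<bar> * \<bar>w x\<bar>) + 512 * ?D + \<tau>"
      by (rule tendsto_upperbound[OF lim_E]) simp
  qed
  moreover have "(\<lambda>x. ?F (grad w x) x) = (\<lambda>x. \<Sum>b\<in>Basis. unit_slope b (weak_grad \<Omega> u x) * partial b w x)"
    by (intro ext sum.cong) (auto simp: grad_inner_Basis)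
  ultimately show "(LINT x|?M. (\<Sum>b\<in>Basis. unit_slope b (weak_grad \<Omega> u x) * partial b w x)) \<le>
      (LINT x|?M. \<bar>?H x\<bar> * \<bar>w x\<bar>) + 512 * ?D" by simp
  have sob_N: "sqrt (LINT x|?M. (\<eta> N x * w x)\<^sup>2) \<le>
      (LINT x|?M. norm (grad w x)) + (LINT x|?M. \<bar>w x\<bar> * norm (grad (\<eta> N) x))" for N
  proof -
    have z: "\<eta> N x = 0" "grad (\<lambda>x. \<eta> N x * w x) x = 0" if "x \<notin> \<Omega>" for x
    proof -
      show "\<eta> N x = 0" using that \<eta>(3)[of N] not_supp_zero[of x "\<eta> N"] by blast
      have "partial b (\<lambda>x. \<eta> N x * w x) x = 0" for b
        using that \<zeta>(3)[of N] supp_partial[of b "\<lambda>x. \<eta> N x * w x"]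
          not_supp_zero[of x "partial b (\<lambda>x. \<eta> N x * w x)"] by blast
      then show "grad (\<lambda>x. \<eta> N x * w x) x = 0" by (simp add: grad_def)
    qed
    have "(LINT x|?M. (\<eta> N x * w x)\<^sup>2) = (LINT x|lborel. (\<eta> N x * w x)\<^sup>2)"
      by (intro lebesgue_on_integral_supp \<Omega> continuous_intros wc \<eta>c) (simp add: z)
    then have "sqrt (LINT x|?M. (\<eta> N x * w x)\<^sup>2) \<le> (LINT x|lborel. norm (grad (\<lambda>x. \<eta> N x * w x) x))"
      using planar_sobolev_inequality[OF \<zeta>(1,2)] by simp
    also have "\<dots> = (LINT x|?M. norm (grad (\<lambda>x. \<eta> N x * w x) x))"
      by (intro lebesgue_on_integral_supp[symmetric] \<Omega> continuous_on_norm continuous_on_grad \<zeta>) (simp add: z)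
    also have "\<dots> \<le> (LINT x|?M. norm (grad w x) + \<bar>w x\<bar> * norm (grad (\<eta> N) x))"
    proof (rule integral_mono)
      show "integrable ?M (\<lambda>x. norm (grad (\<lambda>x. \<eta> N x * w x) x))"
        by (intro int_c continuous_on_norm continuous_on_grad \<zeta>)
      show "integrable ?M (\<lambda>x. norm (grad w x) + \<bar>w x\<bar> * norm (grad (\<eta> N) x))"
        by (intro int_c continuous_intros wc \<eta>c)
      fix x
      have "norm (grad (\<lambda>x. \<eta> N x * w x) x) \<le> \<eta> N x * norm (grad w x) + \<bar>w x\<bar> * norm (grad (\<eta> N) x)"
        unfolding gp using \<eta>(4)[of N x] by (intro order_trans[OF norm_triangle_ineq]) simp
      also have "\<dots> \<le> 1 * norm (grad w x) + \<bar>w x\<bar> * norm (grad (\<eta> N) x)"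
        using \<eta>(5)[of N x] by (intro add_mono mult_right_mono) auto
      finally show "norm (grad (\<lambda>x. \<eta> N x * w x) x) \<le> norm (grad w x) + \<bar>w x\<bar> * norm (grad (\<eta> N) x)" by simp
    qed
    also have "\<dots> = (LINT x|?M. norm (grad w x)) + (LINT x|?M. \<bar>w x\<bar> * norm (grad (\<eta> N) x))"
      by (intro Bochner_Integration.integral_add i_wg int_c continuous_on_norm wc)
    finally show ?thesis .
  qed
  have "(\<lambda>N. LINT x|?M. (\<eta> N x * w x)\<^sup>2) \<longlonglongrightarrow> (LINT x|?M. (w x)\<^sup>2)"
  proof (rule integral_dominated_convergence[where w = "\<lambda>x. (w x)\<^sup>2"])
    show "(\<lambda>x. (w x)\<^sup>2) \<in> borel_measurable ?M" "integrable ?M (\<lambda>x. (w x)\<^sup>2)"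
      by (intro borel_measurable_integrable int_c continuous_intros wc)+
    show "(\<lambda>x. (\<eta> N x * w x)\<^sup>2) \<in> borel_measurable ?M" for N
      by (intro borel_measurable_integrable int_c continuous_intros wc \<eta>c)
    show "AE x in ?M. (\<lambda>N. (\<eta> N x * w x)\<^sup>2) \<longlonglongrightarrow> (w x)\<^sup>2"
    proof (rule AE_I2)
      fix x assume "x \<in> space ?M"
      then have "(\<lambda>N. (\<eta> N x * w x)\<^sup>2) \<longlonglongrightarrow> (1 * w x)\<^sup>2"
        by (intro tendsto_power tendsto_mult \<eta>1 tendsto_const) simp
      then show "(\<lambda>N. (\<eta> N x * w x)\<^sup>2) \<longlonglongrightarrow> (w x)\<^sup>2" by simp
    qed
    show "AE x in ?M. norm ((\<eta> N x * w x)\<^sup>2) \<le> (w x)\<^sup>2" for N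
    proof (rule AE_I2)
      fix x
      have "(\<eta> N x)\<^sup>2 \<le> 1" using \<eta>(4,5)[of N x] by (intro power_le_one)
      then show "norm ((\<eta> N x * w x)\<^sup>2) \<le> (w x)\<^sup>2"
        by (simp add: power_mult_distrib mult_left_le_one_le)
    qed
  qed
  then have lim_S: "(\<lambda>N. sqrt (LINT x|?M. (\<eta> N x * w x)\<^sup>2)) \<longlonglongrightarrow> L2_norm_on \<Omega> w"
    unfolding L2_norm_on_def by (rule tendsto_real_sqrt)
  show "L2_norm_on \<Omega> w \<le> (LINT x|?M. norm (grad w x)) + 512 * ?D"
  proof (rule field_le_epsilon)
    fix \<tau> :: real assume "\<tau> > 0"
    have "\<forall>\<^sub>F N in sequentially. sqrt (LINT x|?M. (\<eta> N x * w x)\<^sup>2) \<le> (LINT x|?M. norm (grad w x)) + 512 * ?D + \<tau>"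
      using \<eta>D[OF \<open>\<tau> > 0\<close>] by eventually_elim (rule order_trans[OF sob_N], linarith)
    then show "L2_norm_on \<Omega> w \<le> (LINT x|?M. norm (grad w x)) + 512 * ?D + \<tau>"
      by (rule tendsto_upperbound[OF lim_S]) simp
  qed
qed

lemma L1_boundary_norm_cong:
  assumes "arclength_parametrization n a b \<gamma> S" "\<And>x. x \<in> S \<Longrightarrow> f x = g x"
  shows "L1_boundary_norm n a b \<gamma> f = L1_boundary_norm n a b \<gamma> g"
  unfolding L1_boundary_norm_def
proof (rule sum.cong[OF refl])
  fix k assume "k \<in> {..<n}"
  then have "f (\<gamma> k t) = g (\<gamma> k t)" if "t \<in> {a k..b k}" for t
    using arclength_parametrization_facts(3)[OF assms(1)] that assms(2) by simp
  then show "(LINT t|lebesgue_on {a k..b k}. \<bar>f (\<gamma> k t)\<bar>) = (LINT t|lebesgue_on {a k..b k}. \<bar>g (\<gamma> k t)\<bar>)"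
    by (intro Bochner_Integration.integral_cong) auto
qed

text \<open>The estimates for the approximations contain only the boundary values of \<open>\<phi>\<close>, so they survive the
  passage to \<open>u\<close>.\<close>

lemma limit_energy_and_sobolev:
  fixes \<Omega> :: "(real^2) set" and u \<phi> :: "real^2 \<Rightarrow> real"
  assumes \<Omega>: "open \<Omega>" "bounded \<Omega>" and arc: "arclength_parametrization n a b \<gamma> (frontier \<Omega>)"
    and u: "in_sobolev 2 \<Omega> u" and v: "W22_approx \<Omega> v u"
    and vs: "\<And>i. compact (supp (v i))" and v\<phi>: "\<And>i x. x \<in> frontier \<Omega> \<Longrightarrow> v i x = \<phi> x"
  shows "(LINT x|lebesgue_on \<Omega>. inv_area (weak_grad \<Omega> u x) * (norm (weak_grad \<Omega> u x))\<^sup>2) \<le>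
      L2_norm_on \<Omega> (weak_graph_curvature \<Omega> u) * L2_norm_on \<Omega> u + 512 * L1_boundary_norm n a b \<gamma> \<phi>"
    and "L2_norm_on \<Omega> u \<le> (LINT x|lebesgue_on \<Omega>. norm (weak_grad \<Omega> u x)) + 512 * L1_boundary_norm n a b \<gamma> \<phi>"
    and "integrable (lebesgue_on \<Omega>) (\<lambda>x. inv_area (weak_grad \<Omega> u x) * (norm (weak_grad \<Omega> u x))\<^sup>2)"
    and "integrable (lebesgue_on \<Omega>) (\<lambda>x. norm (weak_grad \<Omega> u x))"
proof -
  let ?M = "lebesgue_on \<Omega>"
  let ?D = "L1_boundary_norm n a b \<gamma> \<phi>"
  let ?H = "weak_graph_curvature \<Omega> u"
  let ?s = "\<lambda>b x. unit_slope b (weak_grad \<Omega> u x)"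
  note wu = in_sobolev_2_weak_partials[OF \<Omega>(1) u]
  have lim0: "L2_lim \<Omega> v u" using v by (simp add: W22_approx_def)
  have lim1: "L2_lim \<Omega> (\<lambda>i. partial b (v i)) (weak_partial \<Omega> b u)" if "b \<in> Basis" for b
    using v that by (auto simp: W22_approx_def)
  have v1: "C_k (Suc 0) (v i)" for i
    using v by (intro C_2_imp_C_1) (simp add: W22_approx_def)
  have D: "L1_boundary_norm n a b \<gamma> (v i) = ?D" for i
    by (rule L1_boundary_norm_cong[OF arc v\<phi>])
  note est = boundary_energy_and_sobolev[OF \<Omega> arc u v v1 vs, unfolded D]
  have one: "in_L2 \<Omega> (\<lambda>_. 1)" by (intro continuous_in_L2 \<Omega> continuous_intros)
  have wi: "integrable ?M (\<lambda>x. \<bar>weak_partial \<Omega> b u x\<bar>)" if "b \<in> Basis" for b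
    by (intro in_L2_integrable \<Omega> in_L2_abs wu that)
  show ng: "integrable ?M (\<lambda>x. norm (weak_grad \<Omega> u x))"
  proof (rule Bochner_Integration.integrable_bound)
    show "integrable ?M (\<lambda>x. \<Sum>b\<in>Basis. \<bar>weak_partial \<Omega> b u x\<bar>)"
      by (intro Bochner_Integration.integrable_sum wi)
    show "(\<lambda>x. norm (weak_grad \<Omega> u x)) \<in> borel_measurable ?M"
      by (intro continuous_weak_grad_measurable wu continuous_intros)
    have "norm (weak_grad \<Omega> u x) \<le> (\<Sum>b\<in>Basis. \<bar>weak_partial \<Omega> b u x\<bar>)" for x
      using norm_le_l1[of "weak_grad \<Omega> u x"] by (simp add: weak_grad_def inner_sum_left_Basis)
    then show "AE x in ?M. norm (norm (weak_grad \<Omega> u x)) \<le> norm (\<Sum>b\<in>Basis. \<bar>weak_partial \<Omega> b u x\<bar>)"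
      by (auto simp: sum_nonneg)
  qed
  have Eeq: "inv_area (weak_grad \<Omega> u x) * (norm (weak_grad \<Omega> u x))\<^sup>2 = (\<Sum>b\<in>Basis. ?s b x * weak_partial \<Omega> b u x)" for x
  proof -
    have "(\<Sum>b\<in>Basis. ?s b x * weak_partial \<Omega> b u x) = (\<Sum>b\<in>Basis. ?s b x * (weak_grad \<Omega> u x \<bullet> b))"
      by (intro sum.cong) (auto simp: weak_grad_def inner_sum_left_Basis)
    then show ?thesis by (simp add: unit_slope_sum_eq power2_norm_eq_inner)
  qed
  have Ei: "integrable ?M (\<lambda>x. \<Sum>b\<in>Basis. ?s b x * weak_partial \<Omega> b u x)"
    by (intro Bochner_Integration.integrable_sum L2_mult_integrable unit_slope_in_L2 \<Omega> wu)
  then show "integrable ?M (\<lambda>x. inv_area (weak_grad \<Omega> u x) * (norm (weak_grad \<Omega> u x))\<^sup>2)"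
    unfolding Eeq .
  have norm_lim: "(\<lambda>i. L2_norm_on \<Omega> (v i)) \<longlonglongrightarrow> L2_norm_on \<Omega> u"
    unfolding L2_norm_on_def by (intro tendsto_real_sqrt L2_lim_norm_sq lim0)
  have E_lim: "(\<lambda>i. LINT x|?M. (\<Sum>b\<in>Basis. ?s b x * partial b (v i) x)) \<longlonglongrightarrow>
      (LINT x|?M. (\<Sum>b\<in>Basis. ?s b x * weak_partial \<Omega> b u x))"
  proof (rule L1_null_tendsto[OF _ _ Ei])
    show "L1_null \<Omega> (\<lambda>i x. \<Sum>b\<in>Basis. \<bar>partial b (v i) x - weak_partial \<Omega> b u x\<bar> * \<bar>?s b x\<bar>)"
      by (intro L1_null_sum finite_Basis L2_lim_L1_null lim1 unit_slope_in_L2 \<Omega> wu)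
    show "integrable ?M (\<lambda>x. \<Sum>b\<in>Basis. ?s b x * partial b (v i) x)" for i
      by (intro Bochner_Integration.integrable_sum L2_mult_integrable unit_slope_in_L2 \<Omega> wu continuous_in_L2
          C_1_partial_continuous[OF v1])
    fix i x
    have "(\<Sum>b\<in>Basis. ?s b x * partial b (v i) x) - (\<Sum>b\<in>Basis. ?s b x * weak_partial \<Omega> b u x) =
        (\<Sum>b\<in>Basis. (partial b (v i) x - weak_partial \<Omega> b u x) * ?s b x)"
      by (simp add: sum_subtractf[symmetric] algebra_simps)
    then show "\<bar>(\<Sum>b\<in>Basis. ?s b x * partial b (v i) x) - (\<Sum>b\<in>Basis. ?s b x * weak_partial \<Omega> b u x)\<bar> \<le>
        (\<Sum>b\<in>Basis. \<bar>partial b (v i) x - weak_partial \<Omega> b u x\<bar> * \<bar>?s b x\<bar>)"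
      using sum_abs[of "\<lambda>b. (partial b (v i) x - weak_partial \<Omega> b u x) * ?s b x" Basis] by (simp add: abs_mult)
  qed
  have "(LINT x|?M. (\<Sum>b\<in>Basis. ?s b x * weak_partial \<Omega> b u x)) \<le> L2_norm_on \<Omega> ?H * L2_norm_on \<Omega> u + 512 * ?D"
  proof (rule LIMSEQ_le[OF E_lim])
    show "(\<lambda>i. L2_norm_on \<Omega> ?H * L2_norm_on \<Omega> (v i) + 512 * ?D) \<longlonglongrightarrow> L2_norm_on \<Omega> ?H * L2_norm_on \<Omega> u + 512 * ?D"
      by (intro tendsto_intros norm_lim)
    have "(LINT x|?M. (\<Sum>b\<in>Basis. ?s b x * partial b (v i) x)) \<le> L2_norm_on \<Omega> ?H * L2_norm_on \<Omega> (v i) + 512 * ?D" for i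
      using est(1)[of i] L2_Cauchy_Schwarz[OF weak_graph_curvature_in_L2[OF \<Omega>(1) u]
          continuous_in_L2[OF \<Omega> C_k_continuous[OF v1]], of i] by linarith
    then show "\<exists>N. \<forall>i\<ge>N. (LINT x|?M. (\<Sum>b\<in>Basis. ?s b x * partial b (v i) x)) \<le>
        L2_norm_on \<Omega> ?H * L2_norm_on \<Omega> (v i) + 512 * ?D" by blast
  qed
  then show "(LINT x|?M. inv_area (weak_grad \<Omega> u x) * (norm (weak_grad \<Omega> u x))\<^sup>2) \<le>
      L2_norm_on \<Omega> ?H * L2_norm_on \<Omega> u + 512 * ?D"
    unfolding Eeq .
  have A_lim: "(\<lambda>i. LINT x|?M. norm (grad (v i) x)) \<longlonglongrightarrow> (LINT x|?M. norm (weak_grad \<Omega> u x))"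
  proof (rule L1_null_tendsto[OF _ _ ng])
    show "L1_null \<Omega> (\<lambda>i x. \<Sum>b\<in>Basis. \<bar>partial b (v i) x - weak_partial \<Omega> b u x\<bar> * \<bar>1\<bar>)"
      by (intro L1_null_sum finite_Basis L2_lim_L1_null lim1 one)
    show "integrable ?M (\<lambda>x. norm (grad (v i) x))" for i
      by (intro in_L2_integrable continuous_in_L2 \<Omega> continuous_on_norm continuous_on_grad v1)
    fix i x
    show "\<bar>norm (grad (v i) x) - norm (weak_grad \<Omega> u x)\<bar> \<le>
        (\<Sum>b\<in>Basis. \<bar>partial b (v i) x - weak_partial \<Omega> b u x\<bar> * \<bar>1\<bar>)"
      using norm_triangle_ineq3[of "grad (v i) x" "weak_grad \<Omega> u x"] norm_grad_diff_le[of "v i" x \<Omega> u] by simp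
  qed
  show "L2_norm_on \<Omega> u \<le> (LINT x|?M. norm (weak_grad \<Omega> u x)) + 512 * ?D"
  proof (rule LIMSEQ_le[OF norm_lim])
    show "(\<lambda>i. (LINT x|?M. norm (grad (v i) x)) + 512 * ?D) \<longlonglongrightarrow> (LINT x|?M. norm (weak_grad \<Omega> u x)) + 512 * ?D"
      by (intro tendsto_intros A_lim)
    show "\<exists>N. \<forall>i\<ge>N. L2_norm_on \<Omega> (v i) \<le> (LINT x|?M. norm (grad (v i) x)) + 512 * ?D"
      using est(2) by blast
  qed
qed

text \<open>The energy density \<open>|p|\<^sup>2 / Q\<close> is at least \<open>|p|\<^sup>2 / (1 + |p|)\<close>; where \<open>|p| > \<tau>\<close>, the factor
  \<open>|p| / (1 + |p|)\<close> exceeds \<open>\<tau> / (1 + \<tau>)\<close>.\<close>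

lemma norm_le_energy_density:
  assumes "\<tau> > 0"
  shows "norm p \<le> \<tau> + (1 + \<tau>) / \<tau> * (inv_area p * (norm p)\<^sup>2)"
proof (cases "norm p \<le> \<tau>")
  case True
  have "0 \<le> (1 + \<tau>) / \<tau> * (inv_area p * (norm p)\<^sup>2)"
    using assms inv_area_bounds[of p] by (intro mult_nonneg_nonneg) auto
  with True show ?thesis by linarith
next
  case False
  have "sqrt (1 + (norm p)\<^sup>2) \<le> 1 + norm p"
    by (rule real_le_lsqrt) (auto simp: power2_sum)
  then have "1 / (1 + norm p) \<le> inv_area p"
    unfolding inv_area_def by (intro divide_left_mono) (auto simp: add_pos_nonneg intro!: mult_pos_pos)
  then have 1: "(norm p)\<^sup>2 * (1 / (1 + norm p)) \<le> (norm p)\<^sup>2 * inv_area p"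
    by (intro mult_left_mono) auto
  have "\<tau> * (1 + norm p) \<le> (1 + \<tau>) * norm p" using False by (simp add: algebra_simps)
  then have "1 \<le> (1 + \<tau>) / \<tau> * (norm p / (1 + norm p))"
    using assms by (simp add: divide_simps add_pos_nonneg algebra_simps)
  then have "norm p * 1 \<le> norm p * ((1 + \<tau>) / \<tau> * (norm p / (1 + norm p)))"
    by (intro mult_left_mono) auto
  also have "\<dots> = (1 + \<tau>) / \<tau> * ((norm p)\<^sup>2 * (1 / (1 + norm p)))"
    by (simp add: power2_eq_square)
  also have "\<dots> \<le> (1 + \<tau>) / \<tau> * ((norm p)\<^sup>2 * inv_area p)"
    by (rule mult_left_mono[OF 1]) (use assms in simp)
  finally have "norm p \<le> (1 + \<tau>) / \<tau> * (inv_area p * (norm p)\<^sup>2)"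
    by (simp only: mult_1_right mult.commute[of "inv_area p"])
  then show ?thesis using assms by linarith
qed

lemma willmore_bound_curvature:
  fixes u :: "'a::euclidean_space \<Rightarrow> real"
  assumes \<Omega>: "open \<Omega>" "bounded \<Omega>" and u: "in_sobolev 2 \<Omega> u" and v: "W22_approx \<Omega> v u"
    and W: "willmore \<Omega> u \<le> ennreal \<delta>" and \<delta>: "\<delta> \<ge> 0"
  shows "L2_norm_on \<Omega> (weak_graph_curvature \<Omega> u) \<le> 2 * sqrt \<delta>"
proof -
  let ?M = "lebesgue_on \<Omega>" and ?H = "weak_graph_curvature \<Omega> u"
  have "ennreal (1/4) * (\<integral>\<^sup>+x. ennreal ((?H x)\<^sup>2) \<partial>?M) \<le> willmore \<Omega> u"
    unfolding willmore_def
  proof (intro mult_left_mono nn_integral_mono_AE)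
    have Q: "1 \<le> area_element \<Omega> u x" for x unfolding area_element_def by (rule real_le_rsqrt) simp
    show "AE x in ?M. ennreal ((?H x)\<^sup>2) \<le> ennreal ((graph_mean_curvature \<Omega> u x)\<^sup>2 * area_element \<Omega> u x)"
      using graph_mean_curvature_AE[OF \<Omega> u v]
    proof eventually_elim
      case (elim x)
      have "(?H x)\<^sup>2 * 1 \<le> (?H x)\<^sup>2 * area_element \<Omega> u x" by (intro mult_left_mono Q) simp
      then show ?case unfolding elim by (intro ennreal_leI) simp
    qed
  qed simp
  also note W
  also have "(\<integral>\<^sup>+x. ennreal ((?H x)\<^sup>2) \<partial>?M) = ennreal (LINT x|?M. (?H x)\<^sup>2)"
    using weak_graph_curvature_in_L2[OF \<Omega>(1) u] by (intro nn_integral_eq_integral) (auto simp: in_L2_def)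
  finally have "ennreal (1 / 4 * (LINT x|?M. (?H x)\<^sup>2)) \<le> ennreal \<delta>"
    by (subst ennreal_mult) auto
  then have "1 / 4 * (LINT x|?M. (?H x)\<^sup>2) \<le> \<delta>" using \<delta> by (subst (asm) ennreal_le_iff)
  then have "(LINT x|?M. (?H x)\<^sup>2) \<le> 4 * \<delta>" by simp
  then have "L2_norm_on \<Omega> ?H \<le> sqrt (4 * \<delta>)" unfolding L2_norm_on_def by (rule real_sqrt_le_mono)
  then show ?thesis by (simp add: real_sqrt_mult)
qed

text \<open>Here \<open>m\<close> is the area of the domain, \<open>H\<close> and \<open>U\<close> are the \<open>L\<^sup>2\<close>-norms of the curvature and of the
  solution, \<open>D\<close> is the boundary norm, \<open>E\<close> the energy and \<open>A\<close> the total variation.\<close>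

lemma absorption:
  fixes m \<epsilon> :: real
  assumes "m \<ge> 0" "\<epsilon> > 0"
  shows "\<exists>\<delta>>0. \<forall>H D E U A. 0 \<le> H \<longrightarrow> H \<le> 2 * sqrt \<delta> \<longrightarrow> D \<le> \<delta> \<longrightarrow> 0 \<le> U \<longrightarrow>
    E \<le> H * U + 512 * D \<longrightarrow> U \<le> A + 512 * D \<longrightarrow> (\<forall>\<tau>>0. A \<le> \<tau> * m + (1 + \<tau>) / \<tau> * E) \<longrightarrow> U < \<epsilon>"
proof -
  \<comment> \<open>\<open>\<tau>\<close> makes \<open>\<tau> m\<close> at most \<open>\<epsilon> / 4\<close>. In \<open>\<delta>\<close> the first term gives \<open>\<kappa> H \<le> 1 / 2\<close>, so that half of \<open>U\<close>
    is absorbed, and the second makes the boundary contribution small.\<close>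
  define \<tau> where "\<tau> = \<epsilon> / (4 * (m + 1))"
  have \<tau>: "\<tau> > 0" using assms by (simp add: \<tau>_def)
  have \<tau>m: "\<tau> * m \<le> \<epsilon> / 4"
  proof -
    have "\<tau> * m = \<epsilon> / 4 * (m / (m + 1))" using assms by (simp add: \<tau>_def)
    also have "\<dots> \<le> \<epsilon> / 4 * 1" using assms by (intro mult_left_mono) auto
    finally show ?thesis by simp
  qed
  define \<kappa> where "\<kappa> = (1 + \<tau>) / \<tau>"
  have \<kappa>: "\<kappa> > 0" using \<tau> by (simp add: \<kappa>_def)
  define \<delta> where "\<delta> = min ((1 / (4 * \<kappa>))\<^sup>2) (\<epsilon> / (4096 * (\<kappa> + 1)))"
  have \<delta>: "\<delta> > 0" using \<kappa> assms by (simp add: \<delta>_def)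
  have sq: "sqrt \<delta> \<le> 1 / (4 * \<kappa>)"
    using \<kappa> by (intro real_le_lsqrt) (auto simp: \<delta>_def)
  have \<delta>2: "1024 * (\<kappa> + 1) * \<delta> < \<epsilon> / 2"
  proof -
    have "1024 * (\<kappa> + 1) * \<delta> \<le> 1024 * (\<kappa> + 1) * (\<epsilon> / (4096 * (\<kappa> + 1)))"
      using \<kappa> by (intro mult_left_mono) (auto simp: \<delta>_def)
    also have "\<dots> = \<epsilon> / 4" using \<kappa> by (simp add: divide_simps)
    finally show ?thesis using assms by simp
  qed
  show ?thesis
  proof (intro exI[of _ \<delta>] conjI \<delta> allI impI)
    fix H D E U A :: real
    assume H: "0 \<le> H" "H \<le> 2 * sqrt \<delta>" and D: "D \<le> \<delta>" and U: "0 \<le> U" and E: "E \<le> H * U + 512 * D"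
      and UA: "U \<le> A + 512 * D" and A: "\<forall>\<tau>>0. A \<le> \<tau> * m + (1 + \<tau>) / \<tau> * E"
    have "A \<le> \<tau> * m + \<kappa> * E" using A \<tau> by (simp add: \<kappa>_def)
    also have "\<dots> \<le> \<epsilon> / 4 + \<kappa> * (H * U + 512 * D)" using \<tau>m E \<kappa> by (intro add_mono mult_left_mono) auto
    finally have 1: "U \<le> \<epsilon> / 4 + (\<kappa> * H) * U + 512 * ((\<kappa> + 1) * D)"
      using UA by (simp add: algebra_simps)
    have "\<kappa> * H \<le> \<kappa> * (2 * (1 / (4 * \<kappa>)))" using H(2) sq \<kappa> by (intro mult_left_mono) auto
    also have "\<dots> = 1 / 2" using \<kappa> by simp
    finally have "(\<kappa> * H) * U \<le> 1 / 2 * U" using U by (intro mult_right_mono)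
    moreover have "(\<kappa> + 1) * D \<le> (\<kappa> + 1) * \<delta>" using D \<kappa> by (intro mult_left_mono) auto
    ultimately show "U < \<epsilon>" using 1 \<delta>2 by linarith
  qed
qed

theorem theorem3:
  fixes \<Omega> :: "(real^2) set" and K \<epsilon> :: real
  assumes "smooth_bounded_domain \<Omega>" and "K > 0" and "\<epsilon> > 0"
  shows "\<exists>\<delta>>0. \<forall>(\<phi> :: real^2 \<Rightarrow> real) (u :: real^2 \<Rightarrow> real) n a b \<gamma>.
           C2_compact \<phi> \<longrightarrow>
           in_sobolev 2 \<Omega> u \<longrightarrow>
           in_sobolev_0 2 \<Omega> (\<lambda>x. u x - \<phi> x) \<longrightarrow>
           arclength_parametrization n a b \<gamma> (frontier \<Omega>) \<longrightarrow>
           L1_tangential_norm n a b \<gamma> \<phi> < K \<longrightarrow>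
           willmore \<Omega> u + ennreal (L1_boundary_norm n a b \<gamma> \<phi>) \<le> ennreal \<delta> \<longrightarrow>
           L2_norm_on \<Omega> u < \<epsilon>"
proof -
  have \<Omega>: "open \<Omega>" "bounded \<Omega>" using assms(1) by (auto simp: smooth_bounded_domain_def)
  define m where "m = measure (lebesgue_on \<Omega>) \<Omega>"
  have "m \<ge> 0" by (simp add: m_def)
  from absorption[OF this assms(3)] obtain \<delta> where \<delta>: "\<delta> > 0"
    and absorb: "\<And>H D E U A. 0 \<le> H \<Longrightarrow> H \<le> 2 * sqrt \<delta> \<Longrightarrow> D \<le> \<delta> \<Longrightarrow> 0 \<le> U \<Longrightarrow>
      E \<le> H * U + 512 * D \<Longrightarrow> U \<le> A + 512 * D \<Longrightarrow> (\<forall>\<tau>>0. A \<le> \<tau> * m + (1 + \<tau>) / \<tau> * E) \<Longrightarrow> U < \<epsilon>"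
    by blast
  show ?thesis
  proof (intro exI[of _ \<delta>] conjI \<delta> allI impI)
    fix \<phi> u :: "real^2 \<Rightarrow> real" and n a b \<gamma>
    assume \<phi>: "C2_compact \<phi>" and u: "in_sobolev 2 \<Omega> u" and u0: "in_sobolev_0 2 \<Omega> (\<lambda>x. u x - \<phi> x)"
      and arc: "arclength_parametrization n a b \<gamma> (frontier \<Omega>)"
      and small: "willmore \<Omega> u + ennreal (L1_boundary_norm n a b \<gamma> \<phi>) \<le> ennreal \<delta>"
    let ?M = "lebesgue_on \<Omega>"
    let ?D = "L1_boundary_norm n a b \<gamma> \<phi>"
    interpret finite_measure ?M by (rule finite_measure_bounded_open[OF \<Omega>])
    obtain v where v: "W22_approx \<Omega> v u" "\<And>i. compact (supp (v i))"
      "\<And>i x. x \<in> frontier \<Omega> \<Longrightarrow> v i x = \<phi> x"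
      using exists_W22_approx[OF \<Omega> \<phi> u u0] by blast
    note lim = limit_energy_and_sobolev[OF \<Omega> arc u v]
    have "ennreal ?D \<le> willmore \<Omega> u + ennreal ?D" by simp
    then have "ennreal ?D \<le> ennreal \<delta>" using small by (rule order_trans)
    then have D: "?D \<le> \<delta>" using \<delta> by (subst (asm) ennreal_le_iff) auto
    have "willmore \<Omega> u \<le> willmore \<Omega> u + ennreal ?D" by simp
    then have W: "willmore \<Omega> u \<le> ennreal \<delta>" using small by (rule order_trans)
    show "L2_norm_on \<Omega> u < \<epsilon>"
    proof (rule absorb[OF L2_norm_on_nonneg willmore_bound_curvature[OF \<Omega> u v(1) W] D L2_norm_on_nonneg lim(1,2)])
      show "\<forall>\<tau>>0. (LINT x|?M. norm (weak_grad \<Omega> u x)) \<le>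
          \<tau> * m + (1 + \<tau>) / \<tau> * (LINT x|?M. inv_area (weak_grad \<Omega> u x) * (norm (weak_grad \<Omega> u x))\<^sup>2)"
      proof (intro allI impI)
        fix \<tau> :: real assume \<tau>: "\<tau> > 0"
        have "(LINT x|?M. norm (weak_grad \<Omega> u x)) \<le>
            (LINT x|?M. \<tau> + (1 + \<tau>) / \<tau> * (inv_area (weak_grad \<Omega> u x) * (norm (weak_grad \<Omega> u x))\<^sup>2))"
          by (intro integral_mono lim(4) norm_le_energy_density \<tau> Bochner_Integration.integrable_add
              integrable_const integrable_mult_right lim(3))
        also have "\<dots> = \<tau> * m + (1 + \<tau>) / \<tau> * (LINT x|?M. inv_area (weak_grad \<Omega> u x) * (norm (weak_grad \<Omega> u x))\<^sup>2)"
          using lim(3) by (subst Bochner_Integration.integral_add) (auto simp: m_def)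
        finally show "(LINT x|?M. norm (weak_grad \<Omega> u x)) \<le>
          \<tau> * m + (1 + \<tau>) / \<tau> * (LINT x|?M. inv_area (weak_grad \<Omega> u x) * (norm (weak_grad \<Omega> u x))\<^sup>2)" .
      qed
    qed (use \<delta> in simp)
  qed
qed

end
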